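(* Let $N\ge 2$ be an integer, let $m_0\in L^\infty(\mathbb{T})$, and suppose that $m_0$ does not vanish on a subset of $\mathbb{T}$ of positive measure. Let $$(Rf)(z)=\frac1N\sum_{w^N=z}|m_0(w)|^2f(w),\qquad f\in L^1(\mathbb{T}).$$ (i) There is a one-to-one correspondence between the data (a) and (b) below, where (b) is understood up to unitary equivalence (a unitary equivalence being a unitary operator that intertwines the representations and carries the distinguished vector to the distinguished vector): (a) functions $h\in L^1(\mathbb{T})$ with $h\ge 0$ and $R(h)=h$; (b) normal representations $\tilde\pi=(\pi,U)\in\operatorname{Rep}(\mathfrak{A}_N,\mathcal{H})$ on a Hilbert space $\mathcal{H}$, together with a cyclic vector $\varphi\in\mathcal{H}$ satisfying $U\varphi=\pi(m_0)\varphi$. (ii) From (a) to (b), the correspondence is given by $$\langle\varphi,\pi(f)\varphi\rangle_{\mathcal{H}}=\int_{\mathbb{T}}fh\,d\mu,\qquad f\in L^\infty(\mathbb{T}).$$ From (b) to (a), the correspondence is given by $$h(z)=h_\varphi(z)=\sum_{n\in\mathbb{Z}}z^n\langle\pi(e_n)\varphi,\varphi\rangle_{\mathcal{H}},$$ that is, $h_\varphi$ is the $L^1(\mathbb{T})$-function with these Fourier coefficients. (iii) When $h$ as in (a) is given, and $\tilde\pi\in\operatorname{Rep}(\mathfrak{A}_N,\mathcal{H})$ is the corresponding cyclic representation with $U\varphi=\pi(m_0)\varphi$, then the representation is unique from $h$ and the formula $\langle\varphi,\pi(f)\varphi\rangle=\int_{\mathbb{T}}fh\,d\mu$ up to unitary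 equivalence: if $\tilde\pi'=(\pi',U')\in\operatorname{Rep}(\mathfrak{A}_N,\mathcal{H}')$ has a cyclic vector $\varphi'\in\mathcal{H}'$ with $\langle\varphi',\pi'(f)\varphi'\rangle=\int_{\mathbb{T}}fh\,d\mu$ for all $f\in L^\infty(\mathbb{T})$ and $U'\varphi'=\pi'(m_0)\varphi'$, then there is a unitary isomorphism $W$ of $\mathcal{H}$ onto $\mathcal{H}'$ such that $W\tilde\pi(A)=\tilde\pi'(A)W$ for all $A\in\mathfrak{A}_N$, and $W\varphi=\varphi'$.
   Context: $\mathbb{T}$ is the unit circle, $\mu$ its normalized Haar measure, and $e_n(z)=z^n$ for $n\in\mathbb{Z}$. Inner products are linear in the second variable. $\mathfrak{A}_N$ is the $C^*$-algebra generated by $L^\infty(\mathbb{T})$ and a single unitary element $U$ subject to $UfU^{-1}=f(z^N)$, $f\in L^\infty(\mathbb{T})$. A representation $\tilde\pi$ of $\mathfrak{A}_N$ on a Hilbert space $\mathcal{H}$ amounts to a pair $(\pi,U)$, where $\pi$ is a $*$-representation of $L^\infty(\mathbb{T})$ on $\mathcal{H}$ (given by $\pi(f)=f(V)$, the functional calculus of the unitary operator $V=\pi(e_1)$) and $U$ is a unitary operator on $\mathcal{H}$ with $U\pi(f)U^{-1}=\pi(f(z^N))$ for all $f\in L^\infty(\mathbb{T})$. A vector $\varphi$ is cyclic if $\{\tilde\pi(A)\varphi: A\in\mathfrak{A}_N\}$ is dense in $\mathcal{H}$. If $V=\int_{\mathbb{T}}\lambda\,E(d\lambda)$ is the spectral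 resolution of $V$, the representation with cyclic vector $\varphi$ is called normal if the measure $\|E(\cdot)\varphi\|^2$ is absolutely continuous with respect to $\mu$; $\operatorname{Rep}(\mathfrak{A}_N,\mathcal{H})$ denotes the normal representations on $\mathcal{H}$. *)

theory Defs
  imports "HOL-Analysis.Analysis"
begin

section \<open>The unit circle\<close>

text \<open>Normalized arc length, i.e. normalized Haar measure, on the Borel sets of the unit circle.
  Functions on the circle have type \<^typ>\<open>complex \<Rightarrow> complex\<close>; their values off the circle are
  irrelevant. Elements of the Lebesgue spaces are represented by functions, and all notions below
  are invariant under equality almost everywhere.\<close>

definition circle_measure :: "complex measure" where
  "circle_measure = distr (restrict_space lborel {0..<1}) (restrict_space borel (sphere 0 1))
     (\<lambda>t. cis (2 * pi * t))"

definition Linf :: "(complex \<Rightarrow> complex) set" where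
  "Linf = {f \<in> borel_measurable circle_measure.
     \<exists>C::real. AE z in circle_measure. cmod (f z) \<le> C}"

definition monom_fun :: "int \<Rightarrow> complex \<Rightarrow> complex" where
  "monom_fun n = (\<lambda>z. z powi n)"

definition fourier_coeff :: "(complex \<Rightarrow> complex) \<Rightarrow> int \<Rightarrow> complex" where
  "fourier_coeff h n = (LINT z|circle_measure. monom_fun (- n) z * h z)"

definition ruelle :: "nat \<Rightarrow> (complex \<Rightarrow> complex) \<Rightarrow> (complex \<Rightarrow> complex) \<Rightarrow> complex \<Rightarrow> complex" where
  "ruelle N m0 f = (\<lambda>z. (\<Sum>w | w ^ N = z. of_real ((cmod (m0 w))\<^sup>2) * f w) / of_nat N)"

definition ruelle_harmonic :: "nat \<Rightarrow> (complex \<Rightarrow> complex) \<Rightarrow> (complex \<Rightarrow> complex) set" where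
  "ruelle_harmonic N m0 = {h. integrable circle_measure h \<and>
     (AE z in circle_measure. h z \<in> \<real>\<^sub>\<ge>\<^sub>0) \<and>
     (AE z in circle_measure. ruelle N m0 h z = h z)}"

definition L1_eq :: "((complex \<Rightarrow> complex) \<times> (complex \<Rightarrow> complex)) set" where
  "L1_eq = {(h, h'). integrable circle_measure h \<and> integrable circle_measure h' \<and>
     (AE z in circle_measure. h z = h' z)}"


section \<open>Complex Hilbert spaces and their operators\<close>

text \<open>A Hilbert space is given by a carrier set and its operations, so that one can quantify over
  Hilbert spaces. Operators are functions on the whole type of which only the restriction to the
  carrier matters.\<close>

record 'a hilb =
  hcarrier :: "'a set"
  hzero :: 'a
  hadd :: "'a \<Rightarrow> 'a \<Rightarrow> 'a"
  hscale :: "complex \<Rightarrow> 'a \<Rightarrow> 'a"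
  hinner :: "'a \<Rightarrow> 'a \<Rightarrow> complex"

definition hnorm :: "'a hilb \<Rightarrow> 'a \<Rightarrow> real" where
  "hnorm H x = sqrt (Re (hinner H x x))"

definition hminus :: "'a hilb \<Rightarrow> 'a \<Rightarrow> 'a \<Rightarrow> 'a" where
  "hminus H x y = hadd H x (hscale H (- 1) y)"

text \<open>The value off the carrier only serves the locale \<^locale>\<open>Metric_space\<close>, which requires
  nonnegativity and symmetry on the whole type.\<close>

definition hdist :: "'a hilb \<Rightarrow> 'a \<Rightarrow> 'a \<Rightarrow> real" where
  "hdist H x y = (if x \<in> hcarrier H \<and> y \<in> hcarrier H then hnorm H (hminus H x y) else 0)"

text \<open>The inner product is linear in the second variable.\<close>

locale hilbert_space =
  fixes H :: "'a hilb"
  assumes zero_closed: "hzero H \<in> hcarrier H"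
    and add_closed: "\<And>x y. x \<in> hcarrier H \<Longrightarrow> y \<in> hcarrier H \<Longrightarrow> hadd H x y \<in> hcarrier H"
    and scale_closed: "\<And>a x. x \<in> hcarrier H \<Longrightarrow> hscale H a x \<in> hcarrier H"
    and add_assoc: "\<And>x y z. x \<in> hcarrier H \<Longrightarrow> y \<in> hcarrier H \<Longrightarrow> z \<in> hcarrier H \<Longrightarrow>
      hadd H (hadd H x y) z = hadd H x (hadd H y z)"
    and add_commute: "\<And>x y. x \<in> hcarrier H \<Longrightarrow> y \<in> hcarrier H \<Longrightarrow> hadd H x y = hadd H y x"
    and add_zero: "\<And>x. x \<in> hcarrier H \<Longrightarrow> hadd H x (hzero H) = x"
    and minus_self: "\<And>x. x \<in> hcarrier H \<Longrightarrow> hminus H x x = hzero H"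
    and scale_add_right: "\<And>a x y. x \<in> hcarrier H \<Longrightarrow> y \<in> hcarrier H \<Longrightarrow>
      hscale H a (hadd H x y) = hadd H (hscale H a x) (hscale H a y)"
    and scale_add_left: "\<And>a b x. x \<in> hcarrier H \<Longrightarrow>
      hscale H (a + b) x = hadd H (hscale H a x) (hscale H b x)"
    and scale_scale: "\<And>a b x. x \<in> hcarrier H \<Longrightarrow> hscale H a (hscale H b x) = hscale H (a * b) x"
    and scale_one: "\<And>x. x \<in> hcarrier H \<Longrightarrow> hscale H 1 x = x"
    and inner_cnj: "\<And>x y. x \<in> hcarrier H \<Longrightarrow> y \<in> hcarrier H \<Longrightarrow>
      hinner H y x = cnj (hinner H x y)"
    and inner_add_right: "\<And>x y z. x \<in> hcarrier H \<Longrightarrow> y \<in> hcarrier H \<Longrightarrow> z \<in> hcarrier H \<Longrightarrow>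
      hinner H x (hadd H y z) = hinner H x y + hinner H x z"
    and inner_scale_right: "\<And>a x y. x \<in> hcarrier H \<Longrightarrow> y \<in> hcarrier H \<Longrightarrow>
      hinner H x (hscale H a y) = a * hinner H x y"
    and inner_nonneg: "\<And>x. x \<in> hcarrier H \<Longrightarrow> 0 \<le> Re (hinner H x x)"
    and inner_eq_zeroD: "\<And>x. x \<in> hcarrier H \<Longrightarrow> hinner H x x = 0 \<Longrightarrow> x = hzero H"
    and complete: "Metric_space.mcomplete (hcarrier H) (hdist H)"

definition linear_op :: "'a hilb \<Rightarrow> 'b hilb \<Rightarrow> ('a \<Rightarrow> 'b) \<Rightarrow> bool" where
  "linear_op H K T \<longleftrightarrow>
     (\<forall>x\<in>hcarrier H. T x \<in> hcarrier K) \<and>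
     (\<forall>x\<in>hcarrier H. \<forall>y\<in>hcarrier H. T (hadd H x y) = hadd K (T x) (T y)) \<and>
     (\<forall>a. \<forall>x\<in>hcarrier H. T (hscale H a x) = hscale K a (T x))"

definition bounded_op :: "'a hilb \<Rightarrow> ('a \<Rightarrow> 'a) \<Rightarrow> bool" where
  "bounded_op H T \<longleftrightarrow> linear_op H H T \<and>
     (\<exists>C. \<forall>x\<in>hcarrier H. hnorm H (T x) \<le> C * hnorm H x)"

definition unitary_op :: "'a hilb \<Rightarrow> 'b hilb \<Rightarrow> ('a \<Rightarrow> 'b) \<Rightarrow> bool" where
  "unitary_op H K W \<longleftrightarrow> linear_op H K W \<and> bij_betw W (hcarrier H) (hcarrier K) \<and>
     (\<forall>x\<in>hcarrier H. \<forall>y\<in>hcarrier H. hinner K (W x) (W y) = hinner H x y)"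

definition op_tendsto :: "'a hilb \<Rightarrow> (nat \<Rightarrow> 'a \<Rightarrow> 'a) \<Rightarrow> ('a \<Rightarrow> 'a) \<Rightarrow> bool" where
  "op_tendsto H S T \<longleftrightarrow> (\<forall>\<epsilon>>0. \<forall>\<^sub>F n in sequentially.
     \<forall>x\<in>hcarrier H. hnorm H (hminus H (S n x) (T x)) \<le> \<epsilon> * hnorm H x)"


section \<open>Spectral resolutions\<close>

definition projection_op :: "'a hilb \<Rightarrow> ('a \<Rightarrow> 'a) \<Rightarrow> bool" where
  "projection_op H P \<longleftrightarrow> bounded_op H P \<and>
     (\<forall>x\<in>hcarrier H. P (P x) = P x) \<and>
     (\<forall>x\<in>hcarrier H. \<forall>y\<in>hcarrier H. hinner H (P x) y = hinner H x (P y))"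

definition projection_valued_measure :: "'a hilb \<Rightarrow> (complex set \<Rightarrow> 'a \<Rightarrow> 'a) \<Rightarrow> bool" where
  "projection_valued_measure H E \<longleftrightarrow>
     (\<forall>S\<in>sets circle_measure. projection_op H (E S)) \<and>
     (\<forall>x\<in>hcarrier H. E (space circle_measure) x = x) \<and>
     (\<forall>S\<in>sets circle_measure. \<forall>T\<in>sets circle_measure. \<forall>x\<in>hcarrier H.
        E (S \<inter> T) x = E S (E T x)) \<and>
     (\<forall>A::nat \<Rightarrow> complex set. range A \<subseteq> sets circle_measure \<longrightarrow> disjoint_family A \<longrightarrow>
        (\<forall>x\<in>hcarrier H. \<forall>y\<in>hcarrier H.
           (\<lambda>n. hinner H x (E (A n) y)) sums hinner H x (E (\<Union>n. A n) y)))"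

definition scalar_spectral_measure ::
    "'a hilb \<Rightarrow> (complex set \<Rightarrow> 'a \<Rightarrow> 'a) \<Rightarrow> 'a \<Rightarrow> complex measure" where
  "scalar_spectral_measure H E x = measure_of (space circle_measure) (sets circle_measure)
     (\<lambda>S. ennreal ((hnorm H (E S x))\<^sup>2))"

text \<open>The operator \<open>T\<close> is the spectral integral of \<open>f\<close> with respect to \<open>E\<close>. The quadratic form
  of a bounded operator determines it, so only the positive scalar measures are needed.\<close>

definition is_spectral_integral ::
    "'a hilb \<Rightarrow> (complex set \<Rightarrow> 'a \<Rightarrow> 'a) \<Rightarrow> (complex \<Rightarrow> complex) \<Rightarrow> ('a \<Rightarrow> 'a) \<Rightarrow> bool" where
  "is_spectral_integral H E f T \<longleftrightarrow> (\<forall>x\<in>hcarrier H.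
     integrable (scalar_spectral_measure H E x) f \<and>
     hinner H x (T x) = (LINT z|scalar_spectral_measure H E x. f z))"

definition spectral_resolution ::
    "'a hilb \<Rightarrow> ('a \<Rightarrow> 'a) \<Rightarrow> (complex set \<Rightarrow> 'a \<Rightarrow> 'a) \<Rightarrow> bool" where
  "spectral_resolution H V E \<longleftrightarrow> projection_valued_measure H E \<and>
     is_spectral_integral H E (\<lambda>z. z) V"


section \<open>Representations\<close>

text \<open>Representation data: the Hilbert space, the representation of the essentially bounded
  functions, the unitary \<open>U\<close>, and the distinguished vector.\<close>

record 'a rep =
  rspace :: "'a hilb"
  rfun :: "(complex \<Rightarrow> complex) \<Rightarrow> 'a \<Rightarrow> 'a"
  runi :: "'a \<Rightarrow> 'a"
  rvec :: 'a

definition star_rep :: "'a hilb \<Rightarrow> ((complex \<Rightarrow> complex) \<Rightarrow> 'a \<Rightarrow> 'a) \<Rightarrow> bool" where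
  "star_rep H \<pi> \<longleftrightarrow>
     (\<forall>f\<in>Linf. bounded_op H (\<pi> f)) \<and>
     (\<forall>f\<in>Linf. \<forall>g\<in>Linf. (AE z in circle_measure. f z = g z) \<longrightarrow>
        (\<forall>x\<in>hcarrier H. \<pi> f x = \<pi> g x)) \<and>
     (\<forall>x\<in>hcarrier H. \<pi> (\<lambda>_. 1) x = x) \<and>
     (\<forall>f\<in>Linf. \<forall>g\<in>Linf. \<forall>x\<in>hcarrier H. \<pi> (\<lambda>z. f z + g z) x = hadd H (\<pi> f x) (\<pi> g x)) \<and>
     (\<forall>a. \<forall>f\<in>Linf. \<forall>x\<in>hcarrier H. \<pi> (\<lambda>z. a * f z) x = hscale H a (\<pi> f x)) \<and>
     (\<forall>f\<in>Linf. \<forall>g\<in>Linf. \<forall>x\<in>hcarrier H. \<pi> (\<lambda>z. f z * g z) x = \<pi> f (\<pi> g x)) \<and>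
     (\<forall>f\<in>Linf. \<forall>x\<in>hcarrier H. \<forall>y\<in>hcarrier H.
        hinner H (\<pi> (\<lambda>z. cnj (f z)) x) y = hinner H x (\<pi> f y))"

text \<open>Formal elements of the *-algebra generated by the essentially bounded functions and the
  unitary \<open>U\<close>. Scalars are constant functions, and the algebra is closed under adjoints because
  the adjoints of the generators are \<open>f \<mapsto> cnj f\<close> and \<open>U\<^sup>* = U\<inverse>\<close>.\<close>

datatype alg_term =
    Fn "complex \<Rightarrow> complex"
  | Uni
  | UniInv
  | Plus alg_term alg_term
  | Times alg_term alg_term

primrec alg_wf :: "alg_term \<Rightarrow> bool" where
  "alg_wf (Fn f) \<longleftrightarrow> f \<in> Linf"
| "alg_wf Uni \<longleftrightarrow> True"
| "alg_wf UniInv \<longleftrightarrow> True"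
| "alg_wf (Plus a b) \<longleftrightarrow> alg_wf a \<and> alg_wf b"
| "alg_wf (Times a b) \<longleftrightarrow> alg_wf a \<and> alg_wf b"

primrec alg_eval :: "'a rep \<Rightarrow> alg_term \<Rightarrow> 'a \<Rightarrow> 'a" where
  "alg_eval r (Fn f) = rfun r f"
| "alg_eval r Uni = runi r"
| "alg_eval r UniInv = inv_into (hcarrier (rspace r)) (runi r)"
| "alg_eval r (Plus a b) = (\<lambda>x. hadd (rspace r) (alg_eval r a x) (alg_eval r b x))"
| "alg_eval r (Times a b) = (\<lambda>x. alg_eval r a (alg_eval r b x))"

text \<open>The image of a C*-algebra under a *-homomorphism is norm closed. Hence the image of the
  generated C*-algebra under a representation is the norm closure of the image of the *-algebra
  above, and, applying this to the direct sum of two representations \<open>r\<close> and \<open>s\<close>, the pairs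
  \<open>(r(A), s(A))\<close> with \<open>A\<close> in the C*-algebra are the simultaneous norm limits of the images of
  sequences in the *-algebra.\<close>

definition alg_image :: "'a rep \<Rightarrow> ('a \<Rightarrow> 'a) set" where
  "alg_image r = {A. \<exists>a. (\<forall>n. alg_wf (a n)) \<and> linear_op (rspace r) (rspace r) A \<and>
     op_tendsto (rspace r) (\<lambda>n. alg_eval r (a n)) A}"

definition alg_image2 :: "'a rep \<Rightarrow> 'b rep \<Rightarrow> (('a \<Rightarrow> 'a) \<times> ('b \<Rightarrow> 'b)) set" where
  "alg_image2 r s = {(A, B). \<exists>a. (\<forall>n. alg_wf (a n)) \<and>
     linear_op (rspace r) (rspace r) A \<and> op_tendsto (rspace r) (\<lambda>n. alg_eval r (a n)) A \<and>
     linear_op (rspace s) (rspace s) B \<and> op_tendsto (rspace s) (\<lambda>n. alg_eval s (a n)) B}"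

definition cyclic_vector :: "'a rep \<Rightarrow> bool" where
  "cyclic_vector r \<longleftrightarrow> rvec r \<in> hcarrier (rspace r) \<and>
     Metric_space.mtopology (hcarrier (rspace r)) (hdist (rspace r))
       closure_of {A (rvec r) |A. A \<in> alg_image r} = hcarrier (rspace r)"

text \<open>Normal representations together with a cyclic vector. With \<open>V = \<pi>(e\<^sub>1)\<close>
  and \<open>E\<close> its spectral resolution, \<open>\<pi>(f) = f(V)\<close> is the spectral integral of \<open>f\<close>.\<close>

definition normal_cyclic_rep :: "nat \<Rightarrow> 'a rep \<Rightarrow> bool" where
  "normal_cyclic_rep N r \<longleftrightarrow>
     hilbert_space (rspace r) \<and>
     star_rep (rspace r) (rfun r) \<and>
     unitary_op (rspace r) (rspace r) (runi r) \<and>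
     (\<forall>f\<in>Linf. \<forall>x\<in>hcarrier (rspace r).
        runi r (rfun r f (inv_into (hcarrier (rspace r)) (runi r) x)) = rfun r (\<lambda>z. f (z ^ N)) x) \<and>
     cyclic_vector r \<and>
     (\<exists>E. spectral_resolution (rspace r) (rfun r (monom_fun 1)) E \<and>
        (\<forall>f\<in>Linf. is_spectral_integral (rspace r) E f (rfun r f)) \<and>
        absolutely_continuous circle_measure (scalar_spectral_measure (rspace r) E (rvec r)))"

definition scaling_reps :: "nat \<Rightarrow> (complex \<Rightarrow> complex) \<Rightarrow> 'a rep set" where
  "scaling_reps N m0 = {r. normal_cyclic_rep N r \<and> runi r (rvec r) = rfun r m0 (rvec r)}"

definition unitarily_equivalent :: "'a rep \<Rightarrow> 'b rep \<Rightarrow> bool" where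
  "unitarily_equivalent r s \<longleftrightarrow> (\<exists>W. unitary_op (rspace r) (rspace s) W \<and>
     (\<forall>(A, B)\<in>alg_image2 r s. \<forall>x\<in>hcarrier (rspace r). W (A x) = B (W x)) \<and>
     W (rvec r) = rvec s)"

text \<open>Spaces with a cyclic vector are separable here, so up to unitary equivalence they all live on
  subsets of a type of the cardinality of the continuum; quotients by \<open>rep_eq\<close> are to be
  taken over such a type.\<close>

definition rep_eq :: "nat \<Rightarrow> (complex \<Rightarrow> complex) \<Rightarrow> ('a rep \<times> 'a rep) set" where
  "rep_eq N m0 = {(r, s). r \<in> scaling_reps N m0 \<and> s \<in> scaling_reps N m0 \<and>
     unitarily_equivalent r s}"

definition has_density :: "'a rep \<Rightarrow> (complex \<Rightarrow> complex) \<Rightarrow> bool" where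
  "has_density r h \<longleftrightarrow> (\<forall>f\<in>Linf.
     hinner (rspace r) (rvec r) (rfun r f (rvec r)) = (LINT z|circle_measure. f z * h z))"

text \<open>The integrable function \<open>h\<^sub>\<phi>\<close>, as the set of all its representatives.\<close>

definition h_phi :: "'a rep \<Rightarrow> (complex \<Rightarrow> complex) set" where
  "h_phi r = {h. integrable circle_measure h \<and>
     (\<forall>n. fourier_coeff h n = hinner (rspace r) (rfun r (monom_fun n) (rvec r)) (rvec r))}"

end

theory Submission
  imports Defs
begin

text \<open>From a representation to a density: the measure \<open>\<parallel>E(\<cdot>)\<phi>\<parallel>\<^sup>2\<close> is finite and absolutely continuous, so it has
  a density \<open>h \<ge> 0\<close>, and \<open>\<langle>\<phi>, \<pi>(f)\<phi>\<rangle> = \<integral> f h d\<mu>\<close> (\<open>has_density_exists\<close>). As \<open>U\<close> is isometric with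
  \<open>U\<pi>(f) = \<pi>(f(z\<^sup>N))U\<close> and \<open>U\<phi> = \<pi>(m\<^sub>0)\<phi>\<close>, this functional of \<open>f\<close> is unchanged when \<open>f\<close> is replaced by
  \<open>\<bar>m\<^sub>0\<bar>\<^sup>2 f(z\<^sup>N)\<close>. The transfer operator is the adjoint of that substitution (\<open>integral_ruelle\<close>), so
  \<open>R h = h\<close> (\<open>has_density_harmonic\<close>). An integrable function is determined by its Fourier
  coefficients (\<open>fourier_coeff_eq_imp_AE_eq\<close>), which identifies \<open>h\<close> with \<open>h\<^sub>\<phi>\<close>.

  Uniqueness: the vectors \<open>U\<^sup>-\<^sup>j\<pi>(f)\<phi>\<close> form a dense set (\<open>hdense_orbits\<close>). By
  \<open>U\<^sup>-\<^sup>j\<pi>(f)\<phi> = U\<^sup>-\<^sup>j\<^sup>-\<^sup>1\<pi>(m\<^sub>0 f(z\<^sup>N))\<phi>\<close> two of them can be written with a common \<open>j\<close>, and then their inner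
  product is an integral against \<open>h\<close> (\<open>ip_orbit\<close>). Hence two representations with the same density
  have equal Gram matrices on dense sets, and matching these vectors extends to a unitary
  (\<open>unitary_extension\<close>, \<open>unitarily_equivalent_if_same_density\<close>).

  Existence: the same formula says how to build the space. It is the completion of the direct limit
  of the isometries \<open>f \<mapsto> m\<^sub>0 f(z\<^sup>N)\<close> of \<open>L\<^sup>\<infinity>\<close> with the inner product of \<open>L\<^sup>2(h d\<mu>)\<close>; they are isometric
  precisely because \<open>R h = h\<close> (\<open>form_dilate\<close>). The unitary \<open>U\<close> is the shift of the direct limit, and
  \<open>f\<close> acts at level \<open>k\<close> as multiplication by \<open>f(z\<^bsup>N\<^sup>k\<^esup>)\<close>. This action is continuous under bounded pointwise
  convergence, so \<open>S \<mapsto> \<pi>(1\<^sub>S)\<close> is a spectral measure with \<open>\<pi>(f) = \<integral> f dE\<close> (\<open>spectral_resolution_rep\<close>,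
  \<open>is_spectral_integral_rep\<close>). The completion is realized on sequences of complex numbers by
  recording the inner products with a countable total family (\<open>germ_seq_separating\<close>).\<close>


section \<open>Functions on the circle\<close>

lemma space_circle [simp]: "space circle_measure = sphere 0 1"
  by (simp add: circle_measure_def space_restrict_space)

lemma sets_circle: "sets circle_measure = sets (restrict_space borel (sphere 0 1))"
  by (simp add: circle_measure_def)

lemma sets_circle_iff: "S \<in> sets circle_measure \<longleftrightarrow> S \<in> sets borel \<and> S \<subseteq> sphere 0 1"
  by (auto simp: sets_circle sets_restrict_space_iff)

lemma borel_measurable_circleI: "f \<in> borel_measurable borel \<Longrightarrow> f \<in> borel_measurable circle_measure"
  using measurable_cong_sets[OF sets_circle refl] by (auto intro: measurable_restrict_space1)

lemma measurable_arc [measurable]: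
  "(\<lambda>t. cis (2 * pi * t)) \<in> borel \<rightarrow>\<^sub>M restrict_space borel (sphere 0 1)"
  by (intro measurable_restrict_space2 borel_measurable_continuous_onI)
    (auto intro!: continuous_intros simp: cis_conv_exp)

lemma emeasure_circle: "emeasure circle_measure (space circle_measure) = 1"
proof -
  have "(\<lambda>t. cis (2 * pi * t)) \<in> restrict_space lborel {0..<1} \<rightarrow>\<^sub>M restrict_space borel (sphere 0 1)"
    by (intro measurable_restrict_space1) simp
  then show ?thesis
    unfolding space_circle unfolding circle_measure_def
    by (subst emeasure_distr)
      (auto simp: space_restrict_space emeasure_restrict_space sets_restrict_space_iff vimage_def)
qed

interpretation circle: finite_measure circle_measure
  by standard (use emeasure_circle in simp)

lemma
  fixes f :: "complex \<Rightarrow> complex"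
  assumes f: "f \<in> borel_measurable circle_measure"
  shows integral_circle_eq: "(LINT z|circle_measure. f z) =
      (LINT t|lborel. indicator {0..<1} t *\<^sub>R f (cis (2 * pi * t)))"
    and integrable_circle_iff: "integrable circle_measure f \<longleftrightarrow>
      integrable lborel (\<lambda>t. indicator {0..<1} t *\<^sub>R f (cis (2 * pi * t)))"
    and measurable_arc_comp: "(\<lambda>t. f (cis (2 * pi * t))) \<in> borel_measurable borel"
proof -
  have m: "(\<lambda>t. cis (2 * pi * t)) \<in> restrict_space lborel {0..<1} \<rightarrow>\<^sub>M restrict_space borel (sphere 0 1)"
    by (intro measurable_restrict_space1) simp
  have f': "f \<in> borel_measurable (restrict_space borel (sphere 0 1))"
    using f measurable_cong_sets[OF sets_circle refl] by blast
  show "(LINT z|circle_measure. f z) =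
      (LINT t|lborel. indicator {0..<1} t *\<^sub>R f (cis (2 * pi * t)))"
    unfolding circle_measure_def by (subst integral_distr[OF m f'], subst integral_restrict_space) auto
  show "integrable circle_measure f \<longleftrightarrow>
      integrable lborel (\<lambda>t. indicator {0..<1} t *\<^sub>R f (cis (2 * pi * t)))"
    unfolding circle_measure_def
    by (subst integrable_distr_eq[OF m f'], subst integrable_restrict_space) auto
  show "(\<lambda>t. f (cis (2 * pi * t))) \<in> borel_measurable borel"
    using measurable_compose[OF measurable_arc f'] .
qed

lemma measurable_circle_power [measurable]:
  "(\<lambda>z. z ^ N) \<in> circle_measure \<rightarrow>\<^sub>M circle_measure"
proof -
  have "(\<lambda>z::complex. z ^ N) \<in> borel_measurable circle_measure"
    by (intro borel_measurable_circleI borel_measurable_continuous_onI continuous_intros)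
  then have "(\<lambda>z::complex. z ^ N) \<in> circle_measure \<rightarrow>\<^sub>M restrict_space borel (sphere 0 1)"
    by (intro measurable_restrict_space2) (auto simp: norm_power)
  then show ?thesis
    using measurable_cong_sets[OF refl sets_circle] by blast
qed

subsection \<open>Essentially bounded functions\<close>

lemma LinfI:
  "f \<in> borel_measurable circle_measure \<Longrightarrow> (\<And>z. z \<in> sphere 0 1 \<Longrightarrow> cmod (f z) \<le> C) \<Longrightarrow> f \<in> Linf"
  unfolding Linf_def by (auto intro!: exI[of _ C])

lemma Linf_measurable [measurable_dest]: "f \<in> Linf \<Longrightarrow> f \<in> borel_measurable circle_measure"
  by (simp add: Linf_def)

lemma LinfE:
  assumes "f \<in> Linf"
  obtains C where "C \<ge> 0" "AE z in circle_measure. cmod (f z) \<le> C"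
proof -
  obtain C where C: "AE z in circle_measure. cmod (f z) \<le> C"
    using assms by (auto simp: Linf_def)
  have "AE z in circle_measure. cmod (f z) \<le> max C 0"
    using C by eventually_elim auto
  then show thesis using that[of "max C 0"] by auto
qed

lemma Linf_const [simp]: "(\<lambda>_. c) \<in> Linf"
  by (rule LinfI[where C = "cmod c"]) auto

lemma Linf_add: "f \<in> Linf \<Longrightarrow> g \<in> Linf \<Longrightarrow> (\<lambda>z. f z + g z) \<in> Linf"
proof -
  assume fg: "f \<in> Linf" "g \<in> Linf"
  obtain C D where "AE z in circle_measure. cmod (f z) \<le> C" "AE z in circle_measure. cmod (g z) \<le> D"
    using fg by (auto simp: Linf_def)
  then have "AE z in circle_measure. cmod (f z + g z) \<le> C + D"
    by eventually_elim (metis add_mono norm_triangle_le)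
  then show ?thesis using fg unfolding Linf_def by auto
qed

lemma Linf_mult: "f \<in> Linf \<Longrightarrow> g \<in> Linf \<Longrightarrow> (\<lambda>z. f z * g z) \<in> Linf"
proof -
  assume fg: "f \<in> Linf" "g \<in> Linf"
  obtain C where C: "C \<ge> 0" "AE z in circle_measure. cmod (f z) \<le> C"
    using LinfE[OF fg(1)] .
  obtain D where D: "AE z in circle_measure. cmod (g z) \<le> D"
    using LinfE[OF fg(2)] .
  from C(2) D have "AE z in circle_measure. cmod (f z * g z) \<le> C * D"
    by eventually_elim (auto simp: norm_mult intro: mult_mono C)
  then show ?thesis using fg unfolding Linf_def by auto
qed

lemma Linf_cnj: "f \<in> Linf \<Longrightarrow> (\<lambda>z. cnj (f z)) \<in> Linf"
  unfolding Linf_def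
  using measurable_compose[OF _ borel_measurable_continuous_onI[OF continuous_on_cnj[OF continuous_on_id]],
      of f circle_measure] by auto

lemma Linf_indicator: "S \<in> sets circle_measure \<Longrightarrow> indicator S \<in> Linf"
  by (rule LinfI[where C = 1]) (auto simp: indicator_def)

lemma Linf_diff: "f \<in> Linf \<Longrightarrow> g \<in> Linf \<Longrightarrow> (\<lambda>z. f z - g z) \<in> Linf"
  using Linf_add[OF _ Linf_mult[OF Linf_const[of "-1"]], of f g] by simp

lemma Linf_monom_fun [simp]: "monom_fun n \<in> Linf"
proof (rule LinfI[where C = 1])
  have "(\<lambda>z::complex. z powi n) \<in> borel_measurable borel"
    by (cases "n \<ge> 0") (auto simp: power_int_def)
  then show "monom_fun n \<in> borel_measurable circle_measure"
    unfolding monom_fun_def by (rule borel_measurable_circleI)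
qed (auto simp: monom_fun_def norm_power_int)

lemma Linf_imp_integrable:
  assumes f: "f \<in> Linf" and "finite_measure M" "sets M = sets circle_measure"
    and ac: "absolutely_continuous circle_measure M"
  shows "integrable M f"
proof -
  interpret finite_measure M by fact
  obtain C where C: "AE z in circle_measure. cmod (f z) \<le> C"
    using LinfE[OF f] .
  have "AE z in M. cmod (f z) \<le> C"
    using absolutely_continuous_AE[OF assms(3) ac C] .
  moreover have "f \<in> borel_measurable M"
    by (simp add: measurable_cong_sets[OF assms(3) refl] Linf_measurable f)
  ultimately show ?thesis
    by (intro integrable_const_bound) auto
qed

lemma integrable_Linf_mult:
  assumes "f \<in> Linf" "integrable circle_measure g"
  shows "integrable circle_measure (\<lambda>z. f z * g z)"
proof -
  obtain C where C: "C \<ge> 0" "AE z in circle_measure. cmod (f z) \<le> C"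
    using LinfE[OF assms(1)] .
  show ?thesis
  proof (rule Bochner_Integration.integrable_bound)
    show "integrable circle_measure (\<lambda>z. C * norm (g z))" using assms(2) by simp
    show "AE z in circle_measure. norm (f z * g z) \<le> norm (C * norm (g z))"
      using C(2) by eventually_elim (use C(1) in \<open>auto simp: norm_mult intro: mult_right_mono\<close>)
  qed (use assms in measurable)
qed

subsection \<open>A monotone class theorem\<close>

text \<open>Simple functions are finite combinations of indicator functions, and bounded functions are bounded
  pointwise limits of simple ones; boundedness outside a null set is reduced to boundedness by
  the stability under equality almost everywhere.\<close>

lemma Linf_induct_indicator [consumes 1, case_names ae indicator add scale lim]:
  assumes f: "f \<in> Linf"
    and ae: "\<And>f g. P f \<Longrightarrow> g \<in> Linf \<Longrightarrow> (AE z in circle_measure. f z = g z) \<Longrightarrow> P g"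
    and ind: "\<And>S. S \<in> sets circle_measure \<Longrightarrow> P (indicator S)"
    and add: "\<And>f g. P f \<Longrightarrow> P g \<Longrightarrow> P (\<lambda>z. f z + g z)"
    and scale: "\<And>a f. P f \<Longrightarrow> P (\<lambda>z. a * f z)"
    and lim: "\<And>F f C. (\<And>n. P (F n)) \<Longrightarrow> (\<And>n z. z \<in> sphere 0 1 \<Longrightarrow> cmod (F n z) \<le> C) \<Longrightarrow>
        (\<And>z. z \<in> sphere 0 1 \<Longrightarrow> (\<lambda>n. F n z) \<longlonglongrightarrow> f z) \<Longrightarrow> f \<in> Linf \<Longrightarrow> P f"
  shows "P f"
proof -
  have Psum: "P (\<lambda>z. \<Sum>i\<in>I. g i z)" if "\<And>i. i \<in> I \<Longrightarrow> P (g i)" for I and g :: "complex \<Rightarrow> complex \<Rightarrow> complex"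
    using that
  proof (induction I rule: infinite_finite_induct)
    case (insert i I) then show ?case using add[of "g i" "\<lambda>z. \<Sum>i\<in>I. g i z"] by simp
  qed (use scale[OF ind[of "{}"], of 0] in simp_all)
  obtain C where C: "C \<ge> 0" "AE z in circle_measure. cmod (f z) \<le> C"
    using LinfE[OF f] .
  define g where "g = (\<lambda>z. if cmod (f z) \<le> C then f z else 0)"
  have [measurable]: "f \<in> borel_measurable circle_measure" using f by (rule Linf_measurable)
  have g[measurable]: "g \<in> borel_measurable circle_measure" unfolding g_def by measurable
  have gb: "cmod (g z) \<le> C" for z using C(1) by (simp add: g_def)
  have gL: "g \<in> Linf" by (rule LinfI[OF g]) (rule gb)
  have gf: "AE z in circle_measure. g z = f z"
    using C(2) by eventually_elim (simp add: g_def)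
  obtain F where F: "\<And>i. simple_function circle_measure (F i)"
      "\<And>z. z \<in> sphere 0 1 \<Longrightarrow> (\<lambda>i. F i z) \<longlonglongrightarrow> g z"
      "\<And>i z. z \<in> sphere 0 1 \<Longrightarrow> cmod (F i z) \<le> 2 * cmod (g z)"
    using borel_measurable_implies_sequence_metric[OF g, of 0] unfolding space_circle dist_0_norm dist_norm diff_0_right by blast
  have PF: "P (F i)" for i
  proof -
    let ?G = "\<lambda>z. \<Sum>y\<in>F i ` sphere 0 1. y * indicator (F i -` {y} \<inter> sphere 0 1) z"
    have "P ?G"
      using simple_functionD(2)[OF F(1)[of i]] by (intro Psum scale ind) auto
    moreover have "F i \<in> Linf"
    proof (rule LinfI[where C = "2 * C"])
      show "cmod (F i z) \<le> 2 * C" if "z \<in> sphere 0 1" for z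
        using F(3)[OF that, of i] gb[of z] by linarith
    qed (rule borel_measurable_simple_function[OF F(1)])
    moreover have "?G z = F i z" if "z \<in> sphere 0 1" for z
    proof -
      have fin: "finite (F i ` sphere 0 1)"
        using simple_functionD(1)[OF F(1)[of i]] by simp
      have "?G z = (\<Sum>y\<in>F i ` sphere 0 1. if y = F i z then y else 0)"
        using that by (intro sum.cong) (auto simp: indicator_def)
      also have "\<dots> = F i z" using that fin by simp
      finally show ?thesis .
    qed
    then have "AE z in circle_measure. ?G z = F i z"
      by (intro AE_I2) (simp only: space_circle)
    ultimately show ?thesis using ae by blast
  qed
  have "P g"
  proof (rule lim[of F "2 * C"])
    show "cmod (F n z) \<le> 2 * C" if "z \<in> sphere 0 1" for n z
      using F(3)[OF that, of n] gb[of z] by linarith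
  qed (rule PF F(2) gL; assumption)+
  then show ?thesis using ae f gf by blast
qed

text \<open>A class of functions that contains the monomials and is stable under linear combinations and bounded
  limits contains the polynomials in the real and imaginary part, hence by Stone and Weierstrass the
  continuous functions, hence the indicator functions of closed sets (as limits of
  \<open>max 0 (1 - n dist(z, A))\<close>), hence by Dynkin's lemma those of all Borel sets. This is used both for the
  uniqueness of Fourier coefficients and to find a countable total family in the Hilbert space.\<close>

lemma Linf_induct_monom [consumes 1, case_names ae monom add scale lim]:
  assumes f: "f \<in> Linf"
    and ae: "\<And>f g. P f \<Longrightarrow> g \<in> Linf \<Longrightarrow> (AE z in circle_measure. f z = g z) \<Longrightarrow> P g"
    and monom: "\<And>n. P (monom_fun n)"
    and add: "\<And>f g. P f \<Longrightarrow> P g \<Longrightarrow> P (\<lambda>z. f z + g z)"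
    and scale: "\<And>a f. P f \<Longrightarrow> P (\<lambda>z. a * f z)"
    and lim: "\<And>F f C. (\<And>n. P (F n)) \<Longrightarrow> (\<And>n z. z \<in> sphere 0 1 \<Longrightarrow> cmod (F n z) \<le> C) \<Longrightarrow>
        (\<And>z. z \<in> sphere 0 1 \<Longrightarrow> (\<lambda>n. F n z) \<longlonglongrightarrow> f z) \<Longrightarrow> f \<in> Linf \<Longrightarrow> P f"
  shows "P f"
proof -
  have eq: "P g" if "P f" "g \<in> Linf" "\<And>z. z \<in> sphere 0 1 \<Longrightarrow> f z = g z" for f g
    using ae[OF that(1,2) AE_I2] that(3) by simp
  have contL: "(\<lambda>z. of_real (p z)) \<in> Linf" if "continuous_on UNIV p" for p :: "complex \<Rightarrow> real"
  proof -
    have "compact (p ` sphere 0 1)"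
      by (rule compact_continuous_image[OF continuous_on_subset[OF that]]) auto
    then obtain C where "\<forall>x \<in> p ` sphere 0 1. norm x \<le> C"
      using compact_imp_bounded bounded_iff by blast
    then show ?thesis
      by (intro LinfI[where C = C] borel_measurable_circleI borel_measurable_continuous_onI
          continuous_on_of_real that) auto
  qed
  \<comment> \<open>Products of polynomials are not accessible from products with monomials alone, so the
    induction over polynomials carries an arbitrary factor whose multiples by monomials are good.\<close>
  have poly: "\<forall>g\<in>Linf. (\<forall>n. P (\<lambda>z. g z * monom_fun n z)) \<longrightarrow> (\<forall>n. P (\<lambda>z. of_real (p z) * g z * monom_fun n z))"
    if "real_polynomial_function p" for p :: "complex \<Rightarrow> real"
    using that
  proof (induction p rule: real_polynomial_function.induct)
    case (linear l)
    show ?case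
    proof (intro ballI impI allI)
      fix g n assume g: "g \<in> Linf" "\<forall>n. P (\<lambda>z. g z * monom_fun n z)"
      define a where "a = (complex_of_real (l 1) - \<i> * complex_of_real (l \<i>)) / 2"
      define b where "b = (complex_of_real (l 1) + \<i> * complex_of_real (l \<i>)) / 2"
      have l: "complex_of_real (l z) = a * z + b * cnj z" for z
      proof -
        interpret l: bounded_linear l by fact
        have "l z = l (Re z *\<^sub>R 1 + Im z *\<^sub>R \<i>)"
          by (rule arg_cong[where f = l]) (simp add: complex_eq_iff)
        then have "l z = Re z * l 1 + Im z * l \<i>"
          by (simp only: l.add l.scaleR real_scaleR_def)
        then show ?thesis
          by (simp add: a_def b_def complex_eq_iff field_simps)
      qed
      have "P (\<lambda>z. a * (g z * monom_fun (n + 1) z) + b * (g z * monom_fun (n - 1) z))"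
        using g(2) by (intro add scale) auto
      moreover have "(\<lambda>z. complex_of_real (l z) * g z * monom_fun n z) \<in> Linf"
        using contL[OF linear_continuous_on[OF linear]] g(1) by (intro Linf_mult) auto
      moreover have "a * (g z * monom_fun (n + 1) z) + b * (g z * monom_fun (n - 1) z)
          = complex_of_real (l z) * g z * monom_fun n z" if "z \<in> sphere 0 1" for z
      proof -
        have z: "z \<noteq> 0" "cnj z = inverse z"
          using that complex_norm_square[of z] inverse_unique[of z "cnj z"] by auto
        show ?thesis
          using z(1) unfolding l z(2) monom_fun_def
          by (simp add: power_int_add power_int_diff field_simps)
      qed
      ultimately show "P (\<lambda>z. of_real (l z) * g z * monom_fun n z)"
        by (rule eq)
    qed
  next
    case (const c)
    show ?case
    proof (intro ballI impI allI)
      fix g n assume "\<forall>n. P (\<lambda>z. g z * monom_fun n z)"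
      then have "P (\<lambda>z. of_real c * (g z * monom_fun n z))" by (intro scale) blast
      then show "P (\<lambda>z. of_real c * g z * monom_fun n z)" by (simp only: mult.assoc)
    qed
  next
    case (add p q)
    show ?case
    proof (intro ballI impI allI)
      fix g n assume "g \<in> Linf" "\<forall>n. P (\<lambda>z. g z * monom_fun n z)"
      then have "P (\<lambda>z. of_real (p z) * g z * monom_fun n z + of_real (q z) * g z * monom_fun n z)"
        using add.IH by (intro assms(4)) blast+
      then show "P (\<lambda>z. of_real (p z + q z) * g z * monom_fun n z)"
        by (simp only: of_real_add distrib_right)
    qed
  next
    case (mult p q)
    show ?case
    proof (intro ballI impI)
      fix g assume g: "g \<in> Linf" "\<forall>n. P (\<lambda>z. g z * monom_fun n z)"
      have 1: "\<forall>n. P (\<lambda>z. of_real (q z) * g z * monom_fun n z)"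
        using mult.IH(2) g by blast
      have "(\<lambda>z. of_real (q z) * g z) \<in> Linf"
        by (rule Linf_mult[OF contL g(1)]) (simp add: continuous_at_imp_continuous_on continuous_real_polymonial_function mult.hyps(2))
      from mult.IH(1)[rule_format, OF this] 1
      show "\<forall>n. P (\<lambda>z. of_real (p z * q z) * g z * monom_fun n z)"
        by (simp add: mult_ac)
    qed
  qed
  have poly: "P (\<lambda>z. of_real (p z))" if "real_polynomial_function p" for p :: "complex \<Rightarrow> real"
    using poly[OF that, rule_format, of "\<lambda>_. 1" 0] monom by (simp add: monom_fun_def)
  have cont: "P (\<lambda>z. of_real (p z))" if p: "continuous_on UNIV p" for p :: "complex \<Rightarrow> real"
  proof -
    have "\<exists>q. real_polynomial_function q \<and> (\<forall>z\<in>sphere 0 1. \<bar>p z - q z\<bar> < inverse (real (Suc n)))" for n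
      by (rule Stone_Weierstrass_real_polynomial_function[of "sphere (0::complex) 1" p "inverse (real (Suc n))"])
        (use continuous_on_subset[OF p] in auto)
    then obtain q where q: "\<And>n. real_polynomial_function (q n)"
        "\<And>n z. z \<in> sphere 0 1 \<Longrightarrow> \<bar>p z - q n z\<bar> < inverse (real (Suc n))"
      by metis
    have "compact (p ` sphere 0 1)"
      by (rule compact_continuous_image[OF continuous_on_subset[OF p]]) auto
    then obtain C where C: "\<And>z. z \<in> sphere 0 1 \<Longrightarrow> \<bar>p z\<bar> \<le> C"
      using compact_imp_bounded bounded_iff by (metis image_eqI real_norm_def)
    show ?thesis
    proof (rule lim[where F = "\<lambda>n z. of_real (q n z)" and C = "C + 1"])
      fix n and z :: complex assume z: "z \<in> sphere 0 1"
      have "inverse (real (Suc n)) \<le> 1" by (simp add: field_simps)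
      then show "cmod (complex_of_real (q n z)) \<le> C + 1"
        using q(2)[OF z, of n] C[OF z] by simp
    next
      fix z :: complex assume z: "z \<in> sphere 0 1"
      have "(\<lambda>n. p z - q n z) \<longlonglongrightarrow> 0"
        by (rule Lim_null_comparison[OF _ LIMSEQ_inverse_real_of_nat]) (use q(2)[OF z] in \<open>auto intro!: always_eventually less_imp_le\<close>)
      from tendsto_diff[OF tendsto_const[of "p z"] this] have "(\<lambda>n. q n z) \<longlonglongrightarrow> p z" by simp
      then show "(\<lambda>n. complex_of_real (q n z)) \<longlonglongrightarrow> complex_of_real (p z)"
        by (rule tendsto_of_real)
    qed (rule poly[OF q(1)] contL[OF p])+
  qed
  have closed: "P (indicator (A \<inter> sphere 0 1))" if A: "closed A" for A
  proof (cases "A = {}")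
    case True
    have "(\<lambda>z. 0 * monom_fun 0 z) = indicator (A \<inter> sphere 0 1)"
      using True by auto
    then show ?thesis using scale[OF monom, of 0 0] by metis
  next
    case False
    let ?F = "\<lambda>n z. max 0 (1 - real n * infdist z A)"
    show ?thesis
    proof (rule lim[where F = "\<lambda>n z. of_real (?F n z)" and C = 1])
      show "P (\<lambda>z. of_real (?F n z))" for n
        by (rule cont) (intro continuous_intros)
      fix n and z :: complex assume z: "z \<in> sphere 0 1"
      show "cmod (complex_of_real (?F n z)) \<le> 1" by (auto simp: max_def infdist_nonneg)
      show "(\<lambda>n. complex_of_real (?F n z)) \<longlonglongrightarrow> indicator (A \<inter> sphere 0 1) z"
      proof (cases "z \<in> A")
        case True
        then show ?thesis using z by simp
      next
        case nA: False
        then have pos: "infdist z A > 0"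
          using A False infdist_nonneg[of z A] by (simp add: in_closed_iff_infdist_zero order_less_le)
        obtain m where m: "real m * infdist z A > 1"
          using reals_Archimedean3[OF pos] by blast
        have "\<forall>\<^sub>F n in sequentially. complex_of_real (?F n z) = 0"
          using eventually_ge_at_top[of m]
        proof eventually_elim
          case (elim n)
          have "real m * infdist z A \<le> real n * infdist z A"
            using elim pos by (intro mult_right_mono) auto
          with m show ?case by simp
        qed
        then show ?thesis using nA by (simp add: tendsto_eventually)
      qed
    next
      show "indicator (A \<inter> sphere 0 1) \<in> Linf"
        by (rule Linf_indicator) (use A in \<open>auto simp: sets_circle_iff\<close>)
    qed
  qed
  have borel: "P (indicator (A \<inter> sphere 0 1))" if "A \<in> sigma_sets UNIV (Collect closed)" for A
  proof -
    have sets: "A \<inter> sphere 0 1 \<in> sets circle_measure"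
      if "A \<in> sigma_sets UNIV (Collect closed)" for A :: "complex set"
    proof -
      have "A \<in> sets borel" using that by (simp add: borel_eq_closed)
      then show ?thesis using borel_closed[of "sphere (0::complex) 1"] by (auto simp: sets_circle_iff)
    qed
    have one: "P (\<lambda>_. 1)" using monom[of 0] by (simp add: monom_fun_def)
    have int: "Int_stable (Collect closed :: complex set set)" by (auto simp: Int_stable_def)
    show ?thesis using int subset_UNIV[of "Collect closed", unfolded Pow_UNIV[symmetric]] that
    proof (induction rule: sigma_sets_induct_disjoint)
      case (basic A) then show ?case using closed by simp
    next
      case empty show ?case by (rule closed) simp
    next
      case (compl A)
      have "P (\<lambda>z. 1 + (-1) * indicator (A \<inter> sphere 0 1) z)"
        by (intro add scale one compl)
      moreover have "UNIV - A \<in> sigma_sets UNIV (Collect closed)"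
        using compl(1) by (rule sigma_sets.Compl)
      then have "indicator ((UNIV - A) \<inter> sphere 0 1) \<in> Linf"
        by (rule Linf_indicator[OF sets])
      ultimately show ?case
        by (rule eq) (auto simp: indicator_def)
    next
      case (union A)
      have psum: "P (\<lambda>z. \<Sum>i<n. indicator (A i \<inter> sphere 0 1) z)" for n
      proof (induction n)
        case 0
        have "P (\<lambda>z. 0 * 1)" by (rule scale[OF one])
        then show ?case by simp
      next
        case (Suc n)
        show ?case using add[OF Suc union(3)[of n]] by simp
      qed
      have disj: "disjoint_family (\<lambda>i. A i \<inter> sphere 0 1)"
        using union(1) unfolding disjoint_family_on_def by blast
      have e: "(\<Sum>i<n. indicator (A i \<inter> sphere 0 1) z) = (indicator (\<Union>i<n. A i \<inter> sphere 0 1) z :: complex)" for n z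
        by (rule indicator_UN_disjoint[symmetric]) (use disj in \<open>auto intro: disjoint_family_on_mono\<close>)
      show ?case
      proof (rule lim[where F = "\<lambda>n z. \<Sum>i<n. indicator (A i \<inter> sphere 0 1) z" and C = 1])
        fix z :: complex
        show "(\<lambda>n. \<Sum>i<n. indicator (A i \<inter> sphere 0 1) z) \<longlonglongrightarrow> (indicator (\<Union> (range A) \<inter> sphere 0 1) z :: complex)"
          unfolding e using LIMSEQ_indicator_UN[of "\<lambda>i. A i \<inter> sphere 0 1" z] by (simp add: Int_UN_distrib2)
        show "cmod (\<Sum>i<n. indicator (A i \<inter> sphere 0 1) z) \<le> 1" for n
          unfolding e by (auto simp: indicator_def)
        have "\<Union> (range A) \<in> sigma_sets UNIV (Collect closed)"
          using union(2) by (intro sigma_sets.Union) auto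
        then show "indicator (\<Union> (range A) \<inter> sphere 0 1) \<in> Linf"
          using Linf_indicator[OF sets] by blast
      qed (rule psum)
    qed
  qed
  show ?thesis
  proof (rule Linf_induct_indicator[OF f])
    fix S assume "S \<in> sets circle_measure"
    then have "S \<in> sigma_sets UNIV (Collect closed)" "S \<inter> sphere 0 1 = S"
      by (auto simp: sets_circle_iff borel_eq_closed)
    then show "P (indicator S)" using borel[of S] by simp
  qed (fact ae add scale lim)+
qed

subsection \<open>The power map and averaging over its fibres\<close>

lemma borel_measurable_Arg: "Arg \<in> borel_measurable borel"
proof -
  let ?A = "- \<real>\<^sub>\<le>\<^sub>0 :: complex set"
  have "continuous_on ?A (\<lambda>z. Im (Ln z))"
    by (intro continuous_intros) auto
  moreover have "?A \<in> sets borel" by auto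
  ultimately have "(\<lambda>z. indicator ?A z *\<^sub>R Im (Ln z)) \<in> borel_measurable borel"
    by (intro borel_measurable_continuous_on_indicator) auto
  moreover have "(\<lambda>z. indicator (- ?A - {0}) z *\<^sub>R pi) \<in> borel_measurable borel"
    by measurable
  ultimately have "(\<lambda>z. indicator ?A z *\<^sub>R Im (Ln z) + indicator (- ?A - {0}) z *\<^sub>R pi) \<in> borel_measurable borel"
    by (rule borel_measurable_add)
  moreover have "indicator ?A z *\<^sub>R Im (Ln z) + indicator (- ?A - {0}) z *\<^sub>R pi = Arg z" for z
  proof -
    have "Arg z = Im (Ln z)" if "z \<notin> \<real>\<^sub>\<le>\<^sub>0"
      using that by (intro Arg_eq_Im_Ln) auto
    moreover have "Arg z = pi" if "z \<in> \<real>\<^sub>\<le>\<^sub>0" "z \<noteq> 0"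
      using that Arg_eq_pi[of z] by (auto simp: complex_nonpos_Reals_iff complex_eq_iff)
    ultimately show ?thesis by (auto simp: indicator_def Arg_zero)
  qed
  ultimately show ?thesis by simp
qed

text \<open>The \<open>N\<close>-th roots of \<open>e\<^bsup>2\<pi>it\<^esup>\<close> are \<open>e\<^bsup>2\<pi>i(t+k)/N\<^esup>\<close>, so that sums over the fibres of \<open>z \<mapsto> z\<^sup>N\<close> become sums
  over \<open>k\<close> in the angle variable.\<close>

lemma sum_roots_cis:
  fixes G :: "complex \<Rightarrow> 'a::comm_monoid_add"
  assumes "N > 0"
  shows "(\<Sum>w | w ^ N = cis (2 * pi * t). G w) = (\<Sum>k<N. G (cis (2 * pi * ((t + real k) / real N))))"
proof -
  define c where "c = cis (2 * pi * t / real N)"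
  have c: "c ^ N = cis (2 * pi * t)" "c \<noteq> 0"
    using assms by (auto simp: c_def Complex.DeMoivre)
  have "bij_betw ((*) c) {w. w ^ N = 1} {w. w ^ N = c ^ N}"
    by (rule bij_betwI[where g = "\<lambda>w. w / c"]) (use c(2) in \<open>auto simp: power_mult_distrib power_divide\<close>)
  from bij_betw_trans[OF Complex.bij_betw_roots_unity[OF assms] this]
  have "bij_betw ((*) c \<circ> (\<lambda>k. cis (2 * pi * real k / real N))) {..<N} {w. w ^ N = cis (2 * pi * t)}"
    by (simp add: c)
  from sum.reindex_bij_betw[OF this, of G] show ?thesis
    by (simp add: c_def cis_mult add_divide_distrib distrib_left)
qed

text \<open>The measurable choice \<open>t = Arg z / 2\<pi>\<close> of the angle exhibits the fibre sum as a finite sum of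
  measurable functions.\<close>

lemma measurable_root_sum:
  assumes "N > 0" and G: "G \<in> borel_measurable circle_measure"
  shows "(\<lambda>z. \<Sum>w | w ^ N = z. G w :: complex) \<in> borel_measurable circle_measure"
proof -
  have "(\<lambda>z. G (cis (2 * pi * ((Arg z / (2 * pi) + real k) / real N)))) \<in> borel_measurable circle_measure" for k
  proof -
    have "(\<lambda>z. (Arg z / (2 * pi) + real k) / real N) \<in> borel_measurable circle_measure"
      by (rule borel_measurable_circleI) (use borel_measurable_Arg in measurable)
    from measurable_compose[OF this measurable_arc_comp[OF G]] show ?thesis .
  qed
  then have "(\<lambda>z. \<Sum>k<N. G (cis (2 * pi * ((Arg z / (2 * pi) + real k) / real N)))) \<in> borel_measurable circle_measure"
    by (intro borel_measurable_sum) auto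
  moreover have "(\<Sum>k<N. G (cis (2 * pi * ((Arg z / (2 * pi) + real k) / real N)))) = (\<Sum>w | w ^ N = z. G w)"
    if "z \<in> space circle_measure" for z
  proof -
    have "z \<noteq> 0" "sgn z = z" using that by (auto simp: sgn_eq)
    then have "cis (2 * pi * (Arg z / (2 * pi))) = z" using cis_Arg[of z] by simp
    then show ?thesis using sum_roots_cis[OF assms(1), of G "Arg z / (2 * pi)"] by simp
  qed
  ultimately show ?thesis by (subst measurable_cong[symmetric])
qed

text \<open>The arcs \<open>[k/N, (k+1)/N)\<close> tile a period, and the \<open>k\<close>-th inverse branch of \<open>z \<mapsto> z\<^sup>N\<close> maps
  the circle onto the \<open>k\<close>-th arc, contracting length by \<open>N\<close>.\<close>

lemma
  fixes G :: "complex \<Rightarrow> complex"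
  assumes N: "N > 0" and G: "integrable circle_measure G"
  shows integrable_root_sum: "integrable circle_measure (\<lambda>z. \<Sum>w | w ^ N = z. G w)"
    and integral_root_sum: "(LINT z|circle_measure. (\<Sum>w | w ^ N = z. G w)) =
      of_nat N * (LINT z|circle_measure. G z)"
proof -
  define g where "g t = G (cis (2 * pi * t))" for t
  have Gm: "G \<in> borel_measurable circle_measure" using G by auto
  have g[measurable]: "g \<in> borel_measurable borel"
    unfolding g_def by (rule measurable_arc_comp[OF Gm])
  have gi: "integrable lborel (\<lambda>t. indicator {0..<1} t *\<^sub>R g t)"
    using G integrable_circle_iff[OF Gm] by (simp add: g_def)
  define I where "I k = {real k / real N..<(real k + 1) / real N}" for k
  have Isub: "I k \<subseteq> {0..<1}" if "k < N" for k
  proof -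
    have "(real k + 1) / real N \<le> 1" using that N by (simp add: divide_simps)
    then show ?thesis unfolding I_def by (auto intro: order_trans[rotated] less_le_trans)
  qed
  have Ii: "integrable lborel (\<lambda>t. indicator (I k) t *\<^sub>R g t)" if "k < N" for k
  proof -
    have "integrable lborel (\<lambda>t. indicator (I k) t *\<^sub>R (indicator {0..<1} t *\<^sub>R g t))"
      by (rule integrable_mult_indicator) (auto simp: gi I_def)
    moreover have "(\<lambda>t. indicator (I k) t *\<^sub>R (indicator {0..<1} t *\<^sub>R g t)) = (\<lambda>t. indicator (I k) t *\<^sub>R g t)"
      using Isub[OF that] by (intro ext) (auto simp: indicator_def subset_iff)
    ultimately show ?thesis by metis
  qed
  have tile: "(\<Sum>k<N. indicator (I k) t *\<^sub>R g t) = indicator {0..<1} t *\<^sub>R g t" for t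
  proof -
    have disj: "disjoint_family_on I {..<N}"
    proof -
      have "j = k" if "t \<in> I j" "t \<in> I k" for j k t
      proof -
        have "real j < real k + 1" "real k < real j + 1"
          using that N by (auto simp: I_def field_simps)
        then show "j = k" by linarith
      qed
      then show ?thesis unfolding disjoint_family_on_def by blast
    qed
    have "(\<Union>k<N. I k) = {0..<1}"
    proof (intro equalityI subsetI)
      fix t :: real assume t: "t \<in> {0..<1}"
      define k where "k = nat \<lfloor>t * real N\<rfloor>"
      have k: "real k \<le> t * real N" "t * real N < real k + 1"
        using t N by (auto simp: k_def)
      moreover have "t * real N < 1 * real N" using t N by (intro mult_strict_right_mono) auto
      ultimately have "real k < real N" by linarith
      then show "t \<in> (\<Union>k<N. I k)"
        using k N by (auto simp: I_def field_simps intro!: bexI[of _ k])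
    qed (use Isub in blast)
    then have "(\<Sum>k<N. indicator (I k) t :: real) = indicator {0..<1} t"
      using indicator_UN_disjoint[OF finite_lessThan disj, of t] by metis
    then show ?thesis by (simp add: scaleR_sum_left[symmetric])
  qed
  have affine: "(indicator (I k) (real k / real N + (1 / real N) * t) :: real) = indicator {0..<1} t" for k t
    using N by (auto simp: I_def indicator_def field_simps)
  have Ji: "integrable lborel (\<lambda>t. indicator {0..<1} t *\<^sub>R g ((t + real k) / real N))" if "k < N" for k
    using lborel_integrable_real_affine[OF Ii[OF that], of "1 / real N" "real k / real N"] N
    unfolding affine by (simp add: add_divide_distrib add.commute)
  have J: "(LINT t|lborel. indicator {0..<1} t *\<^sub>R g ((t + real k) / real N)) =
      of_nat N * (LINT t|lborel. indicator (I k) t *\<^sub>R g t)" for k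
    using lborel_integral_real_affine[of "1 / real N" "\<lambda>t. indicator (I k) t *\<^sub>R g t" "real k / real N"] N
    unfolding affine by (simp add: add_divide_distrib add.commute scaleR_conv_of_real)
  have eq: "indicator {0..<1} t *\<^sub>R (\<Sum>w | w ^ N = cis (2 * pi * t). G w) =
      (\<Sum>k<N. indicator {0..<1} t *\<^sub>R g ((t + real k) / real N))" for t
    by (simp add: sum_roots_cis[OF N] g_def scaleR_sum_right)
  note m = measurable_root_sum[OF N Gm]
  show "integrable circle_measure (\<lambda>z. \<Sum>w | w ^ N = z. G w)"
    unfolding integrable_circle_iff[OF m] eq by (rule Bochner_Integration.integrable_sum) (use Ji in auto)
  have "(LINT z|circle_measure. (\<Sum>w | w ^ N = z. G w)) =
      (\<Sum>k<N. LINT t|lborel. indicator {0..<1} t *\<^sub>R g ((t + real k) / real N))"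
    unfolding integral_circle_eq[OF m] eq
    by (rule Bochner_Integration.integral_sum) (use Ji in auto)
  also have "\<dots> = of_nat N * (LINT t|lborel. (\<Sum>k<N. indicator (I k) t *\<^sub>R g t))"
    unfolding J by (subst Bochner_Integration.integral_sum) (use Ii in \<open>auto simp: sum_distrib_left\<close>)
  also have "\<dots> = of_nat N * (LINT z|circle_measure. G z)"
    by (simp only: tile) (simp only: g_def integral_circle_eq[OF Gm])
  finally show "(LINT z|circle_measure. (\<Sum>w | w ^ N = z. G w)) =
      of_nat N * (LINT z|circle_measure. G z)" .
qed

text \<open>Fibres over points outside \<open>S\<close> miss the preimage of \<open>S\<close>, so the fibre sum of its indicator function
  vanishes almost everywhere, and so does its integral.\<close>

lemma null_set_power_vimage:
  assumes N: "N > 0" and S: "S \<in> null_sets circle_measure"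
  shows "(\<lambda>z. z ^ N) -` S \<inter> sphere 0 1 \<in> null_sets circle_measure"
proof -
  let ?T = "(\<lambda>z::complex. z ^ N) -` S \<inter> sphere 0 1"
  have T: "?T \<in> sets circle_measure"
    using measurable_sets[OF measurable_circle_power, of S N] S by (simp add: null_sets_def)
  have "integrable circle_measure (indicator ?T :: complex \<Rightarrow> complex)"
    using Linf_imp_integrable[OF Linf_indicator[OF T], of circle_measure] circle.finite_measure_axioms
    by (simp add: absolutely_continuous_def)
  from integral_root_sum[OF N this]
  have "of_nat N * (LINT z|circle_measure. (indicator ?T z :: complex)) = (LINT z|circle_measure. (\<Sum>w | w ^ N = z. indicator ?T w))" ..
  also have "\<dots> = 0"
  proof (rule integral_eq_zero_AE)
    have "(\<Sum>w | w ^ N = z. indicator ?T w) = (0 :: complex)" if "z \<notin> S" for z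
      by (rule sum.neutral) (use that in \<open>auto simp: indicator_def\<close>)
    then show "AE z in circle_measure. (\<Sum>w | w ^ N = z. indicator ?T w) = (0 :: complex)"
      using AE_not_in[OF S] by auto
  qed
  finally have "(LINT z|circle_measure. complex_of_real (indicator ?T z)) = 0"
    using N by (simp add: of_real_indicator)
  then have "measure circle_measure ?T = 0"
    unfolding integral_complex_of_real using T by simp
  then show ?thesis using T by (auto simp: null_sets_def circle.emeasure_eq_measure)
qed

lemma AE_circle_power:
  assumes N: "N > 0" and P: "AE z in circle_measure. P z"
  shows "AE z in circle_measure. P (z ^ N)"
proof -
  obtain S where S: "{z \<in> space circle_measure. \<not> P z} \<subseteq> S" "S \<in> null_sets circle_measure"
    using AE_E[OF P] by (auto simp: null_sets_def)
  show ?thesis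
    by (rule AE_I'[OF null_set_power_vimage[OF N S(2)]]) (use S(1) in \<open>auto simp: norm_power subset_iff\<close>)
qed

lemma Linf_power_comp:
  assumes "N > 0" "f \<in> Linf"
  shows "(\<lambda>z. f (z ^ N)) \<in> Linf"
proof -
  obtain C where "AE z in circle_measure. cmod (f z) \<le> C"
    using assms(2) by (auto simp: Linf_def)
  then show ?thesis
    using AE_circle_power[OF assms(1), of "\<lambda>z. cmod (f z) \<le> C"]
      measurable_compose[OF measurable_circle_power Linf_measurable[OF assms(2)], of N]
    by (auto simp: Linf_def)
qed

subsection \<open>The transfer operator\<close>

lemma Linf_cmod_square: "m \<in> Linf \<Longrightarrow> (\<lambda>z. of_real ((cmod (m z))\<^sup>2)) \<in> Linf"
  using Linf_mult[OF _ Linf_cnj, of m m] by (simp only: complex_norm_square)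

text \<open>On the fibre over \<open>z\<close> the factor \<open>f(z)\<close> equals \<open>f(w\<^sup>N)\<close> and can be moved into the sum. Thus the transfer
  operator is the adjoint of \<open>f \<mapsto> \<bar>m\<bar>\<^sup>2 f(z\<^sup>N)\<close>.\<close>

lemma
  assumes N: "N > 0" and m: "m \<in> Linf" and g: "integrable circle_measure g"
  shows integrable_ruelle: "integrable circle_measure (ruelle N m g)"
    and integral_ruelle: "f \<in> Linf \<Longrightarrow> (LINT z|circle_measure. f z * ruelle N m g z) =
      (LINT z|circle_measure. of_real ((cmod (m z))\<^sup>2) * f (z ^ N) * g z)"
proof -
  let ?m = "\<lambda>z. complex_of_real ((cmod (m z))\<^sup>2)"
  have mg: "integrable circle_measure (\<lambda>z. ?m z * g z)"
    by (rule integrable_Linf_mult[OF Linf_cmod_square[OF m] g])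
  show "integrable circle_measure (ruelle N m g)"
    unfolding ruelle_def by (intro integrable_divide integrable_root_sum N mg)
  assume f: "f \<in> Linf"
  have i: "integrable circle_measure (\<lambda>z. f (z ^ N) * (?m z * g z))"
    by (rule integrable_Linf_mult[OF Linf_power_comp[OF N f] mg])
  have "f z * ruelle N m g z = (\<Sum>w | w ^ N = z. f (w ^ N) * (?m w * g w)) / of_nat N" for z
    by (simp add: ruelle_def sum_distrib_left)
  then have "(LINT z|circle_measure. f z * ruelle N m g z) =
      (LINT z|circle_measure. (\<Sum>w | w ^ N = z. f (w ^ N) * (?m w * g w))) / of_nat N"
    by simp
  also have "\<dots> = (LINT z|circle_measure. f (z ^ N) * (?m z * g z))"
    using integral_root_sum[OF N i] N by simp
  finally show "(LINT z|circle_measure. f z * ruelle N m g z) =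
      (LINT z|circle_measure. ?m z * f (z ^ N) * g z)"
    by (simp add: mult_ac)
qed

subsection \<open>Uniqueness of Fourier coefficients\<close>

text \<open>Testing against the conjugate of \<open>sgn g\<close> yields \<open>\<integral> \<bar>g\<bar> d\<mu> = 0\<close>.\<close>

lemma AE_eq_0_if_orthogonal_Linf:
  assumes g: "integrable circle_measure g"
    and 0: "\<And>f. f \<in> Linf \<Longrightarrow> (LINT z|circle_measure. f z * g z) = 0"
  shows "AE z in circle_measure. g z = 0"
proof -
  have gm[measurable]: "g \<in> borel_measurable circle_measure" using g by auto
  have "(\<lambda>z. cnj (sgn (g z))) \<in> Linf"
  proof (rule LinfI[where C = 1])
    have "(\<lambda>z. sgn (g z)) \<in> borel_measurable circle_measure" unfolding sgn_div_norm by measurable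
    then show "(\<lambda>z. cnj (sgn (g z))) \<in> borel_measurable circle_measure"
      by (rule measurable_compose[OF _ borel_measurable_continuous_onI[OF continuous_on_cnj[OF continuous_on_id]]])
  qed (simp add: norm_sgn)
  from 0[OF this] have "(LINT z|circle_measure. complex_of_real (cmod (g z))) = 0"
  proof -
    have "cnj (sgn (g z)) * g z = complex_of_real (cmod (g z))" for z
      using complex_norm_square[of "g z"]
      by (cases "g z = 0") (simp_all add: sgn_eq field_simps power2_eq_square)
    then show ?thesis using 0[OF \<open>(\<lambda>z. cnj (sgn (g z))) \<in> Linf\<close>] by simp
  qed
  then have "(LINT z|circle_measure. cmod (g z)) = 0"
    by (simp only: integral_complex_of_real of_real_eq_0_iff)
  then show ?thesis
    using integral_nonneg_eq_0_iff_AE[of circle_measure "\<lambda>z. cmod (g z)"] g by simp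
qed

lemma fourier_coeff_eq_imp_AE_eq:
  assumes g: "integrable circle_measure g" and h: "integrable circle_measure h"
    and eq: "\<And>n. fourier_coeff g n = fourier_coeff h n"
  shows "AE z in circle_measure. g z = h z"
proof -
  define d where "d = (\<lambda>z. g z - h z)"
  have d: "integrable circle_measure d" unfolding d_def using g h by auto
  have "f \<in> Linf \<and> (LINT z|circle_measure. f z * d z) = 0" if "f \<in> Linf" for f
    using that
  proof (induction rule: Linf_induct_monom)
    case (ae f f')
    have "(LINT z|circle_measure. f z * d z) = (LINT z|circle_measure. f' z * d z)"
      by (rule integral_cong_AE)
        (use ae borel_measurable_integrable[OF d] in \<open>auto intro!: borel_measurable_times intro: Linf_measurable\<close>)
    then show ?case using ae by simp
  next
    case (monom n)
    have "fourier_coeff g (-n) - fourier_coeff h (-n) = (LINT z|circle_measure. monom_fun n z * d z)"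
      unfolding fourier_coeff_def d_def
      by (subst Bochner_Integration.integral_diff[symmetric])
        (auto intro!: integrable_Linf_mult g h simp: right_diff_distrib)
    then show ?case using eq by simp
  next
    case (add f f')
    then show ?case
      by (simp add: Linf_add distrib_right integrable_Linf_mult d)
  next
    case (scale a f)
    then show ?case by (simp add: Linf_mult mult.assoc)
  next
    case (lim F f C)
    have "(\<lambda>n. LINT z|circle_measure. F n z * d z) \<longlonglongrightarrow> (LINT z|circle_measure. f z * d z)"
    proof (rule integral_dominated_convergence[where w = "\<lambda>z. C * norm (d z)"])
      show "AE z in circle_measure. (\<lambda>n. F n z * d z) \<longlonglongrightarrow> f z * d z"
        by (rule AE_I2) (auto intro!: tendsto_mult_right lim.hyps simp: lim)
      show "AE z in circle_measure. norm (F n z * d z) \<le> C * norm (d z)" for n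
        by (rule AE_I2) (use lim(2) in \<open>auto simp: norm_mult intro: mult_right_mono\<close>)
    qed (use borel_measurable_integrable[OF d] d lim in \<open>auto intro!: borel_measurable_times intro: Linf_measurable\<close>)
    moreover have "(\<lambda>n. LINT z|circle_measure. F n z * d z) = (\<lambda>_. 0)" using lim(1) by auto
    ultimately have "(LINT z|circle_measure. f z * d z) = 0"
      using LIMSEQ_unique tendsto_const by metis
    then show ?case using lim by simp
  qed
  then have "AE z in circle_measure. d z = 0"
    by (intro AE_eq_0_if_orthogonal_Linf d) auto
  then show ?thesis by (simp add: d_def)
qed

section \<open>Semi-inner product spaces and Hilbert spaces\<close>

text \<open>A possibly degenerate inner product. The laws constrain the operations only as far as the form
  sees them, which is what survives in the completion.\<close>

locale semi_inner_space =
  fixes H :: "'a hilb"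
  assumes zero_mem [intro, simp]: "hzero H \<in> hcarrier H"
    and add_mem [intro, simp]: "x \<in> hcarrier H \<Longrightarrow> y \<in> hcarrier H \<Longrightarrow> hadd H x y \<in> hcarrier H"
    and scale_mem [intro, simp]: "x \<in> hcarrier H \<Longrightarrow> hscale H a x \<in> hcarrier H"
    and ip_cnj: "x \<in> hcarrier H \<Longrightarrow> y \<in> hcarrier H \<Longrightarrow> hinner H y x = cnj (hinner H x y)"
    and ip_add_right [simp]: "x \<in> hcarrier H \<Longrightarrow> y \<in> hcarrier H \<Longrightarrow> z \<in> hcarrier H \<Longrightarrow>
      hinner H x (hadd H y z) = hinner H x y + hinner H x z"
    and ip_scale_right [simp]: "x \<in> hcarrier H \<Longrightarrow> y \<in> hcarrier H \<Longrightarrow>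
      hinner H x (hscale H a y) = a * hinner H x y"
    and ip_nonneg: "x \<in> hcarrier H \<Longrightarrow> 0 \<le> Re (hinner H x x)"
begin

abbreviation ip :: "'a \<Rightarrow> 'a \<Rightarrow> complex" where "ip \<equiv> hinner H"
abbreviation nrm :: "'a \<Rightarrow> real" where "nrm \<equiv> hnorm H"

lemma minus_mem [intro, simp]: "x \<in> hcarrier H \<Longrightarrow> y \<in> hcarrier H \<Longrightarrow> hminus H x y \<in> hcarrier H"
  by (simp add: hminus_def)

lemma ip_add_left [simp]: "x \<in> hcarrier H \<Longrightarrow> y \<in> hcarrier H \<Longrightarrow> z \<in> hcarrier H \<Longrightarrow>
    ip (hadd H x y) z = ip x z + ip y z"
  by (subst (1 2 3) ip_cnj) auto

lemma ip_scale_left [simp]: "x \<in> hcarrier H \<Longrightarrow> y \<in> hcarrier H \<Longrightarrow> ip (hscale H a x) y = cnj a * ip x y"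
  by (subst (1 2) ip_cnj) auto

lemma ip_minus_right [simp]: "x \<in> hcarrier H \<Longrightarrow> y \<in> hcarrier H \<Longrightarrow> z \<in> hcarrier H \<Longrightarrow>
    ip x (hminus H y z) = ip x y - ip x z"
  by (simp add: hminus_def)

lemma ip_minus_left [simp]: "x \<in> hcarrier H \<Longrightarrow> y \<in> hcarrier H \<Longrightarrow> z \<in> hcarrier H \<Longrightarrow>
    ip (hminus H x y) z = ip x z - ip y z"
  by (simp add: hminus_def)

lemma nrm_nonneg [simp]: "x \<in> hcarrier H \<Longrightarrow> 0 \<le> nrm x"
  by (simp add: hnorm_def ip_nonneg)

lemma nrm_square: "x \<in> hcarrier H \<Longrightarrow> (nrm x)\<^sup>2 = Re (ip x x)"
  by (simp add: hnorm_def ip_nonneg)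

lemma ip_self: "x \<in> hcarrier H \<Longrightarrow> ip x x = of_real ((nrm x)\<^sup>2)"
  using ip_cnj[of x x] by (simp add: nrm_square complex_eq_iff)

text \<open>The norm sees a vector only through its inner products. This replaces the vector space laws in the
  norm estimates below.\<close>

lemma nrm_cong:
  assumes "x \<in> hcarrier H" "y \<in> hcarrier H" "\<And>w. w \<in> hcarrier H \<Longrightarrow> ip w x = ip w y"
  shows "nrm x = nrm y"
proof -
  have "ip x x = ip x y" using assms by blast
  also have "\<dots> = cnj (ip y x)" using ip_cnj[of y x] assms by simp
  also have "\<dots> = cnj (ip y y)" using assms by simp
  finally show ?thesis by (simp add: hnorm_def)
qed

lemma nrm_scale: "x \<in> hcarrier H \<Longrightarrow> nrm (hscale H a x) = cmod a * nrm x"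
proof -
  assume x: "x \<in> hcarrier H"
  have "ip (hscale H a x) (hscale H a x) = cnj a * (a * ip x x)"
    using x by simp
  also have "\<dots> = of_real ((cmod a)\<^sup>2 * (nrm x)\<^sup>2)"
    by (simp only: ip_self[OF x] of_real_mult complex_norm_square mult_ac)
  finally show ?thesis
    using x by (simp add: hnorm_def ip_nonneg real_sqrt_mult nrm_square[unfolded hnorm_def])
qed

lemma Cauchy_Schwarz:
  assumes x: "x \<in> hcarrier H" and y: "y \<in> hcarrier H"
  shows "cmod (ip x y) \<le> nrm x * nrm y"
proof -
  define c where "c = ip x y"
  have yx: "ip y x = cnj c" using ip_cnj[OF x y] by (simp add: c_def)
  \<comment> \<open>The square of the norm of \<open>x - t \<langle>y, x\<rangle> y\<close>.\<close>
  have quad: "0 \<le> (nrm x)\<^sup>2 - 2 * t * (cmod c)\<^sup>2 + t\<^sup>2 * (cmod c)\<^sup>2 * (nrm y)\<^sup>2" for t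
  proof -
    define w where "w = hadd H x (hscale H (- of_real t * cnj c) y)"
    have "w \<in> hcarrier H" using x y by (simp add: w_def)
    have "ip w w = ip x x - 2 * of_real t * (c * cnj c) + (of_real t)\<^sup>2 * (c * cnj c) * ip y y"
      using x y by (simp add: w_def yx flip: c_def) (simp add: algebra_simps power2_eq_square)
    also have "\<dots> = of_real ((nrm x)\<^sup>2 - 2 * t * (cmod c)\<^sup>2 + t\<^sup>2 * (cmod c)\<^sup>2 * (nrm y)\<^sup>2)"
      unfolding complex_norm_square[symmetric] ip_self[OF x] ip_self[OF y] by simp
    finally have "ip w w = of_real ((nrm x)\<^sup>2 - 2 * t * (cmod c)\<^sup>2 + t\<^sup>2 * (cmod c)\<^sup>2 * (nrm y)\<^sup>2)" .
    then show ?thesis using ip_nonneg[OF \<open>w \<in> hcarrier H\<close>] by (metis Re_complex_of_real)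
  qed
  have "(cmod c)\<^sup>2 \<le> (nrm x)\<^sup>2 * (nrm y)\<^sup>2"
  proof (cases "nrm y = 0")
    case True
    have "c = 0"
    proof (rule ccontr)
      assume "c \<noteq> 0"
      then show False using quad[of "((nrm x)\<^sup>2 + 1) / (2 * (cmod c)\<^sup>2)"] True by simp
    qed
    then show ?thesis by simp
  next
    case False
    define b where "b = (nrm y)\<^sup>2"
    have b: "b > 0" using False by (simp add: b_def)
    have "2 * (1 / b) * (cmod c)\<^sup>2 = 2 * ((cmod c)\<^sup>2 / b)" "(1 / b)\<^sup>2 * (cmod c)\<^sup>2 * b = (cmod c)\<^sup>2 / b"
      using b by (auto simp: field_simps power2_eq_square)
    then have "(cmod c)\<^sup>2 / b \<le> (nrm x)\<^sup>2"
      using quad[of "1 / b", folded b_def] by linarith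
    then show ?thesis unfolding b_def[symmetric] using b by (simp add: pos_divide_le_eq)
  qed
  then have "(cmod c)\<^sup>2 \<le> (nrm x * nrm y)\<^sup>2" by (simp add: power_mult_distrib)
  then show ?thesis unfolding c_def by (rule power2_le_imp_le) (use x y in auto)
qed

lemma nrm_add: 
  assumes x: "x \<in> hcarrier H" and y: "y \<in> hcarrier H"
  shows "nrm (hadd H x y) \<le> nrm x + nrm y"
proof (rule power2_le_imp_le)
  have "(nrm (hadd H x y))\<^sup>2 = (nrm x)\<^sup>2 + (nrm y)\<^sup>2 + 2 * Re (ip x y)"
    using x y ip_cnj[OF x y] by (simp add: nrm_square)
  also have "\<dots> \<le> (nrm x)\<^sup>2 + (nrm y)\<^sup>2 + 2 * (nrm x * nrm y)"
    using complex_Re_le_cmod[of "ip x y"] Cauchy_Schwarz[OF x y] by simp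
  finally show "(nrm (hadd H x y))\<^sup>2 \<le> (nrm x + nrm y)\<^sup>2" by (simp add: power2_sum)
qed (use x y in auto)

lemma nrm_minus_triangle:
  assumes "x \<in> hcarrier H" "y \<in> hcarrier H" "z \<in> hcarrier H"
  shows "nrm (hminus H x z) \<le> nrm (hminus H x y) + nrm (hminus H y z)"
proof -
  have "nrm (hminus H x z) = nrm (hadd H (hminus H x y) (hminus H y z))"
    by (rule nrm_cong) (use assms in auto)
  then show ?thesis using nrm_add[of "hminus H x y" "hminus H y z"] assms by simp
qed

lemma nrm_minus_commute:
  assumes "x \<in> hcarrier H" "y \<in> hcarrier H"
  shows "nrm (hminus H x y) = nrm (hminus H y x)"
proof -
  have "nrm (hminus H x y) = nrm (hscale H (- 1) (hminus H y x))"
    by (rule nrm_cong) (use assms in auto)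
  then show ?thesis using assms by (simp add: nrm_scale)
qed

lemma nrm_minus_self: "x \<in> hcarrier H \<Longrightarrow> nrm (hminus H x x) = 0"
  by (simp add: hnorm_def)

lemma nrm_minus_add:
  assumes "x \<in> hcarrier H" "y \<in> hcarrier H" "x' \<in> hcarrier H" "y' \<in> hcarrier H"
  shows "nrm (hminus H (hadd H x y) (hadd H x' y')) \<le> nrm (hminus H x x') + nrm (hminus H y y')"
proof -
  have "nrm (hminus H (hadd H x y) (hadd H x' y')) = nrm (hadd H (hminus H x x') (hminus H y y'))"
    by (rule nrm_cong) (use assms in auto)
  then show ?thesis using nrm_add[of "hminus H x x'" "hminus H y y'"] assms by simp
qed

lemma nrm_minus_scale:
  assumes "x \<in> hcarrier H" "x' \<in> hcarrier H"
  shows "nrm (hminus H (hscale H a x) (hscale H a x')) = cmod a * nrm (hminus H x x')"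
proof -
  have "nrm (hminus H (hscale H a x) (hscale H a x')) = nrm (hscale H a (hminus H x x'))"
    by (rule nrm_cong) (use assms in \<open>auto simp: algebra_simps\<close>)
  then show ?thesis using assms by (simp add: nrm_scale)
qed

lemma nrm_le_add_minus:
  assumes "x \<in> hcarrier H" "y \<in> hcarrier H"
  shows "nrm x \<le> nrm y + nrm (hminus H x y)"
proof -
  have "nrm x = nrm (hadd H y (hminus H x y))"
    by (rule nrm_cong) (use assms in auto)
  then show ?thesis using nrm_add[of y "hminus H x y"] assms by simp
qed

lemma ip_diff_le:
  assumes "x \<in> hcarrier H" "y \<in> hcarrier H" "x' \<in> hcarrier H" "y' \<in> hcarrier H"
  shows "cmod (ip x y - ip x' y') \<le> nrm (hminus H x x') * nrm y + nrm x' * nrm (hminus H y y')"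
proof -
  have "ip x y - ip x' y' = ip (hminus H x x') y + ip x' (hminus H y y')"
    using assms by simp
  then show ?thesis
    using Cauchy_Schwarz[of "hminus H x x'" y] Cauchy_Schwarz[of x' "hminus H y y'"] assms
      norm_triangle_ineq[of "ip (hminus H x x') y" "ip x' (hminus H y y')"] by simp
qed

end

definition hlim :: "'a hilb \<Rightarrow> (nat \<Rightarrow> 'a) \<Rightarrow> 'a \<Rightarrow> bool" where
  "hlim H v x \<longleftrightarrow> (\<lambda>n. hnorm H (hminus H (v n) x)) \<longlonglongrightarrow> 0"

definition hCauchy :: "'a hilb \<Rightarrow> (nat \<Rightarrow> 'a) \<Rightarrow> bool" where
  "hCauchy H v \<longleftrightarrow> (\<forall>n. v n \<in> hcarrier H) \<and>
     (\<forall>\<epsilon>>0. \<exists>m. \<forall>k\<ge>m. \<forall>l\<ge>m. hnorm H (hminus H (v k) (v l)) < \<epsilon>)"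

definition hdense :: "'a hilb \<Rightarrow> 'a set \<Rightarrow> bool" where
  "hdense H D \<longleftrightarrow> D \<subseteq> hcarrier H \<and> (\<forall>x\<in>hcarrier H. \<forall>\<epsilon>>0. \<exists>y\<in>D. hnorm H (hminus H x y) < \<epsilon>)"

lemma hlimD: "hlim H v x \<Longrightarrow> \<epsilon> > 0 \<Longrightarrow> \<exists>m. \<forall>n\<ge>m. hnorm H (hminus H (v n) x) < \<epsilon>"
  unfolding hlim_def using LIMSEQ_D[of "\<lambda>n. hnorm H (hminus H (v n) x)" 0 \<epsilon>]
  by (metis abs_less_iff diff_zero real_norm_def)

context semi_inner_space
begin

lemma hCauchy_mem: "hCauchy H v \<Longrightarrow> v n \<in> hcarrier H"
  by (simp add: hCauchy_def)

lemma hCauchy_const: "x \<in> hcarrier H \<Longrightarrow> hCauchy H (\<lambda>_. x)"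
  by (simp add: hCauchy_def nrm_minus_self)

lemma hCauchyD: "hCauchy H v \<Longrightarrow> \<epsilon> > 0 \<Longrightarrow> \<exists>m. \<forall>k\<ge>m. \<forall>l\<ge>m. nrm (hminus H (v k) (v l)) < \<epsilon>"
  by (simp add: hCauchy_def)

lemma hCauchy_bounded:
  assumes v: "hCauchy H v"
  obtains C where "C > 0" "\<And>n. nrm (v n) \<le> C"
proof -
  note mem = hCauchy_mem[OF v]
  obtain m where m: "\<And>k. k \<ge> m \<Longrightarrow> nrm (hminus H (v k) (v m)) < 1"
    using hCauchyD[OF v, of 1] by auto
  define C where "C = Max ((\<lambda>n. nrm (v n)) ` {..m}) + 1"
  have le: "nrm (v n) \<le> Max ((\<lambda>n. nrm (v n)) ` {..m})" if "n \<le> m" for n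
    using that by (intro Max_ge) auto
  have "nrm (v n) \<le> C" for n
  proof (cases "n \<le> m")
    case True then show ?thesis unfolding C_def using le[OF True] by linarith
  next
    case False
    then show ?thesis
      unfolding C_def using m[of n] nrm_le_add_minus[OF mem mem, of n m] le[of m] by linarith
  qed
  moreover have "C > 0" unfolding C_def using le[of 0] nrm_nonneg[OF mem[of 0]] by linarith
  ultimately show ?thesis using that by blast
qed

lemma hCauchy_ip_convergent:
  assumes v: "hCauchy H v" and w: "hCauchy H w"
  shows "convergent (\<lambda>n. ip (v n) (w n))"
proof -
  note mem = hCauchy_mem[OF v] hCauchy_mem[OF w]
  obtain C where C: "C > 0" "\<And>n. nrm (v n) \<le> C" using hCauchy_bounded[OF v] by blast
  obtain D where D: "D > 0" "\<And>n. nrm (w n) \<le> D" using hCauchy_bounded[OF w] by blast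
  have "Cauchy (\<lambda>n. ip (v n) (w n))"
  proof (rule metric_CauchyI)
    fix e :: real assume e: "e > 0"
    obtain m where m: "\<And>k l. k \<ge> m \<Longrightarrow> l \<ge> m \<Longrightarrow> nrm (hminus H (v k) (v l)) < e / (2 * D)"
      using hCauchyD[OF v, of "e / (2 * D)"] e D by auto
    obtain n where n: "\<And>k l. k \<ge> n \<Longrightarrow> l \<ge> n \<Longrightarrow> nrm (hminus H (w k) (w l)) < e / (2 * C)"
      using hCauchyD[OF w, of "e / (2 * C)"] e C by auto
    have "dist (ip (v k) (w k)) (ip (v l) (w l)) < e" if kl: "k \<ge> max m n" "l \<ge> max m n" for k l
    proof -
      have "dist (ip (v k) (w k)) (ip (v l) (w l)) \<le>
          nrm (hminus H (v k) (v l)) * nrm (w k) + nrm (v l) * nrm (hminus H (w k) (w l))"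
        unfolding dist_norm by (rule ip_diff_le) (use mem in auto)
      also have "\<dots> \<le> nrm (hminus H (v k) (v l)) * D + C * nrm (hminus H (w k) (w l))"
        using C D mem by (intro add_mono mult_left_mono mult_right_mono) auto
      also have "\<dots> < e / (2 * D) * D + C * (e / (2 * C))"
        using m[of k l] n[of k l] kl C D by (intro add_strict_mono mult_strict_right_mono mult_strict_left_mono) auto
      also have "\<dots> = e" using C D by (simp add: field_simps)
      finally show ?thesis .
    qed
    then show "\<exists>M. \<forall>k\<ge>M. \<forall>l\<ge>M. dist (ip (v k) (w k)) (ip (v l) (w l)) < e" by blast
  qed
  then show ?thesis by (simp add: Cauchy_convergent)
qed

lemma tendsto_ip:
  assumes mem: "\<And>n. v n \<in> hcarrier H" "\<And>n. w n \<in> hcarrier H" "x \<in> hcarrier H" "y \<in> hcarrier H"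
    and v: "hlim H v x" and w: "hlim H w y"
  shows "(\<lambda>n. ip (v n) (w n)) \<longlonglongrightarrow> ip x y"
proof -
  let ?a = "\<lambda>n. nrm (hminus H (v n) x)" and ?b = "\<lambda>n. nrm (hminus H (w n) y)"
  have "(\<lambda>n. ?a n * (nrm y + ?b n) + nrm x * ?b n) \<longlonglongrightarrow> 0 * (nrm y + 0) + nrm x * 0"
    by (intro tendsto_intros v[unfolded hlim_def] w[unfolded hlim_def])
  then have lim: "(\<lambda>n. ?a n * (nrm y + ?b n) + nrm x * ?b n) \<longlonglongrightarrow> 0" by simp
  have "cmod (ip (v n) (w n) - ip x y) \<le> ?a n * (nrm y + ?b n) + nrm x * ?b n" for n
  proof -
    have "cmod (ip (v n) (w n) - ip x y) \<le> ?a n * nrm (w n) + nrm x * ?b n"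
      by (rule ip_diff_le) (use mem in auto)
    also have "?a n * nrm (w n) \<le> ?a n * (nrm y + ?b n)"
      by (rule mult_left_mono) (use mem nrm_le_add_minus in auto)
    finally show ?thesis by simp
  qed
  then have "(\<lambda>n. ip (v n) (w n) - ip x y) \<longlonglongrightarrow> 0"
    by (intro Lim_null_comparison[OF _ lim]) auto
  then show ?thesis by (simp add: LIM_zero_iff)
qed

lemma hlim_const: "x \<in> hcarrier H \<Longrightarrow> hlim H (\<lambda>_. x) x"
  by (simp add: hlim_def nrm_minus_self)

lemma hlim_imp_hCauchy:
  assumes mem: "\<And>n. v n \<in> hcarrier H" "x \<in> hcarrier H" and v: "hlim H v x"
  shows "hCauchy H v"
  unfolding hCauchy_def
proof (intro conjI allI impI)
  fix \<epsilon> :: real assume "\<epsilon> > 0"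
  then obtain m where m: "\<And>k. k \<ge> m \<Longrightarrow> nrm (hminus H (v k) x) < \<epsilon> / 2"
    using LIMSEQ_D[OF v[unfolded hlim_def], of "\<epsilon> / 2"] mem by auto
  have "nrm (hminus H (v k) (v l)) < \<epsilon>" if "k \<ge> m" "l \<ge> m" for k l
    using m[OF that(1)] m[OF that(2)] nrm_minus_triangle[OF mem(1,2,1), of k l]
      nrm_minus_commute[OF mem(1,2), of l] by simp
  then show "\<exists>m. \<forall>k\<ge>m. \<forall>l\<ge>m. nrm (hminus H (v k) (v l)) < \<epsilon>" by blast
qed (use mem in auto)

lemma hdense_seq:
  assumes D: "hdense H D" and x: "x \<in> hcarrier H"
  shows "\<exists>v. (\<forall>n. v n \<in> D) \<and> hlim H v x"
proof -
  have "\<exists>y\<in>D. nrm (hminus H x y) < inverse (real (Suc n))" for n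
    using D x by (simp add: hdense_def)
  then obtain v where v: "\<And>n. v n \<in> D" "\<And>n. nrm (hminus H x (v n)) < inverse (real (Suc n))"
    by metis
  have mem: "v n \<in> hcarrier H" for n using v(1) D by (auto simp: hdense_def)
  have "hlim H v x" unfolding hlim_def
    by (rule Lim_null_comparison[OF _ LIMSEQ_inverse_real_of_nat])
      (use v(2) mem x in \<open>auto intro!: always_eventually less_imp_le simp: nrm_minus_commute[of _ x]\<close>)
  then show ?thesis using v(1) by blast
qed

lemma Metric_space_hdist:
  assumes "\<And>x y. x \<in> hcarrier H \<Longrightarrow> y \<in> hcarrier H \<Longrightarrow> nrm (hminus H x y) = 0 \<Longrightarrow> x = y"
  shows "Metric_space (hcarrier H) (hdist H)"
proof
  show "0 \<le> hdist H x y" for x y by (simp add: hdist_def)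
  show "hdist H x y = hdist H y x" for x y by (simp add: hdist_def nrm_minus_commute)
  show "hdist H x y = 0 \<longleftrightarrow> x = y" if "x \<in> hcarrier H" "y \<in> hcarrier H" for x y
    using that assms by (auto simp: hdist_def nrm_minus_self)
  show "hdist H x z \<le> hdist H x y + hdist H y z"
    if "x \<in> hcarrier H" "y \<in> hcarrier H" "z \<in> hcarrier H" for x y z
    using that by (simp add: hdist_def nrm_minus_triangle)
qed

lemma mcomplete_iff:
  assumes "Metric_space (hcarrier H) (hdist H)"
  shows "Metric_space.mcomplete (hcarrier H) (hdist H) \<longleftrightarrow>
    (\<forall>v. hCauchy H v \<longrightarrow> (\<exists>x\<in>hcarrier H. hlim H v x))"
proof -
  interpret Metric_space "hcarrier H" "hdist H" by fact
  have "MCauchy v \<longleftrightarrow> hCauchy H v" for v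
  proof (cases "range v \<subseteq> hcarrier H")
    case True
    then have "v n \<in> hcarrier H" for n by auto
    then show ?thesis using True unfolding MCauchy_def hCauchy_def hdist_def by simp
  qed (auto simp: MCauchy_def hCauchy_def)
  moreover have "limitin mtopology v x sequentially \<longleftrightarrow> x \<in> hcarrier H \<and> hlim H v x" if "hCauchy H v" for v x
    using hCauchy_mem[OF that] unfolding limitin_metric hlim_def hdist_def
    by (auto simp: tendsto_iff dist_norm)
  ultimately show ?thesis unfolding mcomplete_def by blast
qed

end

context hilbert_space
begin

sublocale semi_inner_space H
  by standard (rule zero_closed add_closed scale_closed inner_cnj inner_add_right inner_scale_right
      inner_nonneg; assumption)+

lemma minus_eq_zeroD:
  assumes x: "x \<in> hcarrier H" and y: "y \<in> hcarrier H" and 0: "nrm (hminus H x y) = 0"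
  shows "x = y"
proof -
  have "ip (hminus H x y) (hminus H x y) = 0"
    by (simp only: ip_self[OF minus_mem[OF x y]] 0) simp
  then have z: "hminus H x y = hzero H" using x y by (intro inner_eq_zeroD) auto
  have "x = hadd H x (hminus H y y)" using x y by (simp add: minus_self add_zero)
  also have "\<dots> = hadd H y (hminus H x y)"
    using x y unfolding hminus_def
    by (simp add: add_assoc[of x y, symmetric] add_commute[of x y] add_assoc[of y x])
  also have "\<dots> = y" using y by (simp add: z add_zero)
  finally show ?thesis .
qed

lemma Metric_space_hilbert: "Metric_space (hcarrier H) (hdist H)"
  by (rule Metric_space_hdist) (rule minus_eq_zeroD)

lemma hCauchy_has_limit:
  assumes "hCauchy H v"
  obtains x where "x \<in> hcarrier H" "hlim H v x"
  using mcomplete_iff[OF Metric_space_hilbert] complete assms by blast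

lemma eq_if_ip_eq:
  assumes "x \<in> hcarrier H" "y \<in> hcarrier H" "\<And>w. w \<in> hcarrier H \<Longrightarrow> ip w x = ip w y"
  shows "x = y"
proof (rule minus_eq_zeroD)
  have "ip (hminus H x y) (hminus H x y) = 0" using assms by simp
  then show "nrm (hminus H x y) = 0" by (simp add: hnorm_def)
qed (use assms in auto)

lemma eq_if_ip_eq_dense:
  assumes D: "hdense H D" and x: "x \<in> hcarrier H" and y: "y \<in> hcarrier H"
    and eq: "\<And>d. d \<in> D \<Longrightarrow> ip d x = ip d y"
  shows "x = y"
proof (rule eq_if_ip_eq[OF x y])
  fix w assume w: "w \<in> hcarrier H"
  obtain d where d: "\<And>n. d n \<in> D" "hlim H d w" using hdense_seq[OF D w] by metis
  have mem: "d n \<in> hcarrier H" for n using d(1) D by (auto simp: hdense_def)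
  have "(\<lambda>n. ip (d n) x) \<longlonglongrightarrow> ip w x"
    by (rule tendsto_ip[OF mem x w x d(2) hlim_const[OF x]])
  moreover have "(\<lambda>n. ip (d n) y) \<longlonglongrightarrow> ip w y"
    by (rule tendsto_ip[OF mem y w y d(2) hlim_const[OF y]])
  ultimately show "ip w x = ip w y" using eq[OF d(1)] by (simp add: LIMSEQ_unique)
qed

lemma closure_of_eq_carrier_iff:
  assumes "D \<subseteq> hcarrier H"
  shows "Metric_space.mtopology (hcarrier H) (hdist H) closure_of D = hcarrier H \<longleftrightarrow> hdense H D"
proof -
  interpret M: Metric_space "hcarrier H" "hdist H" by (rule Metric_space_hilbert)
  show ?thesis
    using assms unfolding M.metric_closure_of hdense_def
    by (auto simp: hdist_def subset_iff set_eq_iff) blast+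
qed

end

text \<open>A point of the target is determined by its inner products with a dense family, so a
  correspondence between two dense families with equal Gram matrices extends to the whole spaces:
  the image of \<open>x\<close> is the point whose products with the second family are those of \<open>x\<close> with the
  first. This makes linearity automatic.\<close>

lemma isometry_extension_exists:
  assumes H: "hilbert_space H" and K: "hilbert_space K"
    and a: "hdense H (a ` I)" and b: "hdense K (b ` I)"
    and gram: "\<And>i j. i \<in> I \<Longrightarrow> j \<in> I \<Longrightarrow> hinner K (b i) (b j) = hinner H (a i) (a j)"
    and x: "x \<in> hcarrier H"
  shows "\<exists>s y. y \<in> hcarrier K \<and> (\<forall>n. s n \<in> I) \<and> hlim H (\<lambda>n. a (s n)) x \<and>
    hlim K (\<lambda>n. b (s n)) y \<and> (\<forall>i\<in>I. hinner K (b i) y = hinner H (a i) x)"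
proof -
  interpret H: hilbert_space H by fact
  interpret K: hilbert_space K by fact
  have aH: "a i \<in> hcarrier H" and bK: "b i \<in> hcarrier K" if "i \<in> I" for i
    using a b that by (auto simp: hdense_def)
  obtain v where v: "(\<forall>n. v n \<in> a ` I) \<and> hlim H v x" using H.hdense_seq[OF a x] ..
  then have "\<forall>n. \<exists>i. i \<in> I \<and> v n = a i" by (simp add: image_iff Bex_def)
  then obtain s where s: "\<And>n. s n \<in> I" "\<And>n. v n = a (s n)" by metis
  have ax: "hlim H (\<lambda>n. a (s n)) x" using v s(2) by (simp add: hlim_def)
  have dist: "hnorm K (hminus K (b i) (b j)) = hnorm H (hminus H (a i) (a j))" if "i \<in> I" "j \<in> I" for i j
    using that aH bK by (simp add: hnorm_def gram)
  have "hCauchy H (\<lambda>n. a (s n))"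
    using H.hlim_imp_hCauchy[OF _ x ax] aH s(1) by blast
  then have "hCauchy K (\<lambda>n. b (s n))"
    using s(1) aH bK by (simp add: hCauchy_def dist)
  then obtain y where y: "y \<in> hcarrier K" "hlim K (\<lambda>n. b (s n)) y"
    using K.hCauchy_has_limit by blast
  have "hinner K (b i) y = hinner H (a i) x" if i: "i \<in> I" for i
  proof -
    have "(\<lambda>n. hinner K (b i) (b (s n))) \<longlonglongrightarrow> hinner K (b i) y"
      by (rule K.tendsto_ip[OF _ _ _ y(1) K.hlim_const y(2)]) (use i s(1) bK in auto)
    moreover have "(\<lambda>n. hinner H (a i) (a (s n))) \<longlonglongrightarrow> hinner H (a i) x"
      by (rule H.tendsto_ip[OF _ _ _ x H.hlim_const ax]) (use i s(1) aH in auto)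
    ultimately show ?thesis using gram[OF i s(1)] by (simp add: LIMSEQ_unique)
  qed
  then show ?thesis using y s(1) ax by blast
qed

lemma unitary_extension:
  assumes H: "hilbert_space H" and K: "hilbert_space K"
    and a: "hdense H (a ` I)" and b: "hdense K (b ` I)"
    and gram: "\<And>i j. i \<in> I \<Longrightarrow> j \<in> I \<Longrightarrow> hinner K (b i) (b j) = hinner H (a i) (a j)"
  obtains W where "unitary_op H K W" "\<And>i. i \<in> I \<Longrightarrow> W (a i) = b i"
proof -
  interpret H: hilbert_space H by fact
  interpret K: hilbert_space K by fact
  have aH: "a i \<in> hcarrier H" and bK: "b i \<in> hcarrier K" if "i \<in> I" for i
    using a b that by (auto simp: hdense_def)
  have "\<exists>y. y \<in> hcarrier K \<and> (\<forall>i\<in>I. hinner K (b i) y = hinner H (a i) x)" if "x \<in> hcarrier H" for x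
    using isometry_extension_exists[OF H K a b gram that] by blast
  then obtain W where W: "\<And>x. x \<in> hcarrier H \<Longrightarrow> W x \<in> hcarrier K"
      "\<And>x i. x \<in> hcarrier H \<Longrightarrow> i \<in> I \<Longrightarrow> hinner K (b i) (W x) = hinner H (a i) x"
    by metis
  have uniq: "W x = y" if "x \<in> hcarrier H" "y \<in> hcarrier K" "\<And>i. i \<in> I \<Longrightarrow> hinner K (b i) y = hinner H (a i) x" for x y
    by (rule K.eq_if_ip_eq_dense[OF b W(1)]) (use that W(2) in auto)
  have Wa: "W (a i) = b i" if "i \<in> I" for i
    by (rule uniq) (use that aH bK gram in auto)
  have isom: "hinner K (W x) (W y) = hinner H x y" if x: "x \<in> hcarrier H" and y: "y \<in> hcarrier H" for x y
  proof -
    obtain s z where s: "z \<in> hcarrier K" "\<And>n. s n \<in> I" "hlim H (\<lambda>n. a (s n)) x" "hlim K (\<lambda>n. b (s n)) z"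
      "\<And>i. i \<in> I \<Longrightarrow> hinner K (b i) z = hinner H (a i) x"
      using isometry_extension_exists[OF H K a b gram x] by blast
    have z: "W x = z" by (rule uniq[OF x s(1,5)])
    have "(\<lambda>n. hinner K (b (s n)) (W y)) \<longlonglongrightarrow> hinner K (W x) (W y)"
      unfolding z by (rule K.tendsto_ip[OF _ _ s(1) _ s(4) K.hlim_const]) (use W(1)[OF y] bK s(2) in auto)
    moreover have "(\<lambda>n. hinner H (a (s n)) y) \<longlonglongrightarrow> hinner H x y"
      by (rule H.tendsto_ip[OF _ _ x _ s(3) H.hlim_const]) (use y aH s(2) in auto)
    ultimately show ?thesis using W(2)[OF y s(2)] by (simp add: LIMSEQ_unique)
  qed
  have "linear_op H K W"
    unfolding linear_op_def
  proof (intro conjI ballI allI)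
    fix x y assume xy: "x \<in> hcarrier H" "y \<in> hcarrier H"
    show "W (hadd H x y) = hadd K (W x) (W y)"
      by (rule uniq) (use xy W aH bK in auto)
  next
    fix c x assume x: "x \<in> hcarrier H"
    show "W (hscale H c x) = hscale K c (W x)"
      by (rule uniq) (use x W aH bK in auto)
  qed (use W in auto)
  moreover have "bij_betw W (hcarrier H) (hcarrier K)"
  proof (rule bij_betw_imageI)
    show "inj_on W (hcarrier H)"
    proof (rule inj_onI)
      fix x y assume xy: "x \<in> hcarrier H" "y \<in> hcarrier H" "W x = W y"
      show "x = y"
        by (rule H.eq_if_ip_eq_dense[OF a]) (use xy W(2) in \<open>auto simp flip: W(2)\<close>)
    qed
    show "W ` hcarrier H = hcarrier K"
    proof (intro equalityI subsetI)
      fix y assume y: "y \<in> hcarrier K"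
      obtain x where x: "x \<in> hcarrier H" "\<And>i. i \<in> I \<Longrightarrow> hinner H (a i) x = hinner K (b i) y"
        using isometry_extension_exists[OF K H b a gram[symmetric] y] by blast
      have "W x = y" by (rule uniq) (use x y in auto)
      then show "y \<in> W ` hcarrier H" using x(1) by blast
    qed (use W(1) in auto)
  qed
  ultimately show thesis using that[of W] isom Wa by (simp add: unitary_op_def)
qed

section \<open>Completion\<close>

context semi_inner_space
begin

text \<open>Two sequences on the right-hand side cover sums as well as images under a Lipschitz map.\<close>

lemma hCauchy_Lipschitz2:
  assumes v: "hCauchy H v" and w: "hCauchy H w" and C: "C \<ge> 0"
    and mem: "\<And>k. u k \<in> hcarrier H'"
    and le: "\<And>k l. hnorm H' (hminus H' (u k) (u l)) \<le> C * nrm (hminus H (v k) (v l)) + C * nrm (hminus H (w k) (w l))"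
  shows "hCauchy H' u"
  unfolding hCauchy_def
proof (intro conjI allI impI mem)
  fix \<epsilon> :: real assume e: "\<epsilon> > 0"
  define \<delta> where "\<delta> = \<epsilon> / (2 * (C + 1))"
  have "\<delta> > 0" using e C by (simp add: \<delta>_def)
  obtain m where m: "\<And>k l. k \<ge> m \<Longrightarrow> l \<ge> m \<Longrightarrow> nrm (hminus H (v k) (v l)) < \<delta>"
    using hCauchyD[OF v \<open>\<delta> > 0\<close>] by blast
  obtain n where n: "\<And>k l. k \<ge> n \<Longrightarrow> l \<ge> n \<Longrightarrow> nrm (hminus H (w k) (w l)) < \<delta>"
    using hCauchyD[OF w \<open>\<delta> > 0\<close>] by blast
  have "hnorm H' (hminus H' (u k) (u l)) < \<epsilon>" if "k \<ge> max m n" "l \<ge> max m n" for k l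
  proof -
    have "hnorm H' (hminus H' (u k) (u l)) \<le> C * \<delta> + C * \<delta>"
      using m[of k l] n[of k l] that C
      by (intro order_trans[OF le] add_mono mult_left_mono) auto
    moreover have "2 * (C + 1) * \<delta> = \<epsilon>" using C by (simp add: \<delta>_def)
    ultimately show ?thesis using \<open>\<delta> > 0\<close> by (simp add: algebra_simps)
  qed
  then show "\<exists>m. \<forall>k\<ge>m. \<forall>l\<ge>m. hnorm H' (hminus H' (u k) (u l)) < \<epsilon>" by blast
qed

lemma hCauchy_add:
  assumes v: "hCauchy H v" and w: "hCauchy H w"
  shows "hCauchy H (\<lambda>k. hadd H (v k) (w k))"
  using hCauchy_mem[OF v] hCauchy_mem[OF w]
  by (intro hCauchy_Lipschitz2[OF v w, of 1]) (auto intro: nrm_minus_add)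

lemma hCauchy_scale:
  assumes v: "hCauchy H v"
  shows "hCauchy H (\<lambda>k. hscale H a (v k))"
  using hCauchy_mem[OF v]
  by (intro hCauchy_Lipschitz2[OF v v, of "cmod a"]) (auto simp: nrm_minus_scale)

lemma hCauchy_minus:
  assumes v: "hCauchy H v" and w: "hCauchy H w"
  shows "hCauchy H (\<lambda>k. hminus H (v k) (w k))"
  unfolding hminus_def by (intro hCauchy_add hCauchy_scale v w)

end

text \<open>The completion is the space of Cauchy sequences modulo null sequences. A sequence of vectors
  whose inner products with a Cauchy sequence decide whether that sequence is null separates the
  classes; recording these inner products turns a class into a sequence of complex numbers, with
  the vector space operations being pointwise.\<close>

locale separated_semi_inner_space = semi_inner_space V for V :: "'a hilb" +
  fixes d :: "nat \<Rightarrow> 'a"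
  assumes d_mem [simp]: "d i \<in> hcarrier V"
    and separating: "hCauchy V v \<Longrightarrow> (\<And>i. (\<lambda>k. hinner V (d i) (v k)) \<longlonglongrightarrow> 0) \<Longrightarrow>
      (\<lambda>k. hnorm V (v k)) \<longlonglongrightarrow> 0"
begin

definition cls :: "(nat \<Rightarrow> 'a) \<Rightarrow> nat \<Rightarrow> complex" where
  "cls v = (\<lambda>i. lim (\<lambda>k. ip (d i) (v k)))"

definition repr :: "(nat \<Rightarrow> complex) \<Rightarrow> nat \<Rightarrow> 'a" where
  "repr F = (SOME v. hCauchy V v \<and> cls v = F)"

definition completion :: "(nat \<Rightarrow> complex) hilb" where
  "completion = \<lparr>hcarrier = {cls v |v. hCauchy V v}, hzero = (\<lambda>_. 0), hadd = (\<lambda>F G i. F i + G i),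
     hscale = (\<lambda>a F i. a * F i), hinner = (\<lambda>F G. lim (\<lambda>k. ip (repr F k) (repr G k)))\<rparr>"

definition lift_op :: "('a \<Rightarrow> 'a) \<Rightarrow> (nat \<Rightarrow> complex) \<Rightarrow> nat \<Rightarrow> complex" where
  "lift_op T F = cls (\<lambda>k. T (repr F k))"

lemma completion_simps [simp]:
  "hcarrier completion = {cls v |v. hCauchy V v}" "hzero completion = (\<lambda>_. 0)"
  "hadd completion F G = (\<lambda>i. F i + G i)" "hscale completion a F = (\<lambda>i. a * F i)"
  by (simp_all add: completion_def)

lemma cls_tendsto:
  assumes v: "hCauchy V v" shows "(\<lambda>k. ip (d i) (v k)) \<longlonglongrightarrow> cls v i"
  using hCauchy_ip_convergent[OF hCauchy_const[OF d_mem] v, of i]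
  by (simp add: convergent_LIMSEQ_iff cls_def)

lemma cls_add: "hCauchy V v \<Longrightarrow> hCauchy V w \<Longrightarrow> cls (\<lambda>k. hadd V (v k) (w k)) = (\<lambda>i. cls v i + cls w i)"
proof
  fix i assume v: "hCauchy V v" and w: "hCauchy V w"
  have "(\<lambda>k. ip (d i) (v k) + ip (d i) (w k)) \<longlonglongrightarrow> cls v i + cls w i"
    by (intro tendsto_add cls_tendsto v w)
  then show "cls (\<lambda>k. hadd V (v k) (w k)) i = cls v i + cls w i"
    using hCauchy_mem[OF v] hCauchy_mem[OF w] by (simp add: cls_def limI)
qed

lemma cls_scale: "hCauchy V v \<Longrightarrow> cls (\<lambda>k. hscale V a (v k)) = (\<lambda>i. a * cls v i)"
proof
  fix i assume v: "hCauchy V v"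
  have "(\<lambda>k. a * ip (d i) (v k)) \<longlonglongrightarrow> a * cls v i"
    by (intro tendsto_mult_left cls_tendsto v)
  then show "cls (\<lambda>k. hscale V a (v k)) i = a * cls v i"
    using hCauchy_mem[OF v] by (simp add: cls_def limI)
qed

lemma cls_minus: "hCauchy V v \<Longrightarrow> hCauchy V w \<Longrightarrow>
    cls (\<lambda>k. hminus V (v k) (w k)) = hminus completion (cls v) (cls w)"
  by (simp add: hminus_def cls_add cls_scale hCauchy_scale)

text \<open>The inner products with the vectors \<open>d i\<close> decide whether a difference of Cauchy sequences is null.\<close>

lemma cls_eq_iff:
  assumes v: "hCauchy V v" and w: "hCauchy V w"
  shows "cls v = cls w \<longleftrightarrow> (\<lambda>k. nrm (hminus V (v k) (w k))) \<longlonglongrightarrow> 0"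
proof
  note vw = hCauchy_minus[OF v w]
  note mem = hCauchy_mem[OF v] hCauchy_mem[OF w]
  assume eq: "cls v = cls w"
  have "cls (\<lambda>k. hminus V (v k) (w k)) i = 0" for i
    unfolding cls_minus[OF v w] by (simp add: eq hminus_def)
  then show "(\<lambda>k. nrm (hminus V (v k) (w k))) \<longlonglongrightarrow> 0"
    using cls_tendsto[OF vw] by (intro separating[OF vw]) metis
next
  note vw = hCauchy_minus[OF v w]
  note mem = hCauchy_mem[OF v] hCauchy_mem[OF w]
  assume lim: "(\<lambda>k. nrm (hminus V (v k) (w k))) \<longlonglongrightarrow> 0"
  have "cls v i - cls w i = 0" for i
  proof (rule LIMSEQ_unique)
    show "(\<lambda>k. ip (d i) (v k) - ip (d i) (w k)) \<longlonglongrightarrow> cls v i - cls w i"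
      by (intro tendsto_diff cls_tendsto v w)
    have lim': "(\<lambda>k. nrm (d i) * nrm (hminus V (v k) (w k))) \<longlonglongrightarrow> 0"
      using tendsto_mult_left[OF lim, of "nrm (d i)"] by simp
    have "cmod (ip (d i) (v k) - ip (d i) (w k)) \<le> nrm (d i) * nrm (hminus V (v k) (w k))" for k
      using Cauchy_Schwarz[of "d i" "hminus V (v k) (w k)"] mem by simp
    then show "(\<lambda>k. ip (d i) (v k) - ip (d i) (w k)) \<longlonglongrightarrow> 0"
      by (intro Lim_null_comparison[OF _ lim']) auto
  qed
  then show "cls v = cls w" by auto
qed

lemma cls_eqI:
  assumes v: "hCauchy V v" and w: "hCauchy V w"
    and eq: "\<And>k x. x \<in> hcarrier V \<Longrightarrow> ip x (v k) = ip x (w k)"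
  shows "cls v = cls w"
  unfolding cls_def using eq[OF d_mem] by simp

lemma repr_cls:
  assumes "hCauchy V v"
  shows "hCauchy V (repr (cls v))" "cls (repr (cls v)) = cls v"
  using someI[of "\<lambda>w. hCauchy V w \<and> cls w = cls v" v] assms by (auto simp: repr_def)

lemma hinner_cls:
  assumes v: "hCauchy V v" and w: "hCauchy V w"
  shows "(\<lambda>k. ip (v k) (w k)) \<longlonglongrightarrow> hinner completion (cls v) (cls w)"
proof -
  let ?v = "repr (cls v)" and ?w = "repr (cls w)"
  note v' = repr_cls(1)[OF v] note w' = repr_cls(1)[OF w]
  note mem = hCauchy_mem[OF v] hCauchy_mem[OF w] hCauchy_mem[OF v'] hCauchy_mem[OF w']
  have lim: "(\<lambda>k. ip (?v k) (?w k)) \<longlonglongrightarrow> hinner completion (cls v) (cls w)"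
    using hCauchy_ip_convergent[OF v' w'] by (simp add: completion_def convergent_LIMSEQ_iff)
  have dv: "(\<lambda>k. nrm (hminus V (v k) (?v k))) \<longlonglongrightarrow> 0"
    using cls_eq_iff[OF v v'] repr_cls(2)[OF v] by simp
  have dw: "(\<lambda>k. nrm (hminus V (w k) (?w k))) \<longlonglongrightarrow> 0"
    using cls_eq_iff[OF w w'] repr_cls(2)[OF w] by simp
  obtain C where C: "\<And>k. nrm (w k) \<le> C" using hCauchy_bounded[OF w] by blast
  obtain D where D: "\<And>k. nrm (?v k) \<le> D" using hCauchy_bounded[OF v'] by blast
  have "(\<lambda>k. nrm (hminus V (v k) (?v k)) * C + D * nrm (hminus V (w k) (?w k))) \<longlonglongrightarrow> 0 * C + D * 0"
    by (intro tendsto_intros dv dw)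
  then have lim0: "(\<lambda>k. nrm (hminus V (v k) (?v k)) * C + D * nrm (hminus V (w k) (?w k))) \<longlonglongrightarrow> 0"
    by simp
  have "cmod (ip (v k) (w k) - ip (?v k) (?w k)) \<le>
      nrm (hminus V (v k) (?v k)) * C + D * nrm (hminus V (w k) (?w k))" for k
  proof -
    have "cmod (ip (v k) (w k) - ip (?v k) (?w k)) \<le>
        nrm (hminus V (v k) (?v k)) * nrm (w k) + nrm (?v k) * nrm (hminus V (w k) (?w k))"
      by (rule ip_diff_le) (use mem in auto)
    also have "\<dots> \<le> nrm (hminus V (v k) (?v k)) * C + D * nrm (hminus V (w k) (?w k))"
      using C[of k] D[of k] mem by (intro add_mono mult_left_mono mult_right_mono) auto
    finally show ?thesis .
  qed
  then have "(\<lambda>k. ip (v k) (w k) - ip (?v k) (?w k)) \<longlonglongrightarrow> 0"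
    by (intro Lim_null_comparison[OF _ lim0]) auto
  from tendsto_add[OF this lim] show ?thesis by simp
qed

lemma hnorm_cls:
  assumes v: "hCauchy V v"
  shows "(\<lambda>k. nrm (v k)) \<longlonglongrightarrow> hnorm completion (cls v)"
  unfolding hnorm_def by (intro tendsto_real_sqrt tendsto_Re hinner_cls v)

lemma hdist_cls:
  assumes v: "hCauchy V v" and w: "hCauchy V w"
  shows "(\<lambda>k. nrm (hminus V (v k) (w k))) \<longlonglongrightarrow> hnorm completion (hminus completion (cls v) (cls w))"
  using hnorm_cls[OF hCauchy_minus[OF v w]] by (simp only: cls_minus[OF v w])

definition emb :: "'a \<Rightarrow> nat \<Rightarrow> complex" where
  "emb x = cls (\<lambda>_. x)"

lemma emb_mem [simp]: "x \<in> hcarrier V \<Longrightarrow> emb x \<in> hcarrier completion"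
  using hCauchy_const by (auto simp: emb_def)

lemma hinner_emb: "x \<in> hcarrier V \<Longrightarrow> y \<in> hcarrier V \<Longrightarrow> hinner completion (emb x) (emb y) = ip x y"
  using hinner_cls[OF hCauchy_const hCauchy_const, of x y] tendsto_const LIMSEQ_unique
  unfolding emb_def by blast

lemma semi_inner_space_completion: "semi_inner_space completion"
proof
  show "hzero completion \<in> hcarrier completion"
    using cls_scale[OF hCauchy_const[OF zero_mem], of 0] hCauchy_scale[OF hCauchy_const[OF zero_mem], of 0]
    by force
next
  fix F G assume "F \<in> hcarrier completion" "G \<in> hcarrier completion"
  then obtain v w where v: "hCauchy V v" "F = cls v" and w: "hCauchy V w" "G = cls w" by auto
  show "hadd completion F G \<in> hcarrier completion"
    using hCauchy_add[OF v(1) w(1)] cls_add[OF v(1) w(1)] v w by force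
  show "hscale completion a F \<in> hcarrier completion" for a
    using hCauchy_scale[OF v(1), of a] cls_scale[OF v(1), of a, symmetric] v(2) by auto
  show "hinner completion G F = cnj (hinner completion F G)"
  proof (rule LIMSEQ_unique)
    show "(\<lambda>k. ip (w k) (v k)) \<longlonglongrightarrow> hinner completion G F" using hinner_cls v w by simp
    have "(\<lambda>k. cnj (ip (v k) (w k))) \<longlonglongrightarrow> cnj (hinner completion F G)"
      using hinner_cls v w by (simp add: tendsto_cnj)
    moreover have "ip (w k) (v k) = cnj (ip (v k) (w k))" for k
      by (rule ip_cnj) (use hCauchy_mem v w in auto)
    ultimately show "(\<lambda>k. ip (w k) (v k)) \<longlonglongrightarrow> cnj (hinner completion F G)" by presburger
  qed
  show "hinner completion F (hscale completion a G) = a * hinner completion F G" for a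
  proof (rule LIMSEQ_unique)
    show "(\<lambda>k. a * ip (v k) (w k)) \<longlonglongrightarrow> a * hinner completion F G"
      using hinner_cls v w by (simp add: tendsto_mult_left)
    show "(\<lambda>k. a * ip (v k) (w k)) \<longlonglongrightarrow> hinner completion F (hscale completion a G)"
      using hinner_cls[OF v(1) hCauchy_scale[OF w(1)], of a] hCauchy_mem[OF v(1)] hCauchy_mem[OF w(1)]
      by (simp add: cls_scale v w)
  qed
  show "0 \<le> Re (hinner completion F F)"
  proof (rule tendsto_lowerbound)
    show "(\<lambda>k. Re (ip (v k) (v k))) \<longlonglongrightarrow> Re (hinner completion F F)"
      using hinner_cls[OF v(1) v(1)] v by (simp add: tendsto_Re)
  qed (use ip_nonneg hCauchy_mem[OF v(1)] in auto)
  fix G' assume "G' \<in> hcarrier completion"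
  then obtain u where u: "hCauchy V u" "G' = cls u" by auto
  show "hinner completion F (hadd completion G G') = hinner completion F G + hinner completion F G'"
  proof (rule LIMSEQ_unique)
    show "(\<lambda>k. ip (v k) (w k) + ip (v k) (u k)) \<longlonglongrightarrow> hinner completion F G + hinner completion F G'"
      using hinner_cls v w u by (simp add: tendsto_add)
    show "(\<lambda>k. ip (v k) (w k) + ip (v k) (u k)) \<longlonglongrightarrow> hinner completion F (hadd completion G G')"
      using hinner_cls[OF v(1) hCauchy_add[OF w(1) u(1)]] hCauchy_mem[OF v(1)] hCauchy_mem[OF w(1)] hCauchy_mem[OF u(1)]
      by (simp add: cls_add v w u)
  qed
qed

lemma completion_separated:
  assumes "F \<in> hcarrier completion" "G \<in> hcarrier completion" "hnorm completion (hminus completion F G) = 0"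
  shows "F = G"
proof -
  obtain v w where v: "hCauchy V v" "F = cls v" and w: "hCauchy V w" "G = cls w" using assms by auto
  show ?thesis using hdist_cls[OF v(1) w(1)] cls_eq_iff[OF v(1) w(1)] assms(3) v w by simp
qed

lemma hlim_emb:
  assumes v: "hCauchy V v"
  shows "hlim completion (\<lambda>n. emb (v n)) (cls v)"
  unfolding hlim_def
proof (rule LIMSEQ_I)
  fix r :: real assume r: "r > 0"
  then obtain m where m: "\<And>k l. k \<ge> m \<Longrightarrow> l \<ge> m \<Longrightarrow> nrm (hminus V (v k) (v l)) < r / 2"
    using hCauchyD[OF v, of "r / 2"] by auto
  have "norm (hnorm completion (hminus completion (emb (v n)) (cls v)) - 0) < r" if n: "n \<ge> m" for n
  proof -
    note c = hCauchy_const[OF hCauchy_mem[OF v, of n]]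
    interpret K: semi_inner_space completion by (rule semi_inner_space_completion)
    have "hnorm completion (hminus completion (emb (v n)) (cls v)) \<le> r / 2"
      unfolding emb_def
      by (rule tendsto_upperbound[OF hdist_cls[OF c v]])
        (use m[OF n] in \<open>auto intro!: exI[of _ m] less_imp_le simp: eventually_sequentially\<close>)
    moreover have "0 \<le> hnorm completion (hminus completion (emb (v n)) (cls v))"
      using emb_mem[OF hCauchy_mem[OF v, of n]] v by (intro K.nrm_nonneg K.minus_mem) auto
    ultimately show ?thesis using r by simp
  qed
  then show "\<exists>no. \<forall>n\<ge>no. norm (hnorm completion (hminus completion (emb (v n)) (cls v)) - 0) < r" by blast
qed

lemma hdense_emb:
  assumes D: "hdense V D"
  shows "hdense completion (emb ` D)"
  unfolding hdense_def
proof (intro conjI ballI allI impI)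
  have DV: "D \<subseteq> hcarrier V" using D by (simp add: hdense_def)
  then show "emb ` D \<subseteq> hcarrier completion" using emb_mem by blast
  interpret K: semi_inner_space completion by (rule semi_inner_space_completion)
  fix F and \<epsilon> :: real assume F: "F \<in> hcarrier completion" and e: "\<epsilon> > 0"
  then obtain v where v: "hCauchy V v" "F = cls v" by auto
  obtain n where n: "hnorm completion (hminus completion (emb (v n)) F) < \<epsilon> / 2"
    using hlimD[OF hlim_emb[OF v(1)], of "\<epsilon> / 2"] e v(2) by auto
  have vn: "v n \<in> hcarrier V" by (rule hCauchy_mem[OF v(1)])
  then obtain y where y: "y \<in> D" "nrm (hminus V (v n) y) < \<epsilon> / 2"
    using D e unfolding hdense_def by (meson half_gt_zero)
  have yV: "y \<in> hcarrier V" using y DV by blast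
  have "hnorm completion (hminus completion (emb (v n)) (emb y)) = nrm (hminus V (v n) y)"
    using K.ip_minus_left K.ip_minus_right emb_mem[OF vn] emb_mem[OF yV] vn yV
    by (simp add: hnorm_def hinner_emb del: completion_simps)
  then have "hnorm completion (hminus completion F (emb y)) < \<epsilon>"
    using K.nrm_minus_triangle[OF F emb_mem[OF vn] emb_mem[OF yV]] K.nrm_minus_commute[OF F emb_mem[OF vn]] n y(2)
    by linarith
  then show "\<exists>y\<in>emb ` D. hnorm completion (hminus completion F y) < \<epsilon>" using y(1) by blast
qed

text \<open>A Cauchy sequence of classes converges to the class of a diagonal sequence: pick from the
  \<open>n\<close>-th class a vector within \<open>1/(n+1)\<close> of it.\<close>

lemma hilbert_space_completion: "hilbert_space completion"
proof -
  interpret K: semi_inner_space completion by (rule semi_inner_space_completion)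
  have complete: "\<exists>F\<in>hcarrier completion. hlim completion X F" if X: "hCauchy completion X" for X
  proof -
    note XK = K.hCauchy_mem[OF X]
    have "\<exists>x\<in>hcarrier V. hnorm completion (hminus completion (emb x) (X n)) < inverse (real (Suc n))" for n
    proof -
      obtain v where v: "hCauchy V v" "X n = cls v" using XK[of n] by auto
      obtain k where "hnorm completion (hminus completion (emb (v k)) (X n)) < inverse (real (Suc n))"
        using hlimD[OF hlim_emb[OF v(1)], of "inverse (real (Suc n))"] v(2) by auto
      then show ?thesis using hCauchy_mem[OF v(1)] by blast
    qed
    then obtain x where x: "\<And>n. x n \<in> hcarrier V"
        "\<And>n. hnorm completion (hminus completion (emb (x n)) (X n)) < inverse (real (Suc n))"
      by metis
    have lim0: "(\<lambda>n. hnorm completion (hminus completion (emb (x n)) (X n))) \<longlonglongrightarrow> 0"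
      by (rule Lim_null_comparison[OF _ LIMSEQ_inverse_real_of_nat])
        (use x(2) K.nrm_nonneg[OF K.minus_mem[OF emb_mem[OF x(1)] XK]] in \<open>auto intro!: always_eventually less_imp_le simp del: completion_simps\<close>)
    have "hCauchy V x"
      unfolding hCauchy_def
    proof (intro conjI allI impI x(1))
      fix \<epsilon> :: real assume e: "\<epsilon> > 0"
      obtain m where m: "\<And>k l. k \<ge> m \<Longrightarrow> l \<ge> m \<Longrightarrow> hnorm completion (hminus completion (X k) (X l)) < \<epsilon> / 3"
        using K.hCauchyD[OF X, of "\<epsilon> / 3"] e by auto
      obtain n where n: "\<And>k. k \<ge> n \<Longrightarrow> hnorm completion (hminus completion (emb (x k)) (X k)) < \<epsilon> / 3"
        using LIMSEQ_D[OF lim0, of "\<epsilon> / 3"] e by (metis abs_less_iff diff_zero real_norm_def zero_less_divide_iff zero_less_numeral)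
      have "nrm (hminus V (x k) (x l)) < \<epsilon>" if kl: "k \<ge> max m n" "l \<ge> max m n" for k l
      proof -
        have "nrm (hminus V (x k) (x l)) = hnorm completion (hminus completion (emb (x k)) (emb (x l)))"
          using K.ip_minus_left K.ip_minus_right emb_mem[OF x(1)] x(1)
          by (simp add: hnorm_def hinner_emb del: completion_simps)
        also have "\<dots> \<le> hnorm completion (hminus completion (emb (x k)) (X k)) +
            (hnorm completion (hminus completion (X k) (X l)) + hnorm completion (hminus completion (X l) (emb (x l))))"
          using K.nrm_minus_triangle[OF emb_mem[OF x(1)] XK emb_mem[OF x(1)], of k l k]
            K.nrm_minus_triangle[OF XK XK emb_mem[OF x(1)], of k l l] by linarith
        also have "\<dots> < \<epsilon>"
          using m[of k l] n[of k] n[of l] kl K.nrm_minus_commute[OF XK emb_mem[OF x(1)], of l l] by simp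
        finally show ?thesis .
      qed
      then show "\<exists>m. \<forall>k\<ge>m. \<forall>l\<ge>m. nrm (hminus V (x k) (x l)) < \<epsilon>" by blast
    qed
    then have lim: "hlim completion (\<lambda>n. emb (x n)) (cls x)" and mem: "cls x \<in> hcarrier completion"
      using hlim_emb by auto
    have "hlim completion X (cls x)"
      unfolding hlim_def
    proof (rule Lim_null_comparison[OF _ tendsto_add_zero[OF lim0 lim[unfolded hlim_def]]])
      have "norm (hnorm completion (hminus completion (X n) (cls x))) \<le>
          hnorm completion (hminus completion (emb (x n)) (X n)) + hnorm completion (hminus completion (emb (x n)) (cls x))" for n
        using K.nrm_minus_triangle[OF XK[of n] emb_mem[OF x(1)[of n]] mem]
          K.nrm_minus_commute[OF XK[of n] emb_mem[OF x(1)[of n]]] K.nrm_nonneg[OF K.minus_mem[OF XK[of n] mem]]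
        by simp
      then show "\<forall>\<^sub>F n in sequentially. norm (hnorm completion (hminus completion (X n) (cls x))) \<le>
          hnorm completion (hminus completion (emb (x n)) (X n)) + hnorm completion (hminus completion (emb (x n)) (cls x))"
        by simp
    qed
    then show ?thesis using mem by blast
  qed
  have "Metric_space (hcarrier completion) (hdist completion)"
    by (rule K.Metric_space_hdist) (rule completion_separated)
  from K.mcomplete_iff[OF this] complete
  have mc: "Metric_space.mcomplete (hcarrier completion) (hdist completion)" by blast
  show ?thesis
  proof
    fix F assume F: "F \<in> hcarrier completion" "hinner completion F F = 0"
    show "F = hzero completion"
    proof (rule completion_separated[OF F(1) K.zero_mem])
      have "hminus completion F (hzero completion) = F" by (auto simp: hminus_def)
      then show "hnorm completion (hminus completion F (hzero completion)) = 0"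
        using F by (simp add: hnorm_def del: completion_simps)
    qed
  qed ((rule mc K.zero_mem K.add_mem K.scale_mem K.ip_cnj K.ip_add_right K.ip_scale_right K.ip_nonneg;
      assumption) | simp add: hminus_def algebra_simps)+
qed

definition lipschitz_op :: "('a \<Rightarrow> 'a) \<Rightarrow> bool" where
  "lipschitz_op T \<longleftrightarrow> (\<forall>x\<in>hcarrier V. T x \<in> hcarrier V) \<and>
     (\<exists>C. \<forall>x\<in>hcarrier V. \<forall>y\<in>hcarrier V. nrm (hminus V (T x) (T y)) \<le> C * nrm (hminus V x y))"

lemma lipschitz_op_mem: "lipschitz_op T \<Longrightarrow> x \<in> hcarrier V \<Longrightarrow> T x \<in> hcarrier V"
  by (simp add: lipschitz_op_def)

lemma lipschitz_opE:
  assumes "lipschitz_op T"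
  obtains C where "C \<ge> 0"
    "\<And>x y. x \<in> hcarrier V \<Longrightarrow> y \<in> hcarrier V \<Longrightarrow> nrm (hminus V (T x) (T y)) \<le> C * nrm (hminus V x y)"
proof -
  obtain C where C: "\<forall>x\<in>hcarrier V. \<forall>y\<in>hcarrier V. nrm (hminus V (T x) (T y)) \<le> C * nrm (hminus V x y)"
    using assms by (auto simp: lipschitz_op_def)
  have "nrm (hminus V (T x) (T y)) \<le> \<bar>C\<bar> * nrm (hminus V x y)" if "x \<in> hcarrier V" "y \<in> hcarrier V" for x y
  proof -
    have "C * nrm (hminus V x y) \<le> \<bar>C\<bar> * nrm (hminus V x y)"
      using that by (intro mult_right_mono) auto
    then show ?thesis using C that by (meson order_trans)
  qed
  then show thesis using that[of "\<bar>C\<bar>"] by simp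
qed

lemma lipschitz_op_hCauchy:
  assumes T: "lipschitz_op T" and v: "hCauchy V v"
  shows "hCauchy V (\<lambda>k. T (v k))"
proof -
  note mem = hCauchy_mem[OF v]
  obtain C where C: "C \<ge> 0"
    "\<And>x y. x \<in> hcarrier V \<Longrightarrow> y \<in> hcarrier V \<Longrightarrow> nrm (hminus V (T x) (T y)) \<le> C * nrm (hminus V x y)"
    using lipschitz_opE[OF T] by blast
  show ?thesis
  proof (rule hCauchy_Lipschitz2[OF v v C(1)])
    show "nrm (hminus V (T (v k)) (T (v l))) \<le> C * nrm (hminus V (v k) (v l)) + C * nrm (hminus V (v k) (v l))" for k l
      using C(2)[OF mem mem, of k l] mult_nonneg_nonneg[OF C(1) nrm_nonneg[OF minus_mem[OF mem mem]], of k l]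
      by linarith
  qed (rule lipschitz_op_mem[OF T mem])
qed

text \<open>The class of \<open>T \<circ> v\<close> depends only on that of \<open>v\<close>, because \<open>T\<close> maps sequences at distance
  tending to 0 to such sequences. Identities between operators on \<open>V\<close> thereby carry over to the
  completion by computing termwise.\<close>

lemma lift_op_cls:
  assumes T: "lipschitz_op T" and v: "hCauchy V v"
  shows "lift_op T (cls v) = cls (\<lambda>k. T (v k))"
  unfolding lift_op_def
proof (rule cls_eq_iff[THEN iffD2])
  note v' = repr_cls[OF v]
  note mem = hCauchy_mem[OF v] hCauchy_mem[OF v'(1)]
  obtain C where C: "\<And>x y. x \<in> hcarrier V \<Longrightarrow> y \<in> hcarrier V \<Longrightarrow> nrm (hminus V (T x) (T y)) \<le> C * nrm (hminus V x y)"
    using lipschitz_opE[OF T] by blast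
  show "hCauchy V (\<lambda>k. T (repr (cls v) k))" "hCauchy V (\<lambda>k. T (v k))"
    by (rule lipschitz_op_hCauchy[OF T v'(1)], rule lipschitz_op_hCauchy[OF T v])
  have "(\<lambda>k. nrm (hminus V (repr (cls v) k) (v k))) \<longlonglongrightarrow> 0"
    using cls_eq_iff[OF v'(1) v] v'(2) by simp
  from tendsto_mult_left[OF this, of C]
  have lim: "(\<lambda>k. C * nrm (hminus V (repr (cls v) k) (v k))) \<longlonglongrightarrow> 0" by simp
  have "norm (nrm (hminus V (T (repr (cls v) k)) (T (v k)))) \<le> C * nrm (hminus V (repr (cls v) k) (v k))" for k
    using C mem lipschitz_op_mem[OF T] by simp
  then show "(\<lambda>k. nrm (hminus V (T (repr (cls v) k)) (T (v k)))) \<longlonglongrightarrow> 0"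
    by (intro Lim_null_comparison[OF _ lim]) auto
qed

lemma lift_op_mem: "lipschitz_op T \<Longrightarrow> F \<in> hcarrier completion \<Longrightarrow> lift_op T F \<in> hcarrier completion"
  using lift_op_cls lipschitz_op_hCauchy by auto

lemma lift_op_emb: "lipschitz_op T \<Longrightarrow> x \<in> hcarrier V \<Longrightarrow> lift_op T (emb x) = emb (T x)"
  using lift_op_cls[OF _ hCauchy_const] by (simp add: emb_def)

lemma lift_op_comp:
  assumes "lipschitz_op T" "lipschitz_op S" "hCauchy V v"
  shows "lift_op T (lift_op S (cls v)) = cls (\<lambda>k. T (S (v k)))"
  using assms by (simp add: lift_op_cls lipschitz_op_hCauchy)

lemma lift_op_linear:
  assumes T: "lipschitz_op T"
    and add: "\<And>x y. x \<in> hcarrier V \<Longrightarrow> y \<in> hcarrier V \<Longrightarrow> T (hadd V x y) = hadd V (T x) (T y)"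
    and scale: "\<And>a x. x \<in> hcarrier V \<Longrightarrow> T (hscale V a x) = hscale V a (T x)"
  shows "linear_op completion completion (lift_op T)"
  unfolding linear_op_def
proof (intro conjI ballI allI lift_op_mem T)
  fix F G a assume F: "F \<in> hcarrier completion"
  then obtain v where v: "hCauchy V v" "F = cls v" by auto
  show "lift_op T (hscale completion a F) = hscale completion a (lift_op T F)"
    using lift_op_cls[OF T hCauchy_scale[OF v(1)], of a] scale[OF hCauchy_mem[OF v(1)]] 
      cls_scale[OF lipschitz_op_hCauchy[OF T v(1)], of a]
    by (simp add: v cls_scale lift_op_cls[OF T v(1)])
  assume "G \<in> hcarrier completion"
  then obtain w where w: "hCauchy V w" "G = cls w" by auto
  show "lift_op T (hadd completion F G) = hadd completion (lift_op T F) (lift_op T G)"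
    using lift_op_cls[OF T hCauchy_add[OF v(1) w(1)]] add[OF hCauchy_mem[OF v(1)] hCauchy_mem[OF w(1)]]
      cls_add[OF lipschitz_op_hCauchy[OF T v(1)] lipschitz_op_hCauchy[OF T w(1)]]
    by (simp add: v w cls_add lift_op_cls[OF T v(1)] lift_op_cls[OF T w(1)])
qed

lemma lift_op_bound:
  assumes T: "lipschitz_op T" and F: "F \<in> hcarrier completion"
    and le: "\<And>x. x \<in> hcarrier V \<Longrightarrow> nrm (T x) \<le> C * nrm x"
  shows "hnorm completion (lift_op T F) \<le> C * hnorm completion F"
proof -
  obtain v where v: "hCauchy V v" "F = cls v" using F by auto
  have "hnorm completion (cls (\<lambda>k. T (v k))) \<le> C * hnorm completion (cls v)"
  proof (rule tendsto_le[OF sequentially_bot])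
    show "(\<lambda>k. C * nrm (v k)) \<longlonglongrightarrow> C * hnorm completion (cls v)"
      by (intro tendsto_mult_left hnorm_cls v(1))
    show "(\<lambda>k. nrm (T (v k))) \<longlonglongrightarrow> hnorm completion (cls (\<lambda>k. T (v k)))"
      by (rule hnorm_cls[OF lipschitz_op_hCauchy[OF T v(1)]])
  qed (use le hCauchy_mem[OF v(1)] in auto)
  then show ?thesis by (simp add: v lift_op_cls[OF T v(1)])
qed

lemma lift_op_adjoint:
  assumes T: "lipschitz_op T" and S: "lipschitz_op S"
    and F: "F \<in> hcarrier completion" and G: "G \<in> hcarrier completion"
    and adj: "\<And>x y. x \<in> hcarrier V \<Longrightarrow> y \<in> hcarrier V \<Longrightarrow> ip (S x) y = ip x (T y)"
  shows "hinner completion (lift_op S F) G = hinner completion F (lift_op T G)"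
proof -
  obtain v w where v: "hCauchy V v" "F = cls v" and w: "hCauchy V w" "G = cls w" using F G by auto
  have "(\<lambda>k. ip (S (v k)) (w k)) \<longlonglongrightarrow> hinner completion (lift_op S F) G"
    using hinner_cls[OF lipschitz_op_hCauchy[OF S v(1)] w(1)] by (simp add: v w lift_op_cls[OF S v(1)])
  moreover have "(\<lambda>k. ip (v k) (T (w k))) \<longlonglongrightarrow> hinner completion F (lift_op T G)"
    using hinner_cls[OF v(1) lipschitz_op_hCauchy[OF T w(1)]] by (simp add: v w lift_op_cls[OF T w(1)])
  moreover have "(\<lambda>k. ip (S (v k)) (w k)) = (\<lambda>k. ip (v k) (T (w k)))"
    using adj[OF hCauchy_mem[OF v(1)] hCauchy_mem[OF w(1)]] by auto
  ultimately show ?thesis by (metis LIMSEQ_unique)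
qed

lemma lift_op_isometric:
  assumes T: "lipschitz_op T"
    and F: "F \<in> hcarrier completion" and G: "G \<in> hcarrier completion"
    and isom: "\<And>x y. x \<in> hcarrier V \<Longrightarrow> y \<in> hcarrier V \<Longrightarrow> ip (T x) (T y) = ip x y"
  shows "hinner completion (lift_op T F) (lift_op T G) = hinner completion F G"
proof -
  obtain v w where v: "hCauchy V v" "F = cls v" and w: "hCauchy V w" "G = cls w" using F G by auto
  have "(\<lambda>k. ip (T (v k)) (T (w k))) \<longlonglongrightarrow> hinner completion (lift_op T F) (lift_op T G)"
    using hinner_cls[OF lipschitz_op_hCauchy[OF T v(1)] lipschitz_op_hCauchy[OF T w(1)]]
    by (simp add: v w lift_op_cls[OF T v(1)] lift_op_cls[OF T w(1)])
  moreover have "(\<lambda>k. ip (v k) (w k)) \<longlonglongrightarrow> hinner completion F G"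
    using hinner_cls[OF v(1) w(1)] by (simp add: v w)
  moreover have "(\<lambda>k. ip (T (v k)) (T (w k))) = (\<lambda>k. ip (v k) (w k))"
    using isom[OF hCauchy_mem[OF v(1)] hCauchy_mem[OF w(1)]] by auto
  ultimately show ?thesis by (metis LIMSEQ_unique)
qed

end

section \<open>Representations of the bounded functions\<close>

locale Linf_rep = hilbert_space H for H :: "'a hilb" +
  fixes \<pi> :: "(complex \<Rightarrow> complex) \<Rightarrow> 'a \<Rightarrow> 'a"
  assumes star_rep: "star_rep H \<pi>"
begin

lemma rep_bounded: "f \<in> Linf \<Longrightarrow> bounded_op H (\<pi> f)"
  using star_rep unfolding star_rep_def by blast

lemma rep_mem [simp, intro]: "f \<in> Linf \<Longrightarrow> x \<in> hcarrier H \<Longrightarrow> \<pi> f x \<in> hcarrier H"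
  using rep_bounded[of f] by (simp add: bounded_op_def linear_op_def)

lemma rep_cong_AE: "f \<in> Linf \<Longrightarrow> g \<in> Linf \<Longrightarrow> (AE z in circle_measure. f z = g z) \<Longrightarrow>
    x \<in> hcarrier H \<Longrightarrow> \<pi> f x = \<pi> g x"
  using star_rep unfolding star_rep_def by blast

lemma rep_cong: "f \<in> Linf \<Longrightarrow> g \<in> Linf \<Longrightarrow> (\<And>z. z \<in> sphere 0 1 \<Longrightarrow> f z = g z) \<Longrightarrow>
    x \<in> hcarrier H \<Longrightarrow> \<pi> f x = \<pi> g x"
  by (rule rep_cong_AE) (auto simp: space_circle)

lemma rep_one [simp]: "x \<in> hcarrier H \<Longrightarrow> \<pi> (\<lambda>_. 1) x = x"
  using star_rep unfolding star_rep_def by blast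

lemma rep_add: "f \<in> Linf \<Longrightarrow> g \<in> Linf \<Longrightarrow> x \<in> hcarrier H \<Longrightarrow>
    \<pi> (\<lambda>z. f z + g z) x = hadd H (\<pi> f x) (\<pi> g x)"
  using star_rep unfolding star_rep_def by blast

lemma rep_scale: "f \<in> Linf \<Longrightarrow> x \<in> hcarrier H \<Longrightarrow> \<pi> (\<lambda>z. a * f z) x = hscale H a (\<pi> f x)"
  using star_rep unfolding star_rep_def by blast

lemma rep_mult: "f \<in> Linf \<Longrightarrow> g \<in> Linf \<Longrightarrow> x \<in> hcarrier H \<Longrightarrow> \<pi> (\<lambda>z. f z * g z) x = \<pi> f (\<pi> g x)"
  using star_rep unfolding star_rep_def by blast

lemma rep_adjoint: "f \<in> Linf \<Longrightarrow> x \<in> hcarrier H \<Longrightarrow> y \<in> hcarrier H \<Longrightarrow>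
    ip (\<pi> (\<lambda>z. cnj (f z)) x) y = ip x (\<pi> f y)"
  using star_rep unfolding star_rep_def by blast

lemma rep_linear: "f \<in> Linf \<Longrightarrow> linear_op H H (\<pi> f)"
  using rep_bounded by (simp add: bounded_op_def)

lemma rep_indicator_Int: "S \<in> sets circle_measure \<Longrightarrow> T \<in> sets circle_measure \<Longrightarrow> x \<in> hcarrier H \<Longrightarrow>
    \<pi> (indicator (S \<inter> T)) x = \<pi> (indicator S) (\<pi> (indicator T) x)"
  using rep_mult[OF Linf_indicator Linf_indicator, of S T x]
  by (simp add: indicator_inter_arith[abs_def])

lemma rep_indicator_idem: "S \<in> sets circle_measure \<Longrightarrow> x \<in> hcarrier H \<Longrightarrow>
    \<pi> (indicator S) (\<pi> (indicator S) x) = \<pi> (indicator S) x"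
  using rep_indicator_Int[of S S x] by simp

lemma rep_indicator_adjoint: "S \<in> sets circle_measure \<Longrightarrow> x \<in> hcarrier H \<Longrightarrow> y \<in> hcarrier H \<Longrightarrow>
    ip (\<pi> (indicator S) x) y = ip x (\<pi> (indicator S) y)"
proof -
  assume S: "S \<in> sets circle_measure" and xy: "x \<in> hcarrier H" "y \<in> hcarrier H"
  have "(\<lambda>z. cnj (indicator S z)) = (indicator S :: complex \<Rightarrow> complex)"
    by (auto simp: indicator_def)
  then show ?thesis using rep_adjoint[OF Linf_indicator[OF S] xy] by simp
qed

lemma nrm_rep_indicator:
  assumes S: "S \<in> sets circle_measure" and x: "x \<in> hcarrier H"
  shows "ip x (\<pi> (indicator S) x) = of_real ((nrm (\<pi> (indicator S) x))\<^sup>2)"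
proof -
  note L = Linf_indicator[OF S]
  have "ip x (\<pi> (indicator S) x) = ip (\<pi> (indicator S) x) (\<pi> (indicator S) x)"
    using rep_indicator_adjoint[OF S x rep_mem[OF L x]] rep_indicator_idem[OF S x] by simp
  then show ?thesis using ip_self[OF rep_mem[OF L x]] by simp
qed

end

lemma sets_scalar_spectral_measure [simp]: "sets (scalar_spectral_measure H E x) = sets circle_measure"
  by (simp add: scalar_spectral_measure_def sets.sigma_sets_eq del: space_circle)

lemma space_scalar_spectral_measure [simp]: "space (scalar_spectral_measure H E x) = sphere 0 1"
  using sets_eq_imp_space_eq[OF sets_scalar_spectral_measure] by simp

text \<open>Bounded pointwise convergence implies weak convergence of the operators. This is the
  continuity that makes \<open>S \<mapsto> \<pi>(1\<^sub>S)\<close> countably additive.\<close>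

locale normal_Linf_rep = Linf_rep +
  assumes normal: "\<And>F f C x y. (\<And>n. F n \<in> Linf) \<Longrightarrow> f \<in> Linf \<Longrightarrow>
    (\<And>n z. z \<in> sphere 0 1 \<Longrightarrow> cmod (F n z) \<le> C) \<Longrightarrow>
    (\<And>z. z \<in> sphere 0 1 \<Longrightarrow> (\<lambda>n. F n z) \<longlonglongrightarrow> f z) \<Longrightarrow>
    x \<in> hcarrier H \<Longrightarrow> y \<in> hcarrier H \<Longrightarrow> (\<lambda>n. hinner H x (\<pi> (F n) y)) \<longlonglongrightarrow> hinner H x (\<pi> f y)"
begin

abbreviation "E \<equiv> \<lambda>S. \<pi> (indicator S)"

lemma ip_rep_zero: "x \<in> hcarrier H \<Longrightarrow> y \<in> hcarrier H \<Longrightarrow> ip x (\<pi> (\<lambda>_. 0) y) = 0"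
  using rep_scale[of "\<lambda>_. 1" y 0] by simp

text \<open>Finite additivity is algebraic; the indicator functions of the partial unions converge boundedly.\<close>

lemma sums_rep_indicator:
  assumes A: "range A \<subseteq> sets circle_measure" "disjoint_family A"
    and x: "x \<in> hcarrier H" and y: "y \<in> hcarrier H"
  shows "(\<lambda>n. ip x (E (A n) y)) sums ip x (E (\<Union>n. A n) y)"
proof -
  have An: "A n \<in> sets circle_measure" for n using A(1) by auto
  have fin: "(\<Union>i<n. A i) \<in> sets circle_measure" for n using An by auto
  have eq: "(\<Sum>i<n. ip x (E (A i) y)) = ip x (E (\<Union>i<n. A i) y)" for n
  proof (induction n)
    case 0
    have "E (\<Union>i<0. A i) y = \<pi> (\<lambda>_. 0) y"
      by (rule rep_cong[OF Linf_indicator[OF fin] Linf_const _ y]) auto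
    then show ?case by (simp only: ip_rep_zero[OF x y] lessThan_0 sum.empty)
  next
    case (Suc n)
    have "A n \<inter> A i = {}" if "i < n" for i
      using A(2) that by (simp add: disjoint_family_on_def)
    then have "E (\<Union>i<Suc n. A i) y = \<pi> (\<lambda>z. indicator (\<Union>i<n. A i) z + indicator (A n) z) y"
      by (intro rep_cong Linf_add Linf_indicator An fin y)
        (auto simp: indicator_def lessThan_Suc)
    also have "\<dots> = hadd H (E (\<Union>i<n. A i) y) (E (A n) y)"
      by (intro rep_add Linf_indicator An fin y)
    finally show ?case using Suc x y Linf_indicator[OF fin] Linf_indicator[OF An] by simp
  qed
  have "(\<lambda>n. ip x (E (\<Union>i<n. A i) y)) \<longlonglongrightarrow> ip x (E (\<Union>n. A n) y)"
  proof (rule normal[where C = 1])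
    show "(indicator (\<Union>n. A n) :: complex \<Rightarrow> complex) \<in> Linf" using An by (intro Linf_indicator) auto
    show "(\<lambda>n. indicator (\<Union>i<n. A i) z :: complex) \<longlonglongrightarrow> indicator (\<Union>n. A n) z" for z
      by (rule LIMSEQ_indicator_UN)
  qed (use Linf_indicator[OF fin] x y in \<open>auto simp: indicator_def\<close>)
  then show ?thesis by (simp add: sums_def eq)
qed

lemma projection_valued_measure_rep: "projection_valued_measure H E"
  unfolding projection_valued_measure_def projection_op_def
proof (intro conjI ballI allI impI)
  fix x assume x: "x \<in> hcarrier H"
  show "E (space circle_measure) x = x"
    using rep_cong[OF Linf_indicator[of "sphere 0 1"] Linf_const[of 1], of x] x
    by (simp add: sets_circle_iff)
  fix S T assume ST: "S \<in> sets circle_measure" "T \<in> sets circle_measure"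
  show "E (S \<inter> T) x = E S (E T x)"
    by (rule rep_indicator_Int[OF ST x])
qed (auto intro: rep_bounded Linf_indicator rep_indicator_idem rep_indicator_adjoint sums_rep_indicator)

lemma emeasure_scalar_spectral_measure:
  assumes x: "x \<in> hcarrier H" and S: "S \<in> sets circle_measure"
  shows "emeasure (scalar_spectral_measure H E x) S = ennreal ((nrm (E S x))\<^sup>2)"
proof (rule emeasure_measure_of[OF scalar_spectral_measure_def[of H E x]])
  let ?\<mu> = "\<lambda>S. ennreal ((nrm (E S x))\<^sup>2)" and ?M = "scalar_spectral_measure H E x"
  show sub: "sets circle_measure \<subseteq> Pow (space circle_measure)" by (rule sets.space_closed)
  note sets = sets_scalar_spectral_measure[of H E x]
  show "S \<in> sets ?M" using S sets by simp
  have "nrm (E {} x) = 0"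
    using nrm_rep_indicator[of "{}" x] x ip_rep_zero[OF x x] 
      rep_cong[OF Linf_indicator[of "{}"] Linf_const[of 0] _ x] by simp
  then show "positive (sets ?M) ?\<mu>" by (simp add: positive_def)
  show "countably_additive (sets ?M) ?\<mu>"
  proof (rule countably_additiveI, unfold sets)
    fix A :: "nat \<Rightarrow> complex set"
    assume A: "range A \<subseteq> sets circle_measure" "disjoint_family A" "\<Union> (range A) \<in> sets circle_measure"
    have "(\<lambda>n. Re (ip x (E (A n) x))) sums Re (ip x (E (\<Union>n. A n) x))"
      by (intro sums_Re sums_rep_indicator A x)
    moreover have "A n \<in> sets circle_measure" for n using A(1) by auto
    ultimately have "(\<lambda>n. (nrm (E (A n) x))\<^sup>2) sums (nrm (E (\<Union>n. A n) x))\<^sup>2"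
      using A(3) x by (simp add: nrm_rep_indicator)
    then show "(\<Sum>i. ?\<mu> (A i)) = ?\<mu> (\<Union> (range A))"
      by (intro suminf_ennreal_eq) auto
  qed
qed

lemma finite_scalar_spectral_measure:
  "x \<in> hcarrier H \<Longrightarrow> finite_measure (scalar_spectral_measure H E x)"
  by (rule finite_measureI) (simp add: emeasure_scalar_spectral_measure sets_circle_iff)

lemma absolutely_continuous_scalar_spectral_measure:
  assumes x: "x \<in> hcarrier H"
  shows "absolutely_continuous circle_measure (scalar_spectral_measure H E x)"
  unfolding absolutely_continuous_def
proof
  fix S assume S: "S \<in> null_sets circle_measure"
  then have S': "S \<in> sets circle_measure" by auto
  have "AE z in circle_measure. indicator S z = (0::complex)"
    using AE_not_in[OF S] by eventually_elim simp
  then have "E S x = \<pi> (\<lambda>_. 0) x"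
    by (intro rep_cong_AE x Linf_indicator[OF S']) auto
  then have "nrm (E S x) = 0"
    using nrm_rep_indicator[OF S' x] ip_rep_zero[OF x x] by simp
  then show "S \<in> null_sets (scalar_spectral_measure H E x)"
    using emeasure_scalar_spectral_measure[OF x S'] S' by (simp add: null_sets_def)
qed

lemma integrable_scalar_spectral_measure:
  assumes "x \<in> hcarrier H" "f \<in> Linf"
  shows "integrable (scalar_spectral_measure H E x) f"
  using assms by (intro Linf_imp_integrable finite_scalar_spectral_measure
      absolutely_continuous_scalar_spectral_measure) auto

text \<open>Both sides agree on indicator functions by the construction of the scalar measure, and both are
  continuous under bounded pointwise convergence.\<close>

lemma is_spectral_integral_rep:
  assumes f: "f \<in> Linf"
  shows "is_spectral_integral H E f (\<pi> f)"
  unfolding is_spectral_integral_def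
proof (intro ballI conjI)
  fix x assume x: "x \<in> hcarrier H"
  let ?M = "scalar_spectral_measure H E x"
  interpret M: finite_measure ?M by (rule finite_scalar_spectral_measure[OF x])
  note int = integrable_scalar_spectral_measure[OF x]
  show "integrable ?M f" by (rule int[OF f])
  have "f \<in> Linf \<and> ip x (\<pi> f x) = (LINT z|?M. f z)"
    using f
  proof (induction rule: Linf_induct_indicator)
    case (ae f g)
    have "AE z in ?M. f z = g z"
      by (rule absolutely_continuous_AE[OF _ absolutely_continuous_scalar_spectral_measure[OF x] ae(3)]) simp
    then have "(LINT z|?M. f z) = (LINT z|?M. g z)"
      using ae int[of f] int[of g] by (intro integral_cong_AE) auto
    then show ?case using ae rep_cong_AE[of f g x] x by simp
  next
    case (indicator S)
    have "(LINT z|?M. (indicator S z :: complex)) = (LINT z|?M. complex_of_real (indicator S z))"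
      by (simp add: of_real_indicator)
    also have "\<dots> = of_real (measure ?M S)"
      unfolding integral_complex_of_real using indicator by (simp add: sets_circle_iff Int_absorb2)
    also have "measure ?M S = (nrm (E S x))\<^sup>2"
      using emeasure_scalar_spectral_measure[OF x indicator] by (simp add: measure_def)
    finally show ?case using nrm_rep_indicator[OF indicator x] Linf_indicator[OF indicator] by simp
  next
    case (add f g)
    then show ?case using x int by (simp add: rep_add Linf_add)
  next
    case (scale a f)
    then show ?case using x int by (simp add: rep_scale Linf_mult)
  next
    case (lim F f C)
    have "(\<lambda>n. ip x (\<pi> (F n) x)) \<longlonglongrightarrow> ip x (\<pi> f x)"
      by (rule normal[of F f C]) (use lim x in auto)
    moreover have "(\<lambda>n. LINT z|?M. F n z) \<longlonglongrightarrow> (LINT z|?M. f z)"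
    proof (rule integral_dominated_convergence[where w = "\<lambda>_. C"])
      show "AE z in ?M. (\<lambda>n. F n z) \<longlonglongrightarrow> f z" by (rule AE_I2) (use lim(3) in auto)
      show "AE z in ?M. norm (F n z) \<le> C" for n by (rule AE_I2) (use lim(2) in auto)
    qed (use int lim in auto)
    ultimately show ?case using lim LIMSEQ_unique by auto
  qed
  then show "ip x (\<pi> f x) = (LINT z|?M. f z)" by simp
qed

lemma spectral_resolution_rep: "spectral_resolution H (\<pi> (monom_fun 1)) E"
proof -
  have "monom_fun 1 = (\<lambda>z. z)" by (auto simp: monom_fun_def)
  then show ?thesis
    using is_spectral_integral_rep[OF Linf_monom_fun[of 1]] projection_valued_measure_rep
    by (simp add: spectral_resolution_def)
qed

end

section \<open>Scaling representations\<close>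

text \<open>The substitution for which \<open>U\<pi>(f)\<phi> = \<pi>(m\<^sub>0 f(z\<^sup>N))\<phi>\<close>.\<close>

definition dilate :: "nat \<Rightarrow> (complex \<Rightarrow> complex) \<Rightarrow> (complex \<Rightarrow> complex) \<Rightarrow> complex \<Rightarrow> complex" where
  "dilate N m0 f = (\<lambda>z. m0 z * f (z ^ N))"

lemma dilate_Linf: "N > 0 \<Longrightarrow> m0 \<in> Linf \<Longrightarrow> f \<in> Linf \<Longrightarrow> dilate N m0 f \<in> Linf"
  unfolding dilate_def by (intro Linf_mult Linf_power_comp)

lemma dilate_funpow_Linf: "N > 0 \<Longrightarrow> m0 \<in> Linf \<Longrightarrow> f \<in> Linf \<Longrightarrow> (dilate N m0 ^^ k) f \<in> Linf"
  by (induction k) (auto intro: dilate_Linf)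

lemma op_tendsto_const:
  assumes "semi_inner_space K" "\<And>x. x \<in> hcarrier K \<Longrightarrow> T x \<in> hcarrier K"
  shows "op_tendsto K (\<lambda>_. T) T"
  using assms semi_inner_space.nrm_nonneg[OF assms(1)]
  by (auto simp: op_tendsto_def semi_inner_space.nrm_minus_self[OF assms(1)])

lemma op_tendstoD:
  assumes "op_tendsto K S T" "\<epsilon> > 0" "x \<in> hcarrier K"
  shows "\<forall>\<^sub>F n in sequentially. hnorm K (hminus K (S n x) (T x)) \<le> \<epsilon> * hnorm K x"
proof -
  have "\<forall>\<^sub>F n in sequentially. \<forall>x\<in>hcarrier K. hnorm K (hminus K (S n x) (T x)) \<le> \<epsilon> * hnorm K x"
    using assms(1,2) unfolding op_tendsto_def by blast
  then show ?thesis by eventually_elim (use assms(3) in blast)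
qed

locale scaling_rep =
  fixes N :: nat and m0 :: "complex \<Rightarrow> complex" and r :: "'a rep"
  assumes N: "N > 0" and m0: "m0 \<in> Linf" and r: "r \<in> scaling_reps N m0"
begin

abbreviation "H \<equiv> rspace r"
abbreviation "\<pi> \<equiv> rfun r"
abbreviation "U \<equiv> runi r"
abbreviation "\<phi> \<equiv> rvec r"
abbreviation "U' \<equiv> inv_into (hcarrier H) U"

lemma r': "normal_cyclic_rep N r" "U \<phi> = \<pi> m0 \<phi>"
  using r by (auto simp: scaling_reps_def)

sublocale Linf_rep "rspace r" "rfun r"
  using r'(1) by (auto simp: normal_cyclic_rep_def Linf_rep_def Linf_rep_axioms_def)

lemma unitary_U: "unitary_op H H U" and cyclic: "cyclic_vector r"
  using r'(1) by (auto simp: normal_cyclic_rep_def)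

lemma \<phi>_mem [simp]: "\<phi> \<in> hcarrier H"
  using cyclic by (simp add: cyclic_vector_def)

lemma U_linear: "linear_op H H U" and U_bij: "bij_betw U (hcarrier H) (hcarrier H)"
  and U_ip: "x \<in> hcarrier H \<Longrightarrow> y \<in> hcarrier H \<Longrightarrow> ip (U x) (U y) = ip x y"
  using unitary_U by (auto simp: unitary_op_def)

lemma U_mem [simp]: "x \<in> hcarrier H \<Longrightarrow> U x \<in> hcarrier H"
  using U_linear by (simp add: linear_op_def)

lemma U'_mem [simp]: "x \<in> hcarrier H \<Longrightarrow> U' x \<in> hcarrier H"
  using U_bij by (auto simp: bij_betw_def intro: inv_into_into)

lemma U_U' [simp]: "x \<in> hcarrier H \<Longrightarrow> U (U' x) = x"
  using U_bij by (auto simp: bij_betw_def intro: f_inv_into_f)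

lemma U'_U [simp]: "x \<in> hcarrier H \<Longrightarrow> U' (U x) = x"
  using U_bij by (auto simp: bij_betw_def intro: inv_into_f_f)

lemma U'_ip: "x \<in> hcarrier H \<Longrightarrow> y \<in> hcarrier H \<Longrightarrow> ip (U' x) (U' y) = ip x y"
  using U_ip[of "U' x" "U' y"] by simp

lemma U'_adjoint: "x \<in> hcarrier H \<Longrightarrow> y \<in> hcarrier H \<Longrightarrow> ip (U' x) y = ip x (U y)"
  using U_ip[of "U' x" y] by simp

lemma U'_eqI: "x \<in> hcarrier H \<Longrightarrow> U x = y \<Longrightarrow> U' y = x"
  by auto

lemma U'_linear: "linear_op H H U'"
  using U_linear unfolding linear_op_def
  by (intro conjI ballI allI U'_eqI) auto

lemma covariant: "f \<in> Linf \<Longrightarrow> x \<in> hcarrier H \<Longrightarrow> U (\<pi> f x) = \<pi> (\<lambda>z. f (z ^ N)) (U x)"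
proof -
  assume f: "f \<in> Linf" and x: "x \<in> hcarrier H"
  have "U (\<pi> f (U' (U x))) = \<pi> (\<lambda>z. f (z ^ N)) (U x)"
    using r'(1) f U_mem[OF x] unfolding normal_cyclic_rep_def by blast
  then show ?thesis using x by simp
qed

lemma covariant_inv: "f \<in> Linf \<Longrightarrow> x \<in> hcarrier H \<Longrightarrow> \<pi> f (U' x) = U' (\<pi> (\<lambda>z. f (z ^ N)) x)"
proof -
  assume f: "f \<in> Linf" and x: "x \<in> hcarrier H"
  have "U (\<pi> f (U' x)) = \<pi> (\<lambda>z. f (z ^ N)) x"
    using covariant[OF f U'_mem[OF x]] by (simp only: U_U'[OF x])
  then show ?thesis using U'_eqI[OF rep_mem[OF f U'_mem[OF x]]] by metis
qed

definition orbit :: "nat \<Rightarrow> (complex \<Rightarrow> complex) \<Rightarrow> 'a" where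
  "orbit j f = (U' ^^ j) (\<pi> f \<phi>)"

lemma U'_funpow_mem [simp]: "x \<in> hcarrier H \<Longrightarrow> (U' ^^ j) x \<in> hcarrier H"
  by (induction j) auto

lemma orbit_mem [simp]: "f \<in> Linf \<Longrightarrow> orbit j f \<in> hcarrier H"
  by (simp add: orbit_def)

lemma orbit_0_1: "orbit 0 (\<lambda>_. 1) = \<phi>"
  by (simp add: orbit_def)

lemma U_rep_\<phi>: "f \<in> Linf \<Longrightarrow> U (\<pi> f \<phi>) = \<pi> (dilate N m0 f) \<phi>"
  unfolding dilate_def
  using covariant[of f \<phi>] rep_mult[OF Linf_power_comp[OF N] m0, of f \<phi>] r'(2)
  by (simp add: mult.commute)

text \<open>The scaling relation \<open>U\<phi> = \<pi>(m\<^sub>0)\<phi>\<close> makes the spaces \<open>U\<^sup>-\<^sup>j \<pi>(L\<^sup>\<infinity>) \<phi>\<close> increase with \<open>j\<close>.\<close>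

lemma orbit_Suc: "f \<in> Linf \<Longrightarrow> orbit (Suc j) (dilate N m0 f) = orbit j f"
  using U_rep_\<phi>[of f] U'_U[of "\<pi> f \<phi>"] by (simp add: orbit_def funpow_Suc_right del: funpow.simps)

lemma orbit_add: "f \<in> Linf \<Longrightarrow> orbit (j + k) ((dilate N m0 ^^ k) f) = orbit j f"
proof (induction k)
  case (Suc k)
  then show ?case using orbit_Suc[OF dilate_funpow_Linf[OF N m0 Suc.prems, of k], of "j + k"] by simp
qed simp

lemma orbit_le: "f \<in> Linf \<Longrightarrow> j \<le> l \<Longrightarrow> orbit j f = orbit l ((dilate N m0 ^^ (l - j)) f)"
  using orbit_add[of f j "l - j"] by simp

lemma U'_funpow_ip: "x \<in> hcarrier H \<Longrightarrow> y \<in> hcarrier H \<Longrightarrow> ip ((U' ^^ j) x) ((U' ^^ j) y) = ip x y"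
  by (induction j) (auto simp: U'_ip)

lemma U'_funpow_add: "x \<in> hcarrier H \<Longrightarrow> y \<in> hcarrier H \<Longrightarrow>
    (U' ^^ j) (hadd H x y) = hadd H ((U' ^^ j) x) ((U' ^^ j) y)"
  using U'_linear by (induction j) (auto simp: linear_op_def)

lemma rep_U'_funpow: "f \<in> Linf \<Longrightarrow> x \<in> hcarrier H \<Longrightarrow>
    \<pi> f ((U' ^^ j) x) = (U' ^^ j) (\<pi> (\<lambda>z. f (z ^ (N ^ j))) x)"
proof (induction j arbitrary: f)
  case (Suc j)
  have "\<pi> f (U' ((U' ^^ j) x)) = U' (\<pi> (\<lambda>z. f (z ^ N)) ((U' ^^ j) x))"
    using Suc.prems by (intro covariant_inv) auto
  also have "\<dots> = U' ((U' ^^ j) (\<pi> (\<lambda>z. f ((z ^ (N ^ j)) ^ N)) x))"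
    using Suc.IH[OF Linf_power_comp[OF N Suc.prems(1)] Suc.prems(2)] by simp
  finally show ?case by (simp add: power_mult[symmetric] mult.commute)
qed simp

lemma rep_orbit: "f \<in> Linf \<Longrightarrow> g \<in> Linf \<Longrightarrow> \<pi> f (orbit j g) = orbit j (\<lambda>z. f (z ^ (N ^ j)) * g z)"
  using N by (simp add: orbit_def rep_U'_funpow rep_mult Linf_power_comp)

lemma U'_orbit: "U' (orbit j f) = orbit (Suc j) f"
  by (simp add: orbit_def)

definition orbits :: "'a set" where
  "orbits = {orbit j f |j f. f \<in> Linf}"

lemma orbits_mem: "orbits \<subseteq> hcarrier H"
  by (auto simp: orbits_def)

text \<open>Two vectors can be moved to a common level, where addition is that of \<open>L\<^sup>\<infinity>\<close>.\<close>

lemma orbits_add: assumes "x \<in> orbits" "y \<in> orbits" shows "hadd H x y \<in> orbits"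
proof -
  obtain j f k g where fg: "x = orbit j f" "y = orbit k g" "f \<in> Linf" "g \<in> Linf"
    using assms by (auto simp: orbits_def)
  define l where "l = max j k"
  define f' where "f' = (dilate N m0 ^^ (l - j)) f"
  define g' where "g' = (dilate N m0 ^^ (l - k)) g"
  have L: "f' \<in> Linf" "g' \<in> Linf" using fg dilate_funpow_Linf[OF N m0] by (auto simp: f'_def g'_def)
  have "hadd H x y = hadd H (orbit l f') (orbit l g')"
    using fg orbit_le[of f j l] orbit_le[of g k l] by (simp add: f'_def g'_def l_def)
  also have "\<dots> = orbit l (\<lambda>z. f' z + g' z)"
    using L by (simp add: orbit_def U'_funpow_add rep_add)
  finally show ?thesis using Linf_add[OF L] by (auto simp: orbits_def)
qed

lemma orbits_invariant:
  "alg_wf a \<Longrightarrow> x \<in> orbits \<Longrightarrow> alg_eval r a x \<in> orbits"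
proof (induction a arbitrary: x)
  case (Fn f)
  then obtain j g where g: "x = orbit j g" "g \<in> Linf" by (auto simp: orbits_def)
  moreover have "(\<lambda>z. f (z ^ (N ^ j)) * g z) \<in> Linf"
    using Fn g N by (intro Linf_mult Linf_power_comp) auto
  ultimately show ?case using Fn rep_orbit[of f g j] by (auto simp: orbits_def)
next
  case Uni
  then obtain j f where f: "x = orbit j f" "f \<in> Linf" by (auto simp: orbits_def)
  show ?case
  proof (cases j)
    case 0
    then have "U x = orbit 0 (dilate N m0 f)" using f U_rep_\<phi>[of f] by (simp add: orbit_def)
    then show ?thesis using dilate_Linf[OF N m0 f(2)] by (auto simp: orbits_def)
  next
    case (Suc i)
    then have "U x = orbit i f" using f by (simp add: U'_orbit[symmetric])
    then show ?thesis using f by (auto simp: orbits_def)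
  qed
next
  case UniInv
  then show ?case using U'_orbit by (auto simp: orbits_def)
qed (auto intro: orbits_add)

lemma \<phi>_orbits: "\<phi> \<in> orbits"
  unfolding orbits_def using orbit_0_1[symmetric] Linf_const[of 1] by blast

text \<open>The set of the vectors \<open>U\<^sup>-\<^sup>j \<pi>(f) \<phi>\<close> contains \<open>\<phi>\<close> and is invariant under the generators, so its
  closure contains the orbit of \<open>\<phi>\<close> under the algebra.\<close>

lemma hdense_orbits: "hdense H orbits"
  unfolding hdense_def
proof (intro conjI ballI allI impI orbits_mem)
  fix x and \<epsilon> :: real assume x: "x \<in> hcarrier H" and e: "\<epsilon> > 0"
  let ?C = "{A \<phi> |A. A \<in> alg_image r}"
  have sub: "?C \<subseteq> hcarrier H" by (auto simp: alg_image_def linear_op_def)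
  then have "hdense H ?C"
    using closure_of_eq_carrier_iff[OF sub] cyclic by (simp add: cyclic_vector_def)
  then have "\<exists>y\<in>?C. nrm (hminus H x y) < \<epsilon> / 2"
    using x half_gt_zero[OF e] unfolding hdense_def by blast
  then obtain A where A: "A \<in> alg_image r" "nrm (hminus H x (A \<phi>)) < \<epsilon> / 2" by blast
  then obtain a where a': "\<forall>n. alg_wf (a n)" "linear_op H H A" "op_tendsto H (\<lambda>n. alg_eval r (a n)) A"
    unfolding alg_image_def by blast
  then have a: "\<And>n. alg_wf (a n)" "op_tendsto H (\<lambda>n. alg_eval r (a n)) A" "A \<phi> \<in> hcarrier H"
    by (auto simp: linear_op_def)
  define \<delta> where "\<delta> = \<epsilon> / (2 * (nrm \<phi> + 1))"
  have nphi: "nrm \<phi> \<ge> 0" by simp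
  have "2 * (c + 1) > 0" if "c \<ge> 0" for c :: real
    using that by (intro mult_pos_pos add_nonneg_pos) simp_all
  from this[OF nphi]
  have "\<delta> > 0" unfolding \<delta>_def using e by (rule divide_pos_pos[rotated])
  from op_tendstoD[OF a(2) this \<phi>_mem]
  obtain n where n: "nrm (hminus H (alg_eval r (a n) \<phi>) (A \<phi>)) \<le> \<delta> * nrm \<phi>"
    by (auto simp: eventually_sequentially)
  define y where "y = alg_eval r (a n) \<phi>"
  have y: "y \<in> orbits" unfolding y_def by (rule orbits_invariant[OF a(1) \<phi>_orbits])
  then have yH: "y \<in> hcarrier H" using orbits_mem by blast
  have "\<delta> * nrm \<phi> < \<delta> * (nrm \<phi> + 1)" using \<open>\<delta> > 0\<close> by simp
  also have "\<dots> = \<epsilon> / 2" using nphi by (simp add: \<delta>_def field_simps add_nonneg_eq_0_iff)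
  finally have "nrm (hminus H (A \<phi>) y) < \<epsilon> / 2"
    using n nrm_minus_commute[OF a(3) yH] by (simp add: y_def)
  then have "nrm (hminus H x y) < \<epsilon>"
    using A(2) nrm_minus_triangle[OF x a(3) yH] by linarith
  then show "\<exists>y\<in>orbits. nrm (hminus H x y) < \<epsilon>" using y by blast
qed

lemma ip_rep_rep: "f \<in> Linf \<Longrightarrow> g \<in> Linf \<Longrightarrow> x \<in> hcarrier H \<Longrightarrow> y \<in> hcarrier H \<Longrightarrow>
    ip (\<pi> f x) (\<pi> g y) = ip x (\<pi> (\<lambda>z. cnj (f z) * g z) y)"
  using rep_adjoint[OF Linf_cnj[of f], of x "\<pi> g y"] by (simp add: rep_mult Linf_cnj)

lemma ip_orbit:
  assumes h: "has_density r h" and f: "f \<in> Linf" and g: "g \<in> Linf"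
  shows "ip (orbit j f) (orbit k g) = (LINT z|circle_measure.
    cnj ((dilate N m0 ^^ (max j k - j)) f z) * (dilate N m0 ^^ (max j k - k)) g z * h z)"
proof -
  let ?f = "(dilate N m0 ^^ (max j k - j)) f" and ?g = "(dilate N m0 ^^ (max j k - k)) g"
  have L: "?f \<in> Linf" "?g \<in> Linf" using f g dilate_funpow_Linf[OF N m0] by auto
  have "ip (orbit j f) (orbit k g) = ip (orbit (max j k) ?f) (orbit (max j k) ?g)"
    using orbit_le[OF f, of j "max j k"] orbit_le[OF g, of k "max j k"] by simp
  also have "\<dots> = ip \<phi> (\<pi> (\<lambda>z. cnj (?f z) * ?g z) \<phi>)"
    using L by (simp add: orbit_def U'_funpow_ip ip_rep_rep)
  also have "\<dots> = (LINT z|circle_measure. cnj (?f z) * ?g z * h z)"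
    using h Linf_mult[OF Linf_cnj[OF L(1)] L(2)] by (simp add: has_density_def)
  finally show ?thesis .
qed

lemma alg_eval_mem: "alg_wf a \<Longrightarrow> x \<in> hcarrier H \<Longrightarrow> alg_eval r a x \<in> hcarrier H"
  by (induction a arbitrary: x) auto

end

subsection \<open>Unitary equivalence\<close>

locale scaling_rep_pair = R: scaling_rep N m0 r + S: scaling_rep N m0 s
  for N m0 and r :: "'a rep" and s :: "'b rep"
begin

lemma unitary_nrm:
  assumes "unitary_op R.H S.H W" "x \<in> hcarrier R.H" "y \<in> hcarrier R.H"
  shows "hnorm S.H (hminus S.H (W x) (W y)) = hnorm R.H (hminus R.H x y)"
  using assms by (simp add: unitary_op_def linear_op_def hnorm_def)

text \<open>Intertwining of the generators passes to words in them by induction, and then to simultaneous norm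
  limits of words.\<close>

lemma unitarily_equivalentI:
  assumes W: "unitary_op R.H S.H W"
    and \<pi>: "\<And>f x. f \<in> Linf \<Longrightarrow> x \<in> hcarrier R.H \<Longrightarrow> W (R.\<pi> f x) = S.\<pi> f (W x)"
    and U: "\<And>x. x \<in> hcarrier R.H \<Longrightarrow> W (R.U x) = S.U (W x)"
    and \<phi>: "W R.\<phi> = S.\<phi>"
  shows "unitarily_equivalent r s"
proof -
  have Wmem: "W x \<in> hcarrier S.H" if "x \<in> hcarrier R.H" for x
    using W that by (simp add: unitary_op_def linear_op_def)
  have Wadd: "W (hadd R.H x y) = hadd S.H (W x) (W y)" if "x \<in> hcarrier R.H" "y \<in> hcarrier R.H" for x y
    using W that by (simp add: unitary_op_def linear_op_def)
  have eval: "W (alg_eval r a x) = alg_eval s a (W x)" if "alg_wf a" "x \<in> hcarrier R.H" for a x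
    using that
  proof (induction a arbitrary: x)
    case UniInv
    have "S.U (W (R.U' x)) = W x" using U[of "R.U' x"] UniInv by simp
    then have "S.U' (W x) = W (R.U' x)" using UniInv Wmem by (intro S.U'_eqI) auto
    then show ?case by simp
  qed (auto simp: \<pi> U Wadd R.alg_eval_mem)
  have "W (A x) = B (W x)" if AB: "(A, B) \<in> alg_image2 r s" and x: "x \<in> hcarrier R.H" for A B x
  proof -
    obtain a where a': "\<forall>n. alg_wf (a n)" "linear_op R.H R.H A" "op_tendsto R.H (\<lambda>n. alg_eval r (a n)) A"
      "linear_op S.H S.H B" "op_tendsto S.H (\<lambda>n. alg_eval s (a n)) B"
      using AB unfolding alg_image2_def by blast
    then have a: "\<And>n. alg_wf (a n)" "A x \<in> hcarrier R.H" "op_tendsto R.H (\<lambda>n. alg_eval r (a n)) A"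
      "B (W x) \<in> hcarrier S.H" "op_tendsto S.H (\<lambda>n. alg_eval s (a n)) B"
      using x Wmem[OF x] by (auto simp: linear_op_def)
    have le: "hnorm S.H (hminus S.H (W (A x)) (B (W x))) \<le> \<epsilon> * (hnorm R.H x + hnorm S.H (W x))" if e: "\<epsilon> > 0" for \<epsilon>
    proof -
      have "\<forall>\<^sub>F n in sequentially. hnorm R.H (hminus R.H (alg_eval r (a n) x) (A x)) \<le> \<epsilon> * hnorm R.H x"
        by (rule op_tendstoD[OF a(3) e x])
      moreover have "\<forall>\<^sub>F n in sequentially. hnorm S.H (hminus S.H (alg_eval s (a n) (W x)) (B (W x))) \<le> \<epsilon> * hnorm S.H (W x)"
        by (rule op_tendstoD[OF a(5) e Wmem[OF x]])
      ultimately have "\<forall>\<^sub>F n in sequentially. hnorm R.H (hminus R.H (alg_eval r (a n) x) (A x)) \<le> \<epsilon> * hnorm R.H x \<and>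
          hnorm S.H (hminus S.H (alg_eval s (a n) (W x)) (B (W x))) \<le> \<epsilon> * hnorm S.H (W x)"
        by (rule eventually_conj)
      then obtain n where n: "hnorm R.H (hminus R.H (alg_eval r (a n) x) (A x)) \<le> \<epsilon> * hnorm R.H x"
          "hnorm S.H (hminus S.H (alg_eval s (a n) (W x)) (B (W x))) \<le> \<epsilon> * hnorm S.H (W x)"
        by (auto simp: eventually_sequentially)
      define y where "y = alg_eval r (a n) x"
      have y: "y \<in> hcarrier R.H" unfolding y_def by (rule R.alg_eval_mem[OF a(1) x])
      have "hnorm S.H (hminus S.H (W (A x)) (B (W x))) \<le>
          hnorm S.H (hminus S.H (W (A x)) (W y)) + hnorm S.H (hminus S.H (W y) (B (W x)))"
        by (rule S.nrm_minus_triangle) (use a y Wmem in auto)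
      also have "hnorm S.H (hminus S.H (W (A x)) (W y)) \<le> \<epsilon> * hnorm R.H x"
        using n(1) unitary_nrm[OF W a(2) y] R.nrm_minus_commute[OF a(2) y] by (simp add: y_def)
      also have "hnorm S.H (hminus S.H (W y) (B (W x))) \<le> \<epsilon> * hnorm S.H (W x)"
        using n(2) eval[OF a(1) x] by (simp add: y_def)
      finally show ?thesis by (simp add: distrib_left)
    qed
    define d where "d = hnorm S.H (hminus S.H (W (A x)) (B (W x)))"
    define c where "c = hnorm R.H x + hnorm S.H (W x)"
    have c: "c \<ge> 0" using x Wmem[OF x] by (simp add: c_def)
    have d0: "d \<ge> 0" unfolding d_def using a(2,4) Wmem by (intro S.nrm_nonneg S.minus_mem) auto
    have "d = 0"
    proof (rule ccontr)
      assume "d \<noteq> 0"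
      then have d: "d > 0" using d0 by simp
      have "d \<le> d / (2 * (c + 1)) * c"
        using le[of "d / (2 * (c + 1))"] d c by (simp add: d_def c_def)
      also have "\<dots> < d"
      proof -
        have "d / (2 * (c + 1)) * c = d * (c / (2 * (c + 1)))" by simp
        also have "\<dots> < d * 1" using d c by (intro mult_strict_left_mono) auto
        finally show ?thesis by simp
      qed
      finally show False by simp
    qed
    then show ?thesis unfolding d_def using a(2,4) Wmem by (intro S.minus_eq_zeroD) auto
  qed
  then show ?thesis using W \<phi> by (auto simp: unitarily_equivalent_def)
qed

text \<open>The pair \<open>(\<pi>(f), \<pi>'(f))\<close> is the image of an element of the algebra, so \<open>W\<close> carries \<open>\<langle>\<phi>, \<pi>(f)\<phi>\<rangle>\<close> over.\<close>

lemma unitarily_equivalent_has_density: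
  assumes eq: "unitarily_equivalent r s" and h: "has_density r h"
  shows "has_density s h"
  unfolding has_density_def
proof
  fix f assume f: "f \<in> Linf"
  obtain W where W: "unitary_op R.H S.H W" "W R.\<phi> = S.\<phi>"
      "\<And>A B x. (A, B) \<in> alg_image2 r s \<Longrightarrow> x \<in> hcarrier R.H \<Longrightarrow> W (A x) = B (W x)"
    using eq by (fastforce simp: unitarily_equivalent_def)
  have "(R.\<pi> f, S.\<pi> f) \<in> alg_image2 r s"
    unfolding alg_image2_def
    using f R.rep_linear[OF f] S.rep_linear[OF f]
      op_tendsto_const[OF R.semi_inner_space_axioms R.rep_mem[OF f]]
      op_tendsto_const[OF S.semi_inner_space_axioms S.rep_mem[OF f]]
    by (auto intro!: exI[of _ "\<lambda>_. Fn f"])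
  from W(3)[OF this R.\<phi>_mem] have "W (R.\<pi> f R.\<phi>) = S.\<pi> f S.\<phi>" by (simp add: W(2))
  then have "hinner S.H S.\<phi> (S.\<pi> f S.\<phi>) = hinner S.H (W R.\<phi>) (W (R.\<pi> f R.\<phi>))"
    by (simp add: W(2))
  also have "\<dots> = hinner R.H R.\<phi> (R.\<pi> f R.\<phi>)"
    using W(1) f by (simp add: unitary_op_def)
  finally show "hinner S.H S.\<phi> (S.\<pi> f S.\<phi>) = (LINT z|circle_measure. f z * h z)"
    using h f by (simp add: has_density_def)
qed

text \<open>The density determines the Gram matrix of the vectors \<open>U\<^sup>-\<^sup>j \<pi>(f) \<phi>\<close>, hence the matching of
  these vectors in the two representations extends to a unitary. It intertwines because the
  generators and their adjoints permute these vectors by the same rule on both sides.\<close>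

theorem unitarily_equivalent_if_same_density:
  assumes hr: "has_density r h" and hs: "has_density s h"
  shows "unitarily_equivalent r s"
proof -
  define I where "I = (UNIV :: nat set) \<times> Linf"
  let ?a = "\<lambda>(j, f). R.orbit j f" and ?b = "\<lambda>(j, f). S.orbit j f"
  have a: "hdense R.H (?a ` I)"
    using R.hdense_orbits by (simp add: R.orbits_def I_def image_def case_prod_beta conj_commute Bex_def)
  have b: "hdense S.H (?b ` I)"
    using S.hdense_orbits by (simp add: S.orbits_def I_def image_def case_prod_beta conj_commute Bex_def)
  have gram: "hinner S.H (?b i) (?b j) = hinner R.H (?a i) (?a j)" if "i \<in> I" "j \<in> I" for i j
    using that R.ip_orbit[OF hr] S.ip_orbit[OF hs] by (auto simp: I_def)
  obtain W where W: "unitary_op R.H S.H W" "\<And>i. i \<in> I \<Longrightarrow> W (?a i) = ?b i"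
    using unitary_extension[OF R.hilbert_space_axioms S.hilbert_space_axioms a b gram] by blast
  have Wo: "W (R.orbit j f) = S.orbit j f" if "f \<in> Linf" for j f
    using W(2)[of "(j, f)"] that by (simp add: I_def)
  have Wmem: "W x \<in> hcarrier S.H" if "x \<in> hcarrier R.H" for x
    using W(1) that by (simp add: unitary_op_def linear_op_def)
  have Wip: "hinner S.H (W x) (W y) = hinner R.H x y" if "x \<in> hcarrier R.H" "y \<in> hcarrier R.H" for x y
    using W(1) that by (simp add: unitary_op_def)
  show ?thesis
  proof (rule unitarily_equivalentI[OF W(1)])
    show "W R.\<phi> = S.\<phi>"
      using Wo[of "\<lambda>_. 1" 0] by (simp add: R.orbit_0_1 S.orbit_0_1)
    fix x assume x: "x \<in> hcarrier R.H"
    show "W (R.U x) = S.U (W x)"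
    proof (rule S.eq_if_ip_eq_dense[OF S.hdense_orbits])
      fix y assume "y \<in> S.orbits"
      then obtain j f where f: "y = S.orbit j f" "f \<in> Linf" by (auto simp: S.orbits_def)
      have "hinner S.H y (S.U (W x)) = hinner S.H (S.U' y) (W x)"
        using f x Wmem by (simp add: S.U'_adjoint)
      also have "\<dots> = hinner S.H (W (R.orbit (Suc j) f)) (W x)"
        using f by (simp add: S.U'_orbit Wo)
      also have "\<dots> = hinner R.H (R.U' (R.orbit j f)) x"
        using f x by (simp add: R.U'_orbit Wip)
      also have "\<dots> = hinner S.H (W (R.orbit j f)) (W (R.U x))"
        using f x by (simp add: R.U'_adjoint Wip)
      finally show "hinner S.H y (W (R.U x)) = hinner S.H y (S.U (W x))"
        using f by (simp add: Wo)
    qed (use x Wmem in auto)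
    fix f assume f: "f \<in> Linf"
    show "W (R.\<pi> f x) = S.\<pi> f (W x)"
    proof (rule S.eq_if_ip_eq_dense[OF S.hdense_orbits])
      fix y assume "y \<in> S.orbits"
      then obtain j g where g: "y = S.orbit j g" "g \<in> Linf" by (auto simp: S.orbits_def)
      let ?g = "\<lambda>z. cnj (f (z ^ (N ^ j))) * g z"
      have gL: "?g \<in> Linf"
        using R.N f g by (intro Linf_mult Linf_cnj Linf_power_comp) auto
      have "hinner S.H y (S.\<pi> f (W x)) = hinner S.H (S.\<pi> (\<lambda>z. cnj (f z)) y) (W x)"
        using f g x Wmem by (simp add: S.rep_adjoint)
      also have "\<dots> = hinner S.H (W (R.orbit j ?g)) (W x)"
        using f g gL by (simp add: S.rep_orbit Linf_cnj Wo)
      also have "\<dots> = hinner R.H (R.\<pi> (\<lambda>z. cnj (f z)) (R.orbit j g)) x"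
        using f g gL x by (simp add: R.rep_orbit Linf_cnj Wip)
      also have "\<dots> = hinner S.H (W (R.orbit j g)) (W (R.\<pi> f x))"
        using f g x by (simp add: R.rep_adjoint Wip)
      finally show "hinner S.H y (W (R.\<pi> f x)) = hinner S.H y (S.\<pi> f (W x))"
        using g by (simp add: Wo)
    qed (use x f Wmem in auto)
  qed
qed

end

section \<open>The harmonic density of a scaling representation\<close>

context scaling_rep
begin

text \<open>The scalar measure is finite because the constant function 1 has a spectral integral; its density is
  then finite almost everywhere, so that it may be taken real-valued.\<close>

lemma has_density_exists:
  obtains h where "integrable circle_measure h" "AE z in circle_measure. h z \<in> \<real>\<^sub>\<ge>\<^sub>0" "has_density r h"
proof -
  obtain E where E: "\<And>f. f \<in> Linf \<Longrightarrow> is_spectral_integral H E f (\<pi> f)"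
      "absolutely_continuous circle_measure (scalar_spectral_measure H E \<phi>)"
    using r'(1) unfolding normal_cyclic_rep_def by blast
  define \<rho> where "\<rho> = scalar_spectral_measure H E \<phi>"
  have sets: "sets \<rho> = sets circle_measure" by (simp add: \<rho>_def)
  have space: "space \<rho> = space circle_measure" by (rule sets_eq_imp_space_eq[OF sets])
  have ac: "absolutely_continuous circle_measure \<rho>" using E(2) by (simp add: \<rho>_def)
  have int: "integrable \<rho> f" "ip \<phi> (\<pi> f \<phi>) = (LINT z|\<rho>. f z)" if "f \<in> Linf" for f
    using E(1)[OF that] by (auto simp: is_spectral_integral_def \<rho>_def)
  obtain k where k: "k \<in> borel_measurable circle_measure" "density circle_measure k = \<rho>"
    using circle.Radon_Nikodym[OF ac sets] by blast
  have "(\<integral>\<^sup>+ z. ennreal (norm (1::complex)) \<partial>\<rho>) < \<infinity>"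
    using int(1)[OF Linf_const[of 1]] by (simp only: integrable_iff_bounded)
  then have fin: "emeasure \<rho> (space \<rho>) < \<infinity>" by simp
  have "(\<integral>\<^sup>+ z. k z \<partial>circle_measure) = emeasure \<rho> (space \<rho>)"
    unfolding k(2)[symmetric] using k(1) sets.top[of circle_measure]
    by (subst emeasure_density) (auto intro!: nn_integral_cong simp del: space_circle)
  then have "AE z in circle_measure. k z \<noteq> \<infinity>"
    using fin k(1) by (intro nn_integral_PInf_AE) auto
  define g where "g z = enn2real (k z)" for z
  have g[measurable]: "g \<in> borel_measurable circle_measure" unfolding g_def using k(1) by measurable
  have g0: "g z \<ge> 0" for z by (simp add: g_def)
  have \<rho>: "\<rho> = density circle_measure (\<lambda>z. ennreal (g z))"
    unfolding k(2)[symmetric]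
  proof (rule density_cong)
    show "AE z in circle_measure. k z = ennreal (g z)"
      using \<open>AE z in circle_measure. k z \<noteq> \<infinity>\<close> by eventually_elim (simp add: g_def ennreal_enn2real_if)
  qed (use k(1) g in auto)
  define h where "h z = complex_of_real (g z)" for z
  have "integrable circle_measure (\<lambda>z. g z *\<^sub>R (1::complex))"
    using int(1)[OF Linf_const[of 1]] g g0 unfolding \<rho> by (subst (asm) integrable_density) auto
  then have "integrable circle_measure h"
    by (simp add: h_def[abs_def] scaleR_conv_of_real)
  moreover have "AE z in circle_measure. h z \<in> \<real>\<^sub>\<ge>\<^sub>0"
    by (simp add: h_def g0)
  moreover have "has_density r h"
    unfolding has_density_def
  proof
    fix f assume f: "f \<in> Linf"
    have "(LINT z|\<rho>. f z) = (LINT z|circle_measure. g z *\<^sub>R f z)"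
      unfolding \<rho> using g0 by (intro integral_density Linf_measurable[OF f] g) auto
    then show "ip \<phi> (\<pi> f \<phi>) = (LINT z|circle_measure. f z * h z)"
      using int(2)[OF f] by (simp add: h_def scaleR_conv_of_real mult.commute)
  qed
  ultimately show thesis using that by blast
qed

text \<open>Since \<open>U\<close> is isometric, \<open>\<langle>\<phi>, \<pi>(f)\<phi>\<rangle> = \<langle>U\<phi>, U\<pi>(f)\<phi>\<rangle> = \<langle>\<phi>, \<pi>(\<bar>m\<^sub>0\<bar>\<^sup>2 f(z\<^sup>N))\<phi>\<rangle>\<close>, and the transfer
  operator is the adjoint of \<open>f \<mapsto> \<bar>m\<^sub>0\<bar>\<^sup>2 f(z\<^sup>N)\<close>.\<close>

lemma has_density_harmonic:
  assumes i: "integrable circle_measure h" and h: "has_density r h"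
  shows "AE z in circle_measure. ruelle N m0 h z = h z"
proof -
  have "AE z in circle_measure. ruelle N m0 h z - h z = 0"
  proof (rule AE_eq_0_if_orthogonal_Linf)
    note R = integrable_ruelle[OF N m0 i]
    show "integrable circle_measure (\<lambda>z. ruelle N m0 h z - h z)" using R i by auto
    fix f assume f: "f \<in> Linf"
    define F where "F = (\<lambda>z. of_real ((cmod (m0 z))\<^sup>2) * f (z ^ N))"
    note fN = Linf_power_comp[OF N f]
    have F: "F \<in> Linf" unfolding F_def by (intro Linf_mult Linf_cmod_square m0 fN)
    have "(LINT z|circle_measure. f z * ruelle N m0 h z) = (LINT z|circle_measure. F z * h z)"
      unfolding F_def by (rule integral_ruelle[OF N m0 i f])
    also have "\<dots> = ip \<phi> (\<pi> F \<phi>)" using h F by (simp add: has_density_def)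
    also have "F = (\<lambda>z. cnj (m0 z) * dilate N m0 f z)"
      unfolding F_def dilate_def complex_norm_square by (simp add: mult_ac)
    also have "ip \<phi> (\<pi> (\<lambda>z. cnj (m0 z) * dilate N m0 f z) \<phi>) = ip (\<pi> m0 \<phi>) (\<pi> (dilate N m0 f) \<phi>)"
      by (rule ip_rep_rep[symmetric]) (auto intro: m0 dilate_Linf N f)
    also have "\<dots> = ip (U \<phi>) (U (\<pi> f \<phi>))" using U_rep_\<phi>[OF f] r'(2) by simp
    also have "\<dots> = ip \<phi> (\<pi> f \<phi>)" using f by (simp add: U_ip)
    also have "\<dots> = (LINT z|circle_measure. f z * h z)" using h f by (simp add: has_density_def)
    finally show "(LINT z|circle_measure. f z * (ruelle N m0 h z - h z)) = 0"
      using integrable_Linf_mult[OF f R] integrable_Linf_mult[OF f i] by (simp add: right_diff_distrib)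
  qed
  then show ?thesis by simp
qed

lemma harmonic_density_exists: "\<exists>h\<in>ruelle_harmonic N m0. has_density r h"
proof -
  obtain h where "integrable circle_measure h" "AE z in circle_measure. h z \<in> \<real>\<^sub>\<ge>\<^sub>0" "has_density r h"
    by (rule has_density_exists)
  then show ?thesis using has_density_harmonic by (auto simp: ruelle_harmonic_def)
qed

lemma fourier_coeff_density:
  assumes h: "has_density r h"
  shows "fourier_coeff h n = ip (\<pi> (monom_fun n) \<phi>) \<phi>"
proof -
  have "ip (\<pi> (monom_fun n) \<phi>) \<phi> = ip (\<pi> (\<lambda>z. cnj (monom_fun (- n) z)) \<phi>) \<phi>"
  proof (rule arg_cong[where f = "\<lambda>x. ip x \<phi>"], rule rep_cong)
    fix z :: complex assume "z \<in> sphere 0 1"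
    then have "cnj z = inverse z"
      using complex_norm_square[of z] inverse_unique[of z "cnj z"] by auto
    then show "monom_fun n z = cnj (monom_fun (- n) z)"
      by (simp add: monom_fun_def power_int_minus power_int_inverse)
  qed (auto intro: Linf_cnj)
  also have "\<dots> = ip \<phi> (\<pi> (monom_fun (- n)) \<phi>)" by (simp add: rep_adjoint)
  finally show ?thesis using h by (simp add: has_density_def fourier_coeff_def)
qed

lemma h_phi_eq:
  assumes i: "integrable circle_measure h" and h: "has_density r h"
  shows "h_phi r = L1_eq `` {h}"
proof (intro equalityI subsetI)
  fix g assume "g \<in> h_phi r"
  then have g: "integrable circle_measure g" "\<And>n. fourier_coeff g n = fourier_coeff h n"
    by (auto simp: h_phi_def fourier_coeff_density[OF h])
  then have "AE z in circle_measure. h z = g z"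
    by (intro fourier_coeff_eq_imp_AE_eq i) auto
  then show "g \<in> L1_eq `` {h}" using g(1) i by (simp add: L1_eq_def)
next
  fix g assume "g \<in> L1_eq `` {h}"
  then have g: "integrable circle_measure g" "AE z in circle_measure. h z = g z"
    by (auto simp: L1_eq_def)
  have "fourier_coeff g n = fourier_coeff h n" for n
    unfolding fourier_coeff_def
  proof (rule integral_cong_AE)
    show "AE z in circle_measure. monom_fun (- n) z * g z = monom_fun (- n) z * h z"
      using g(2) by eventually_elim simp
  qed (use borel_measurable_integrable[OF g(1)] borel_measurable_integrable[OF i]
      in \<open>auto intro!: borel_measurable_times Linf_measurable[OF Linf_monom_fun]\<close>)
  then show "g \<in> h_phi r"
    using g(1) by (simp add: h_phi_def fourier_coeff_density[OF h])
qed

end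

lemma has_density_cong_AE:
  assumes "has_density r h" and h: "integrable circle_measure h" and g: "integrable circle_measure g"
    and eq: "AE z in circle_measure. h z = g z"
  shows "has_density r g"
  unfolding has_density_def
proof
  fix f assume f: "f \<in> Linf"
  have "(LINT z|circle_measure. f z * h z) = (LINT z|circle_measure. f z * g z)"
  proof (rule integral_cong_AE)
    show "AE z in circle_measure. f z * h z = f z * g z" using eq by eventually_elim simp
  qed (use borel_measurable_integrable[OF g] borel_measurable_integrable[OF h]
      in \<open>auto intro!: borel_measurable_times Linf_measurable[OF f]\<close>)
  then show "hinner (rspace r) (rvec r) (rfun r f (rvec r)) = (LINT z|circle_measure. f z * g z)"
    using assms(1) f by (simp add: has_density_def)
qed

section \<open>The representation with a given density\<close>

text \<open>The measure \<open>\<rho>\<close> is to be \<open>h d\<mu>\<close>. Its invariance is the weak form of \<open>R h = h\<close>.\<close>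

locale scaling_data =
  fixes N :: nat and m0 :: "complex \<Rightarrow> complex" and \<rho> :: "complex measure"
  assumes N: "N > 0" and m0: "m0 \<in> Linf"
    and fin: "finite_measure \<rho>" and sets: "sets \<rho> = sets circle_measure"
    and ac: "absolutely_continuous circle_measure \<rho>"
    and invariant: "\<And>f. f \<in> Linf \<Longrightarrow>
      (LINT z|\<rho>. of_real ((cmod (m0 z))\<^sup>2) * f (z ^ N)) = (LINT z|\<rho>. f z)"
begin

lemma integrable_Linf: "f \<in> Linf \<Longrightarrow> integrable \<rho> f"
  by (intro Linf_imp_integrable fin sets ac)

lemma integrable_cmod_square: "f \<in> Linf \<Longrightarrow> integrable \<rho> (\<lambda>z. (cmod (f z))\<^sup>2)"
  using integrable_Re[OF integrable_Linf[OF Linf_cmod_square]] by (simp only: Re_complex_of_real)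

lemma AE_\<rho>: "AE z in circle_measure. P z \<Longrightarrow> AE z in \<rho>. P z"
  by (rule absolutely_continuous_AE[OF sets ac])

abbreviation "dil \<equiv> dilate N m0"

definition form :: "(complex \<Rightarrow> complex) \<Rightarrow> (complex \<Rightarrow> complex) \<Rightarrow> complex" where
  "form f g = (LINT z|\<rho>. cnj (f z) * g z)"

lemma form_integrable: "f \<in> Linf \<Longrightarrow> g \<in> Linf \<Longrightarrow> integrable \<rho> (\<lambda>z. cnj (f z) * g z)"
  by (intro integrable_Linf Linf_mult Linf_cnj)

lemma form_cnj: "form g f = cnj (form f g)"
proof -
  have "form g f = (LINT z|\<rho>. cnj (cnj (f z) * g z))"
    by (simp add: form_def mult.commute)
  then show ?thesis by (simp only: form_def Bochner_Integration.integral_cnj)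
qed

lemma form_add: "f \<in> Linf \<Longrightarrow> g \<in> Linf \<Longrightarrow> g' \<in> Linf \<Longrightarrow> form f (\<lambda>z. g z + g' z) = form f g + form f g'"
  unfolding form_def using form_integrable by (simp add: distrib_left)

lemma form_scale: "form f (\<lambda>z. a * g z) = a * form f g"
proof -
  have "cnj (f z) * (a * g z) = a * (cnj (f z) * g z)" for z by simp
  then show ?thesis unfolding form_def by (simp only: integral_mult_right_zero)
qed

lemma form_self: "form f f = of_real (LINT z|\<rho>. (cmod (f z))\<^sup>2)"
proof -
  have "cnj (f z) * f z = complex_of_real ((cmod (f z))\<^sup>2)" for z
    using complex_norm_square[of "f z"] by (simp add: mult.commute)
  then show ?thesis unfolding form_def by (simp only: integral_complex_of_real)
qed

lemma dil_Linf: "f \<in> Linf \<Longrightarrow> dil f \<in> Linf" and dil_funpow_Linf: "f \<in> Linf \<Longrightarrow> (dil ^^ k) f \<in> Linf"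
  by (auto intro: dilate_Linf dilate_funpow_Linf N m0)

lemma form_dilate: "f \<in> Linf \<Longrightarrow> g \<in> Linf \<Longrightarrow> form (dil f) (dil g) = form f g"
proof -
  assume fg: "f \<in> Linf" "g \<in> Linf"
  have "cnj (dil f z) * dil g z = of_real ((cmod (m0 z))\<^sup>2) * (cnj (f (z ^ N)) * g (z ^ N))" for z
    unfolding dilate_def complex_norm_square by (simp add: mult_ac)
  then show ?thesis
    unfolding form_def using invariant[OF Linf_mult[OF Linf_cnj[OF fg(1)] fg(2)]] by simp
qed

text \<open>The algebraic direct limit of \<open>L\<^sup>\<infinity> \<rightarrow> L\<^sup>\<infinity> \<rightarrow> \<dots>\<close> under \<open>f \<mapsto> m\<^sub>0 f(z\<^sup>N)\<close>: sequences that eventually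
  follow the connecting map. The \<open>k\<close>-th entry stands for \<open>U\<^sup>-\<^sup>k \<pi>(v k) \<phi>\<close>.\<close>

definition V :: "(nat \<Rightarrow> complex \<Rightarrow> complex) hilb" where
  "V = \<lparr>hcarrier = {v. (\<forall>k. v k \<in> Linf) \<and> (\<exists>m. \<forall>k\<ge>m. v (Suc k) = dil (v k))},
     hzero = (\<lambda>k z. 0), hadd = (\<lambda>v w k z. v k z + w k z), hscale = (\<lambda>a v k z. a * v k z),
     hinner = (\<lambda>v w. lim (\<lambda>k. form (v k) (w k)))\<rparr>"

lemma V_simps [simp]:
  "hzero V = (\<lambda>k z. 0)" "hadd V v w = (\<lambda>k z. v k z + w k z)" "hscale V a v = (\<lambda>k z. a * v k z)"
  by (simp_all add: V_def)

lemma V_mem_iff: "v \<in> hcarrier V \<longleftrightarrow> (\<forall>k. v k \<in> Linf) \<and> (\<exists>m. \<forall>k\<ge>m. v (Suc k) = dil (v k))"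
  by (simp add: V_def)

lemma V_memI: "(\<And>k. v k \<in> Linf) \<Longrightarrow> (\<And>k. k \<ge> m \<Longrightarrow> v (Suc k) = dil (v k)) \<Longrightarrow> v \<in> hcarrier V"
  unfolding V_mem_iff by blast

lemma V_Linf: "v \<in> hcarrier V \<Longrightarrow> v k \<in> Linf"
  by (simp add: V_mem_iff)

lemma hminus_V: "hminus V v w = (\<lambda>k z. v k z - w k z)"
  by (simp add: hminus_def)

text \<open>From the level on where both sequences follow the connecting map, which is isometric, the sequence of
  inner products is constant.\<close>

lemma hinner_V_from:
  assumes v: "v \<in> hcarrier V" and w: "w \<in> hcarrier V"
    and vm: "\<And>k. k \<ge> m \<Longrightarrow> v (Suc k) = dil (v k)" and wm: "\<And>k. k \<ge> m \<Longrightarrow> w (Suc k) = dil (w k)"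
    and k: "k \<ge> m"
  shows "hinner V v w = form (v k) (w k)"
proof -
  have const: "form (v k) (w k) = form (v m) (w m)" if "k \<ge> m" for k
    using that
  proof (induction k rule: dec_induct)
    case (step k)
    then show ?case using vm[of k] wm[of k] form_dilate[OF V_Linf[OF v] V_Linf[OF w], of k k] by simp
  qed simp
  have "(\<lambda>k. form (v k) (w k)) \<longlonglongrightarrow> form (v m) (w m)"
    by (rule tendsto_eventually) (use const in \<open>unfold eventually_sequentially, blast\<close>)
  then have "hinner V v w = form (v m) (w m)" by (simp add: V_def limI)
  then show ?thesis using const[OF k] by simp
qed

lemma hinner_V:
  assumes v: "v \<in> hcarrier V" and w: "w \<in> hcarrier V"
  shows "\<forall>\<^sub>F k in sequentially. hinner V v w = form (v k) (w k)"
proof -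
  obtain m n where m: "\<And>k. k \<ge> m \<Longrightarrow> v (Suc k) = dil (v k)" and n: "\<And>k. k \<ge> n \<Longrightarrow> w (Suc k) = dil (w k)"
    using v w unfolding V_mem_iff by blast
  have "hinner V v w = form (v k) (w k)" if "k \<ge> max m n" for k
    by (rule hinner_V_from[OF v w _ _ that]) (auto intro: m n)
  then show ?thesis unfolding eventually_sequentially by blast
qed

lemma hinner_V_eventually_cong:
  assumes v: "v \<in> hcarrier V" "v' \<in> hcarrier V" and w: "w \<in> hcarrier V" "w' \<in> hcarrier V"
    and eq: "\<forall>\<^sub>F k in sequentially. form (v k) (w k) = form (v' k) (w' k)"
  shows "hinner V v w = hinner V v' w'"
proof -
  have "\<forall>\<^sub>F k in sequentially. hinner V v w = hinner V v' w'"
    using hinner_V[OF v(1) w(1)] hinner_V[OF v(2) w(2)] eq by eventually_elim simp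
  then show ?thesis by simp
qed

lemma V_add_mem: assumes v: "v \<in> hcarrier V" and w: "w \<in> hcarrier V" shows "hadd V v w \<in> hcarrier V"
proof -
  obtain m n where m: "\<And>k. k \<ge> m \<Longrightarrow> v (Suc k) = dil (v k)" and n: "\<And>k. k \<ge> n \<Longrightarrow> w (Suc k) = dil (w k)"
    using v w unfolding V_mem_iff by blast
  show ?thesis
    by (rule V_memI[of _ "max m n"]) (auto simp: m n dilate_def distrib_left intro: Linf_add V_Linf v w)
qed

lemma V_scale_mem: assumes v: "v \<in> hcarrier V" shows "hscale V a v \<in> hcarrier V"
proof -
  obtain m where m: "\<And>k. k \<ge> m \<Longrightarrow> v (Suc k) = dil (v k)"
    using v unfolding V_mem_iff by blast
  show ?thesis
    by (rule V_memI[of _ m]) (auto simp: m dilate_def intro: Linf_mult[OF Linf_const] V_Linf v)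
qed

lemma semi_inner_space_V: "semi_inner_space V"
proof
  show "hzero V \<in> hcarrier V" by (rule V_memI) (auto simp: dilate_def)
next
  fix v w assume v: "v \<in> hcarrier V" and w: "w \<in> hcarrier V"
  show "hadd V v w \<in> hcarrier V" using v w by (rule V_add_mem)
  have "\<forall>\<^sub>F k in sequentially. hinner V w v = cnj (hinner V v w)"
    using hinner_V[OF v w] hinner_V[OF w v] by eventually_elim (metis form_cnj)
  then show "hinner V w v = cnj (hinner V v w)" by simp
  have "\<forall>\<^sub>F k in sequentially. hinner V v (hscale V a w) = a * hinner V v w" for a
    using hinner_V[OF v w] hinner_V[OF v V_scale_mem[OF w, of a]]
    by eventually_elim (simp add: form_scale)
  then show "hinner V v (hscale V a w) = a * hinner V v w" for a by simp
  fix u assume u: "u \<in> hcarrier V"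
  have "\<forall>\<^sub>F k in sequentially. hinner V v (hadd V w u) = hinner V v w + hinner V v u"
    using hinner_V[OF v w] hinner_V[OF v u] hinner_V[OF v V_add_mem[OF w u]]
    by eventually_elim (simp add: form_add V_Linf v w u)
  then show "hinner V v (hadd V w u) = hinner V v w + hinner V v u" by simp
next
  fix v a assume v: "v \<in> hcarrier V"
  show "hscale V a v \<in> hcarrier V" using v by (rule V_scale_mem)
  have "\<forall>\<^sub>F k in sequentially. 0 \<le> Re (hinner V v v)"
    using hinner_V[OF v v] by eventually_elim (simp add: form_self)
  then show "0 \<le> Re (hinner V v v)" by simp
qed

sublocale V: semi_inner_space V
  by (rule semi_inner_space_V)

subsection \<open>Operators on the direct limit\<close>

text \<open>Since \<open>\<pi>(f)U\<^sup>-\<^sup>k = U\<^sup>-\<^sup>k\<pi>(f(z\<^bsup>N\<^sup>k\<^esup>))\<close>, a function acts on the entry at level \<open>k\<close> through its composition with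
  \<open>z \<mapsto> z\<^bsup>N\<^sup>k\<^esup>\<close>. Passing to the next entry is \<open>U\<close>. The entry 0 that the inverse shift has to fill in is
  immaterial, since finitely many entries do not affect the inner products.\<close>

definition mulop :: "(complex \<Rightarrow> complex) \<Rightarrow> (nat \<Rightarrow> complex \<Rightarrow> complex) \<Rightarrow> nat \<Rightarrow> complex \<Rightarrow> complex" where
  "mulop f v = (\<lambda>k z. f (z ^ (N ^ k)) * v k z)"

definition shift :: "(nat \<Rightarrow> complex \<Rightarrow> complex) \<Rightarrow> nat \<Rightarrow> complex \<Rightarrow> complex" where
  "shift v = (\<lambda>k. v (Suc k))"

definition unshift :: "(nat \<Rightarrow> complex \<Rightarrow> complex) \<Rightarrow> nat \<Rightarrow> complex \<Rightarrow> complex" where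
  "unshift v = (\<lambda>k. case k of 0 \<Rightarrow> (\<lambda>_. 0) | Suc j \<Rightarrow> v j)"

lemma Linf_pow: "f \<in> Linf \<Longrightarrow> (\<lambda>z. f (z ^ (N ^ k))) \<in> Linf"
  using N by (intro Linf_power_comp) auto

lemma mulop_mem: assumes f: "f \<in> Linf" and v: "v \<in> hcarrier V" shows "mulop f v \<in> hcarrier V"
proof -
  obtain m where m: "\<And>k. k \<ge> m \<Longrightarrow> v (Suc k) = dil (v k)"
    using v unfolding V_mem_iff by blast
  show ?thesis
  proof (rule V_memI[of _ m])
    show "mulop f v k \<in> Linf" for k
      unfolding mulop_def by (intro Linf_mult Linf_pow f V_Linf v)
    show "mulop f v (Suc k) = dil (mulop f v k)" if "k \<ge> m" for k
      by (simp add: mulop_def m[OF that] dilate_def power_mult mult_ac)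
  qed
qed

lemma shift_mem: assumes v: "v \<in> hcarrier V" shows "shift v \<in> hcarrier V"
proof -
  obtain m where m: "\<And>k. k \<ge> m \<Longrightarrow> v (Suc k) = dil (v k)"
    using v unfolding V_mem_iff by blast
  show ?thesis by (rule V_memI[of _ m]) (auto simp: shift_def m V_Linf v)
qed

lemma unshift_mem: assumes v: "v \<in> hcarrier V" shows "unshift v \<in> hcarrier V"
proof -
  obtain m where m: "\<And>k. k \<ge> m \<Longrightarrow> v (Suc k) = dil (v k)"
    using v unfolding V_mem_iff by blast
  show ?thesis
    by (rule V_memI[of _ "Suc m"]) (auto simp: unshift_def m V_Linf v split: nat.split)
qed

lemma shift_ip: assumes v: "v \<in> hcarrier V" and w: "w \<in> hcarrier V"
  shows "hinner V (shift v) (shift w) = hinner V v w"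
proof -
  have "\<forall>\<^sub>F k in sequentially. hinner V v w = form (v (Suc k)) (w (Suc k))"
    by (rule eventually_sequentially_Suc[THEN iffD2, OF hinner_V[OF v w]])
  then have "\<forall>\<^sub>F k in sequentially. hinner V (shift v) (shift w) = hinner V v w"
    using hinner_V[OF shift_mem[OF v] shift_mem[OF w]]
    by eventually_elim (simp add: shift_def)
  then show ?thesis by simp
qed

lemma shift_unshift: "shift (unshift v) = v"
  by (simp add: shift_def unshift_def)

lemma unshift_shift_ip: assumes v: "v \<in> hcarrier V" and w: "w \<in> hcarrier V"
  shows "hinner V w (unshift (shift v)) = hinner V w v"
proof (rule hinner_V_eventually_cong)
  show "\<forall>\<^sub>F k in sequentially. form (w k) (unshift (shift v) k) = form (w k) (v k)"
    using eventually_gt_at_top[of 0]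
    by eventually_elim (auto simp: shift_def unshift_def split: nat.split)
qed (use v w in \<open>auto intro: shift_mem unshift_mem\<close>)

lemma unshift_ip: assumes v: "v \<in> hcarrier V" and w: "w \<in> hcarrier V"
  shows "hinner V (unshift v) (unshift w) = hinner V v w"
  using shift_ip[OF unshift_mem[OF v] unshift_mem[OF w]] by (simp add: shift_unshift)

lemma nrm_mulop:
  assumes f: "f \<in> Linf" and v: "v \<in> hcarrier V" and C: "AE z in circle_measure. cmod (f z) \<le> C"
  shows "hnorm V (mulop f v) \<le> \<bar>C\<bar> * hnorm V v"
proof -
  have "\<forall>\<^sub>F k in sequentially. Re (hinner V (mulop f v) (mulop f v)) \<le> C\<^sup>2 * Re (hinner V v v)"
    using hinner_V[OF v v] hinner_V[OF mulop_mem[OF f v] mulop_mem[OF f v]]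
  proof eventually_elim
    case (elim k)
    have L: "mulop f v k \<in> Linf" by (rule V_Linf[OF mulop_mem[OF f v]])

    have "AE z in \<rho>. cmod (f (z ^ (N ^ k))) \<le> C"
      using AE_\<rho>[OF AE_circle_power[OF _ C, of "N ^ k"]] N by simp
    then have "(LINT z|\<rho>. (cmod (mulop f v k z))\<^sup>2) \<le> (LINT z|\<rho>. C\<^sup>2 * (cmod (v k z))\<^sup>2)"
    proof (intro integral_mono_AE)
      show "AE z in \<rho>. cmod (f (z ^ (N ^ k))) \<le> C \<Longrightarrow>
          AE z in \<rho>. (cmod (mulop f v k z))\<^sup>2 \<le> C\<^sup>2 * (cmod (v k z))\<^sup>2"
        by (elim eventually_mono) (simp add: mulop_def norm_mult power_mult_distrib mult_right_mono power_mono)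
    qed (use integrable_cmod_square[OF L] integrable_cmod_square[OF V_Linf[OF v]] in auto)
    then show ?case using elim by (simp add: form_self)
  qed
  then have "Re (hinner V (mulop f v) (mulop f v)) \<le> C\<^sup>2 * Re (hinner V v v)" by simp
  then have "sqrt (Re (hinner V (mulop f v) (mulop f v))) \<le> sqrt (C\<^sup>2 * Re (hinner V v v))"
    by (rule real_sqrt_le_mono)
  then show ?thesis by (simp add: hnorm_def real_sqrt_mult)
qed

lemma mulop_adjoint:
  assumes f: "f \<in> Linf" and v: "v \<in> hcarrier V" and w: "w \<in> hcarrier V"
  shows "hinner V (mulop (\<lambda>z. cnj (f z)) v) w = hinner V v (mulop f w)"
proof (rule hinner_V_eventually_cong)
  show "\<forall>\<^sub>F k in sequentially. form (mulop (\<lambda>z. cnj (f z)) v k) (w k) = form (v k) (mulop f w k)"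
    by (simp add: form_def mulop_def mult_ac)
qed (use f v w in \<open>auto intro: mulop_mem Linf_cnj\<close>)

text \<open>The vector \<open>U\<^sup>-\<^sup>j \<pi>(f) \<phi>\<close>.\<close>

definition germ :: "nat \<Rightarrow> (complex \<Rightarrow> complex) \<Rightarrow> nat \<Rightarrow> complex \<Rightarrow> complex" where
  "germ j f = (\<lambda>k. if k < j then (\<lambda>_. 0) else (dil ^^ (k - j)) f)"

lemma germ_step: "k \<ge> j \<Longrightarrow> germ j f (Suc k) = dil (germ j f k)"
  by (simp add: germ_def Suc_diff_le)

lemma germ_mem: "f \<in> Linf \<Longrightarrow> germ j f \<in> hcarrier V"
  by (rule V_memI[of _ j]) (auto simp: germ_step, auto simp: germ_def dil_funpow_Linf)

lemma ip_germ: "f \<in> Linf \<Longrightarrow> g \<in> Linf \<Longrightarrow> hinner V (germ j f) (germ j g) = form f g"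
  by (subst hinner_V_from[where m = j and k = j]) (simp_all add: germ_mem germ_step, simp add: germ_def)

lemma dil_add: "(dil ^^ k) (\<lambda>z. f z + g z) = (\<lambda>z. (dil ^^ k) f z + (dil ^^ k) g z)"
  by (induction k) (auto simp: dilate_def distrib_left)

lemma dil_scale: "(dil ^^ k) (\<lambda>z. a * f z) = (\<lambda>z. a * (dil ^^ k) f z)"
  by (induction k) (auto simp: dilate_def)

lemma germ_add: "germ j (\<lambda>z. f z + g z) = hadd V (germ j f) (germ j g)"
  by (auto simp: germ_def dil_add fun_eq_iff)

lemma germ_scale: "germ j (\<lambda>z. a * f z) = hscale V a (germ j f)"
  by (auto simp: germ_def dil_scale fun_eq_iff)

lemma germ_minus: "germ j (\<lambda>z. f z - g z) = hminus V (germ j f) (germ j g)"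
proof -
  have "(\<lambda>z. f z - g z) = (\<lambda>z. f z + - 1 * g z)" by simp
  then show ?thesis by (simp only: germ_add germ_scale hminus_def)
qed

lemma eventually_germ:
  assumes v: "v \<in> hcarrier V"
  shows "\<exists>m. v m \<in> Linf \<and> hnorm V (hminus V v (germ m (v m))) = 0"
proof -
  obtain m where m: "\<And>k. k \<ge> m \<Longrightarrow> v (Suc k) = dil (v k)"
    using v unfolding V_mem_iff by blast
  note vm = V_Linf[OF v, of m]
  have eq: "v k = germ m (v m) k" if "k \<ge> m" for k
    using that by (induction k rule: dec_induct) (auto simp: m germ_step, auto simp: germ_def)
  have d: "hminus V v (germ m (v m)) \<in> hcarrier V"
    using v germ_mem[OF vm] by (intro V.minus_mem)
  have "hinner V (hminus V v (germ m (v m))) (hminus V v (germ m (v m))) = form (\<lambda>_. 0) (\<lambda>_. 0)"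
  proof -
    have z: "hminus V v (germ m (v m)) k = (\<lambda>_. 0)" if "k \<ge> m" for k
      using eq[OF that] by (simp add: hminus_V)
    have "\<forall>\<^sub>F k in sequentially. hinner V (hminus V v (germ m (v m))) (hminus V v (germ m (v m))) = form (\<lambda>_. 0) (\<lambda>_. 0)"
      using hinner_V[OF d d] eventually_ge_at_top[of m] by eventually_elim (simp add: z)
    then show ?thesis by simp
  qed
  then have "hnorm V (hminus V v (germ m (v m))) = 0"
    by (simp add: hnorm_def form_def)
  then show ?thesis using vm by blast
qed

lemma nrm_germ: "f \<in> Linf \<Longrightarrow> hnorm V (germ j f) = sqrt (LINT z|\<rho>. (cmod (f z))\<^sup>2)"
  by (simp add: hnorm_def ip_germ form_self)

text \<open>On the vector that \<open>g\<close> represents, this expresses strong convergence of multiplication operators.\<close>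

lemma tendsto_integral_bounded:
  assumes F: "\<And>n. F n \<in> Linf" and b: "\<And>n z. z \<in> sphere 0 1 \<Longrightarrow> cmod (F n z) \<le> C"
    and lim: "\<And>z. z \<in> sphere 0 1 \<Longrightarrow> (\<lambda>n. F n z) \<longlonglongrightarrow> 0" and g: "g \<in> Linf"
  shows "(\<lambda>n. LINT z|\<rho>. (cmod (F n z * g z))\<^sup>2) \<longlonglongrightarrow> 0"
proof -
  have sp: "space \<rho> = sphere 0 1" using sets_eq_imp_space_eq[OF sets] by simp
  have m: "(\<lambda>z. (cmod (f z))\<^sup>2) \<in> borel_measurable \<rho>" if "f \<in> Linf" for f
    using borel_measurable_integrable[OF integrable_Linf[OF that]] by measurable
  have "(\<lambda>n. LINT z|\<rho>. (cmod (F n z * g z))\<^sup>2) \<longlonglongrightarrow> (LINT z|\<rho>. 0)"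
  proof (rule integral_dominated_convergence[where w = "\<lambda>z. C\<^sup>2 * (cmod (g z))\<^sup>2"])
    show "integrable \<rho> (\<lambda>z. C\<^sup>2 * (cmod (g z))\<^sup>2)"
      using integrable_cmod_square[OF g] by auto
    show "AE z in \<rho>. (\<lambda>n. (cmod (F n z * g z))\<^sup>2) \<longlonglongrightarrow> 0"
    proof (rule AE_I2)
      fix z assume "z \<in> space \<rho>"
      then have "(\<lambda>n. (cmod (F n z * g z))\<^sup>2) \<longlonglongrightarrow> (cmod (0 * g z))\<^sup>2"
        by (intro tendsto_intros lim) (simp add: sp)
      then show "(\<lambda>n. (cmod (F n z * g z))\<^sup>2) \<longlonglongrightarrow> 0" by simp
    qed
    show "AE z in \<rho>. norm ((cmod (F n z * g z))\<^sup>2) \<le> C\<^sup>2 * (cmod (g z))\<^sup>2" for n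
      by (rule AE_I2) (use b sp in \<open>auto simp: norm_mult power_mult_distrib intro!: mult_right_mono power_mono\<close>)
    show "(\<lambda>z. (cmod (F n z * g z))\<^sup>2) \<in> borel_measurable \<rho>" for n
      by (rule m) (intro Linf_mult F g)
  qed simp
  then show ?thesis by simp
qed

lemma nrm_germ_eq_0:
  assumes f: "f \<in> Linf" and 0: "AE z in circle_measure. f z = 0"
  shows "hnorm V (germ j f) = 0"
proof -
  have "(LINT z|\<rho>. (cmod (f z))\<^sup>2) = 0"
    by (rule integral_eq_zero_AE) (use AE_\<rho>[OF 0] in \<open>eventually_elim, simp\<close>)
  then show ?thesis using f by (simp add: nrm_germ)
qed

lemma hdense_germs: "hdense V {germ j f |j f. f \<in> Linf}"
  unfolding hdense_def
proof (intro conjI ballI allI impI)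
  show "{germ j f |j f. f \<in> Linf} \<subseteq> hcarrier V" using germ_mem by blast
  fix v and \<epsilon> :: real assume v: "v \<in> hcarrier V" and e: "\<epsilon> > 0"
  obtain m where "v m \<in> Linf" "hnorm V (hminus V v (germ m (v m))) = 0"
    using eventually_germ[OF v] by blast
  then show "\<exists>y\<in>{germ j f |j f. f \<in> Linf}. hnorm V (hminus V v y) < \<epsilon>"
    using e by (intro bexI[of _ "germ m (v m)"]) auto
qed

text \<open>An enumeration of the vectors \<open>U\<^sup>-\<^sup>j\<pi>(e\<^sub>n)\<phi>\<close>.\<close>

definition germ_seq :: "nat \<Rightarrow> nat \<Rightarrow> complex \<Rightarrow> complex" where
  "germ_seq i = (case from_nat i of (j, n) \<Rightarrow> germ j (monom_fun n))"

text \<open>The vectors against which a Cauchy sequence, being bounded, tends weakly to 0 form a closed set.\<close>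

lemma ip_tendsto_0_closed:
  assumes v: "hCauchy V v" and w: "w \<in> hcarrier V"
    and approx: "\<And>\<epsilon>. \<epsilon> > 0 \<Longrightarrow> \<exists>u\<in>hcarrier V. (\<lambda>k. hinner V u (v k)) \<longlonglongrightarrow> 0 \<and> hnorm V (hminus V w u) \<le> \<epsilon>"
  shows "(\<lambda>k. hinner V w (v k)) \<longlonglongrightarrow> 0"
proof (rule LIMSEQ_I)
  fix \<epsilon> :: real assume e: "\<epsilon> > 0"
  obtain D where D: "D > 0" "\<And>k. hnorm V (v k) \<le> D" using V.hCauchy_bounded[OF v] by blast
  note vV = V.hCauchy_mem[OF v]
  obtain u where u: "u \<in> hcarrier V" "(\<lambda>k. hinner V u (v k)) \<longlonglongrightarrow> 0" "hnorm V (hminus V w u) \<le> \<epsilon> / (2 * D)"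
    using approx[of "\<epsilon> / (2 * D)"] e D by auto
  obtain n where n: "\<And>k. k \<ge> n \<Longrightarrow> cmod (hinner V u (v k)) < \<epsilon> / 2"
    using LIMSEQ_D[OF u(2), of "\<epsilon> / 2"] e by auto
  have "cmod (hinner V w (v k) - 0) < \<epsilon>" if k: "k \<ge> n" for k
  proof -
    have "hinner V w (v k) = hinner V (hminus V w u) (v k) + hinner V u (v k)"
      using w u vV by simp
    then have "cmod (hinner V w (v k)) \<le> cmod (hinner V (hminus V w u) (v k)) + cmod (hinner V u (v k))"
      by (metis norm_triangle_ineq)
    also have "cmod (hinner V (hminus V w u) (v k)) \<le> hnorm V (hminus V w u) * hnorm V (v k)"
      by (rule V.Cauchy_Schwarz) (use w u vV in auto)
    also have "\<dots> \<le> \<epsilon> / (2 * D) * D"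
      using u(3) D e vV w u(1) by (intro mult_mono) auto
    also have "\<dots> = \<epsilon> / 2" using D by simp
    finally show ?thesis using n[OF k] by simp
  qed
  then show "\<exists>no. \<forall>k\<ge>no. cmod (hinner V w (v k) - 0) < \<epsilon>" by blast
qed

text \<open>\<open>\<parallel>v k\<parallel>\<^sup>2\<close> differs from \<open>\<langle>v m, v k\<rangle>\<close>, which tends to 0 in \<open>k\<close>, by at most \<open>\<parallel>v k - v m\<parallel> \<parallel>v k\<parallel>\<close>.\<close>

lemma hCauchy_null_if_weakly_null:
  assumes v: "hCauchy V v" and 0: "\<And>w. w \<in> hcarrier V \<Longrightarrow> (\<lambda>k. hinner V w (v k)) \<longlonglongrightarrow> 0"
  shows "(\<lambda>k. hnorm V (v k)) \<longlonglongrightarrow> 0"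
proof (rule LIMSEQ_I)
  fix \<epsilon> :: real assume e: "\<epsilon> > 0"
  obtain D where D: "D > 0" "\<And>k. hnorm V (v k) \<le> D" using V.hCauchy_bounded[OF v] by blast
  note vV = V.hCauchy_mem[OF v]
  define \<delta> where "\<delta> = \<epsilon>\<^sup>2 / 2"
  have d: "\<delta> > 0" using e by (simp add: \<delta>_def)
  obtain m where m: "\<And>k l. k \<ge> m \<Longrightarrow> l \<ge> m \<Longrightarrow> hnorm V (hminus V (v k) (v l)) < \<delta> / D"
    using V.hCauchyD[OF v, of "\<delta> / D"] d D by auto
  obtain n where n: "\<And>k. k \<ge> n \<Longrightarrow> cmod (hinner V (v m) (v k)) < \<delta>"
    using LIMSEQ_D[OF 0[OF vV[of m]], of \<delta>] d by auto
  have "norm (hnorm V (v k) - 0) < \<epsilon>" if k: "k \<ge> max m n" for k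
  proof -
    have "(hnorm V (v k))\<^sup>2 \<le> cmod (hinner V (v k) (v k))"
      using V.nrm_square[OF vV] complex_Re_le_cmod by simp
    also have "hinner V (v k) (v k) = hinner V (hminus V (v k) (v m)) (v k) + hinner V (v m) (v k)"
      using vV by simp
    also have "cmod \<dots> \<le> cmod (hinner V (hminus V (v k) (v m)) (v k)) + cmod (hinner V (v m) (v k))"
      by (rule norm_triangle_ineq)
    also have "cmod (hinner V (hminus V (v k) (v m)) (v k)) \<le> hnorm V (hminus V (v k) (v m)) * hnorm V (v k)"
      by (rule V.Cauchy_Schwarz) (use vV in auto)
    also have "\<dots> \<le> \<delta> / D * D"
      using m[of k m] k D d vV by (intro mult_mono) auto
    also have "\<delta> / D * D = \<delta>" using D by simp
    finally have "(hnorm V (v k))\<^sup>2 < \<epsilon>\<^sup>2"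
      using n[of k] k by (simp add: \<delta>_def)
    then have "hnorm V (v k) < \<epsilon>" using e by (simp add: power2_less_imp_less)
    then show ?thesis using vV by simp
  qed
  then show "\<exists>no. \<forall>k\<ge>no. norm (hnorm V (v k) - 0) < \<epsilon>" by blast
qed

text \<open>For fixed \<open>j\<close> the functions \<open>f\<close> such that \<open>\<langle>U\<^sup>-\<^sup>j\<pi>(f)\<phi>, v k\<rangle> \<rightarrow> 0\<close> contain the monomials and are stable under
  linear combinations and bounded limits, so they are all of \<open>L\<^sup>\<infinity>\<close>; these vectors are dense.\<close>

lemma germ_seq_separating:
  assumes v: "hCauchy V v" and 0: "\<And>i. (\<lambda>k. hinner V (germ_seq i) (v k)) \<longlonglongrightarrow> 0"
  shows "(\<lambda>k. hnorm V (v k)) \<longlonglongrightarrow> 0"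
proof (rule hCauchy_null_if_weakly_null[OF v])
  note vV = V.hCauchy_mem[OF v]
  have germ: "f \<in> Linf \<and> (\<lambda>k. hinner V (germ j f) (v k)) \<longlonglongrightarrow> 0" if "f \<in> Linf" for f j
    using that
  proof (induction rule: Linf_induct_monom)
    case (ae f g)
    have "AE z in circle_measure. g z - f z = 0" using ae(3) by eventually_elim simp
    then have "hnorm V (hminus V (germ j g) (germ j f)) = 0"
      unfolding germ_minus[symmetric] using ae by (intro nrm_germ_eq_0 Linf_diff) auto
    then show ?case
      using ae by (auto intro!: ip_tendsto_0_closed[OF v] bexI[of _ "germ j f"] germ_mem)
  next
    case (monom n)
    have "germ_seq (to_nat (j, n)) = germ j (monom_fun n)" by (simp add: germ_seq_def)
    then show ?case using 0[of "to_nat (j, n)"] by simp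
  next
    case (add f g)
    then have "(\<lambda>k. hinner V (germ j f) (v k) + hinner V (germ j g) (v k)) \<longlonglongrightarrow> 0 + 0"
      by (intro tendsto_add) auto
    then show ?case using add vV germ_mem by (simp add: germ_add Linf_add V.ip_add_left del: V_simps)
  next
    case (scale a f)
    then have "(\<lambda>k. cnj a * hinner V (germ j f) (v k)) \<longlonglongrightarrow> cnj a * 0"
      by (intro tendsto_mult_left) auto
    then show ?case using scale vV germ_mem by (simp add: germ_scale Linf_mult V.ip_scale_left del: V_simps)
  next
    case (lim F f C)
    have FL: "F n \<in> Linf" for n using lim(1) by blast
    have fC: "cmod (f z) \<le> C" if "z \<in> sphere 0 1" for z
      using LIMSEQ_le_const2[OF tendsto_norm[OF lim(3)[OF that]]] lim(2)[OF that] by blast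
    have "(\<lambda>n. LINT z|\<rho>. (cmod ((f z - F n z) * 1))\<^sup>2) \<longlonglongrightarrow> 0"
    proof (rule tendsto_integral_bounded[where C = "C + C"])
      show "cmod (f z - F n z) \<le> C + C" if "z \<in> sphere 0 1" for n z
        using norm_triangle_ineq4[of "f z" "F n z"] fC[OF that] lim(2)[OF that, of n] by linarith
      show "(\<lambda>n. f z - F n z) \<longlonglongrightarrow> 0" if "z \<in> sphere 0 1" for z
        using tendsto_diff[OF tendsto_const lim(3)[OF that], of "f z"] by simp
    qed (use FL lim(4) in \<open>auto intro: Linf_diff\<close>)
    from tendsto_real_sqrt[OF this]
    have nrm: "(\<lambda>n. hnorm V (hminus V (germ j f) (germ j (F n)))) \<longlonglongrightarrow> 0"
      using FL lim(4) by (simp add: germ_minus[symmetric] nrm_germ Linf_diff)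
    have "\<exists>u\<in>hcarrier V. (\<lambda>k. hinner V u (v k)) \<longlonglongrightarrow> 0 \<and> hnorm V (hminus V (germ j f) u) \<le> \<epsilon>" if e: "\<epsilon> > 0" for \<epsilon>
    proof -
      obtain n where "\<bar>hnorm V (hminus V (germ j f) (germ j (F n)))\<bar> < \<epsilon>"
        using LIMSEQ_D[OF nrm e] by auto
      then show ?thesis using lim(1)[of n] germ_mem[of "F n" j]
        by (intro bexI[of _ "germ j (F n)"]) auto
    qed
    then show ?case using lim(4) ip_tendsto_0_closed[OF v germ_mem[OF lim(4)], of j] by blast
  qed
  fix w assume w: "w \<in> hcarrier V"
  obtain m where m: "w m \<in> Linf" "hnorm V (hminus V w (germ m (w m))) = 0"
    using eventually_germ[OF w] by blast
  show "(\<lambda>k. hinner V w (v k)) \<longlonglongrightarrow> 0"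
    by (rule ip_tendsto_0_closed[OF v w])
      (use m germ[OF m(1), of m] germ_mem[OF m(1)] in \<open>auto intro!: bexI[of _ "germ m (w m)"]\<close>)
qed

sublocale separated_semi_inner_space V germ_seq
proof
  show "germ_seq i \<in> hcarrier V" for i
    by (auto simp: germ_seq_def germ_mem split: prod.split)
qed (rule germ_seq_separating)

subsection \<open>The completed representation\<close>

abbreviation "\<H> \<equiv> completion"

sublocale \<H>: hilbert_space completion
  by (rule hilbert_space_completion)

lemma hminus_mulop: "hminus V (mulop f v) (mulop f w) = mulop f (hminus V v w)"
  by (auto simp: hminus_V mulop_def right_diff_distrib)

lemma lipschitz_mulop:
  assumes f: "f \<in> Linf" shows "lipschitz_op (mulop f)"
proof -
  obtain C where C: "AE z in circle_measure. cmod (f z) \<le> C" using LinfE[OF f] .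
  show ?thesis unfolding lipschitz_op_def
    using mulop_mem[OF f] nrm_mulop[OF f _ C] V.minus_mem
    by (auto simp: hminus_mulop intro!: exI[of _ "\<bar>C\<bar>"])
qed

lemma lipschitz_isometric:
  assumes mem: "\<And>v. v \<in> hcarrier V \<Longrightarrow> T v \<in> hcarrier V"
    and ip: "\<And>v w. v \<in> hcarrier V \<Longrightarrow> w \<in> hcarrier V \<Longrightarrow> hinner V (T v) (T w) = hinner V v w"
  shows "lipschitz_op T"
  unfolding lipschitz_op_def
proof (intro conjI ballI exI[of _ 1] mem)
  fix v w assume vw: "v \<in> hcarrier V" "w \<in> hcarrier V"
  then show "hnorm V (hminus V (T v) (T w)) \<le> 1 * hnorm V (hminus V v w)"
    using mem by (simp add: hnorm_def ip)
qed

lemma lipschitz_shift: "lipschitz_op shift" and lipschitz_unshift: "lipschitz_op unshift"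
  by (auto intro!: lipschitz_isometric shift_mem unshift_mem shift_ip unshift_ip)

abbreviation "act f \<equiv> lift_op (mulop f)"

lemma act_linear: "f \<in> Linf \<Longrightarrow> linear_op \<H> \<H> (act f)"
  by (rule lift_op_linear[OF lipschitz_mulop]) (auto simp: mulop_def distrib_left mult.left_commute)

lemma act_bound:
  assumes "f \<in> Linf" "F \<in> hcarrier \<H>" "AE z in circle_measure. cmod (f z) \<le> C"
  shows "hnorm \<H> (act f F) \<le> \<bar>C\<bar> * hnorm \<H> F"
  by (rule lift_op_bound[OF lipschitz_mulop]) (use assms nrm_mulop in auto)

lemma mulop_AE_eq:
  assumes f: "f \<in> Linf" and g: "g \<in> Linf" and eq: "AE z in circle_measure. f z = g z" and v: "v \<in> hcarrier V"
  shows "hnorm V (hminus V (mulop f v) (mulop g v)) = 0"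
proof -
  have "hminus V (mulop f v) (mulop g v) = mulop (\<lambda>z. f z - g z) v"
    by (auto simp: hminus_V mulop_def left_diff_distrib)
  moreover have "hnorm V (mulop (\<lambda>z. f z - g z) v) \<le> \<bar>0\<bar> * hnorm V v"
  proof (rule nrm_mulop[OF Linf_diff[OF f g] v])
    show "AE z in circle_measure. cmod (f z - g z) \<le> 0" using eq by eventually_elim simp
  qed
  moreover have "0 \<le> hnorm V (hminus V (mulop f v) (mulop g v))"
    using mulop_mem f g v by (intro V.nrm_nonneg V.minus_mem) auto
  ultimately show ?thesis by simp
qed

lemma star_rep_act: "star_rep \<H> (\<lambda>f. act f)"
  unfolding star_rep_def
proof (intro conjI ballI allI impI)
  fix f assume f: "f \<in> Linf"
  obtain C where C: "AE z in circle_measure. cmod (f z) \<le> C" using LinfE[OF f] .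
  show "bounded_op \<H> (act f)"
    unfolding bounded_op_def using act_linear[OF f] act_bound[OF f _ C] by blast
  note lf = lipschitz_mulop[OF f]
  fix x assume x: "x \<in> hcarrier \<H>"
  then obtain v where v: "hCauchy V v" "x = cls v" by auto
  show "act (\<lambda>z. a * f z) x = hscale \<H> a (act f x)" for a
  proof -
    have "act (\<lambda>z. a * f z) x = cls (\<lambda>k. mulop (\<lambda>z. a * f z) (v k))"
      unfolding v(2) by (rule lift_op_cls[OF lipschitz_mulop[OF Linf_mult[OF Linf_const f]] v(1)])
    also have "\<dots> = cls (\<lambda>k. hscale V a (mulop f (v k)))" by (simp add: mulop_def mult.assoc)
    also have "\<dots> = hscale \<H> a (cls (\<lambda>k. mulop f (v k)))"
      using cls_scale[OF lipschitz_op_hCauchy[OF lf v(1)]] by (simp only: completion_simps)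
    finally show ?thesis unfolding v(2) lift_op_cls[OF lf v(1)] .
  qed
  fix g assume g: "g \<in> Linf"
  note lg = lipschitz_mulop[OF g]
  show "act f x = act g x" if "AE z in circle_measure. f z = g z"
    unfolding v(2) lift_op_cls[OF lf v(1)] lift_op_cls[OF lg v(1)]
    using cls_eq_iff[OF lipschitz_op_hCauchy[OF lf v(1)] lipschitz_op_hCauchy[OF lg v(1)]]
      mulop_AE_eq[OF f g that V.hCauchy_mem[OF v(1)]] by simp
  show "act (\<lambda>z. f z + g z) x = hadd \<H> (act f x) (act g x)"
  proof -
    have "act (\<lambda>z. f z + g z) x = cls (\<lambda>k. mulop (\<lambda>z. f z + g z) (v k))"
      unfolding v(2) by (rule lift_op_cls[OF lipschitz_mulop[OF Linf_add[OF f g]] v(1)])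
    also have "\<dots> = cls (\<lambda>k. hadd V (mulop f (v k)) (mulop g (v k)))" by (simp add: mulop_def distrib_right)
    also have "\<dots> = hadd \<H> (cls (\<lambda>k. mulop f (v k))) (cls (\<lambda>k. mulop g (v k)))"
      using cls_add[OF lipschitz_op_hCauchy[OF lf v(1)] lipschitz_op_hCauchy[OF lg v(1)]]
      by (simp only: completion_simps)
    finally show ?thesis unfolding v(2) lift_op_cls[OF lf v(1)] lift_op_cls[OF lg v(1)] .
  qed
  show "act (\<lambda>z. f z * g z) x = act f (act g x)"
  proof -
    have "act (\<lambda>z. f z * g z) x = cls (\<lambda>k. mulop (\<lambda>z. f z * g z) (v k))"
      unfolding v(2) by (rule lift_op_cls[OF lipschitz_mulop[OF Linf_mult[OF f g]] v(1)])
    also have "\<dots> = cls (\<lambda>k. mulop f (mulop g (v k)))" by (simp add: mulop_def mult.assoc)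
    finally show ?thesis unfolding v(2) lift_op_comp[OF lf lg v(1)] .
  qed
  fix y assume y: "y \<in> hcarrier \<H>"
  show "hinner \<H> (act (\<lambda>z. cnj (f z)) x) y = hinner \<H> x (act f y)"
    by (rule lift_op_adjoint[OF lf lipschitz_mulop[OF Linf_cnj[OF f]] x y]) (rule mulop_adjoint[OF f])
next
  fix x assume "x \<in> hcarrier \<H>"
  then obtain v where v: "hCauchy V v" "x = cls v" by auto
  show "act (\<lambda>_. 1) x = x"
    unfolding v(2) lift_op_cls[OF lipschitz_mulop[OF Linf_const] v(1)] by (simp add: mulop_def)
qed

sublocale \<H>: Linf_rep completion "\<lambda>f. lift_op (mulop f)"
  by standard (rule star_rep_act)

text \<open>On a vector \<open>U\<^sup>-\<^sup>j\<pi>(f)\<phi>\<close> this is dominated convergence in \<open>L\<^sup>2(\<rho>)\<close>. These vectors are dense, and the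
  operators are uniformly bounded.\<close>

lemma act_strong_null:
  assumes G: "\<And>n. G n \<in> Linf" and b: "\<And>n z. z \<in> sphere 0 1 \<Longrightarrow> cmod (G n z) \<le> C"
    and lim: "\<And>z. z \<in> sphere 0 1 \<Longrightarrow> (\<lambda>n. G n z) \<longlonglongrightarrow> 0" and y: "y \<in> hcarrier \<H>"
  shows "(\<lambda>n. hnorm \<H> (act (G n) y)) \<longlonglongrightarrow> 0"
proof (rule LIMSEQ_I)
  fix \<epsilon> :: real assume e: "\<epsilon> > 0"
  have "hdense \<H> (emb ` {germ j f |j f. f \<in> Linf})" by (rule hdense_emb[OF hdense_germs])
  moreover have "\<epsilon> / (2 * (\<bar>C\<bar> + 1)) > 0" using e by simp
  ultimately have "\<exists>u\<in>emb ` {germ j f |j f. f \<in> Linf}. hnorm \<H> (hminus \<H> y u) < \<epsilon> / (2 * (\<bar>C\<bar> + 1))"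
    using y unfolding hdense_def by blast
  then obtain j f where f: "f \<in> Linf" "hnorm \<H> (hminus \<H> y (emb (germ j f))) < \<epsilon> / (2 * (\<bar>C\<bar> + 1))"
    by blast
  define u where "u = emb (germ j f)"
  have u: "u \<in> hcarrier \<H>" unfolding u_def by (rule emb_mem[OF germ_mem[OF f(1)]])
  have eq: "hnorm \<H> (act (G n) u) = sqrt (LINT z|\<rho>. (cmod (G n (z ^ (N ^ j)) * f z))\<^sup>2)" for n
  proof -
    note mem = mulop_mem[OF G[of n] germ_mem[OF f(1), of j]]
    have "hnorm \<H> (act (G n) u) = hnorm V (mulop (G n) (germ j f))"
      unfolding u_def lift_op_emb[OF lipschitz_mulop[OF G] germ_mem[OF f(1)]]
      by (simp add: hnorm_def hinner_emb mem)
    also have "hinner V (mulop (G n) (germ j f)) (mulop (G n) (germ j f)) =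
        form (mulop (G n) (germ j f) j) (mulop (G n) (germ j f) j)"
      by (rule hinner_V_from[OF mem mem, of j])
        (auto simp: mulop_def germ_step dilate_def power_mult mult_ac)
    then have "hnorm V (mulop (G n) (germ j f)) = sqrt (LINT z|\<rho>. (cmod (mulop (G n) (germ j f) j z))\<^sup>2)"
      by (simp add: hnorm_def form_self)
    finally show ?thesis by (simp add: mulop_def germ_def)
  qed
  have "(\<lambda>n. LINT z|\<rho>. (cmod (G n (z ^ (N ^ j)) * f z))\<^sup>2) \<longlonglongrightarrow> 0"
    by (rule tendsto_integral_bounded[where C = C]) (auto intro!: Linf_pow G b lim f simp: norm_power)
  from tendsto_real_sqrt[OF this] have "(\<lambda>n. hnorm \<H> (act (G n) u)) \<longlonglongrightarrow> 0" by (simp add: eq)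
  from LIMSEQ_D[OF this, of "\<epsilon> / 2"] e
  obtain n0 where n0: "\<And>n. n \<ge> n0 \<Longrightarrow> \<bar>hnorm \<H> (act (G n) u)\<bar> < \<epsilon> / 2" by auto
  have "norm (hnorm \<H> (act (G n) y) - 0) < \<epsilon>" if n: "n \<ge> n0" for n
  proof -
    note Gy = \<H>.rep_mem[OF G y, of n] and Gu = \<H>.rep_mem[OF G u, of n]
    have "hminus \<H> (act (G n) y) (act (G n) u) = act (G n) (hminus \<H> y u)"
      using act_linear[OF G, of n] y u unfolding hminus_def linear_op_def by (metis \<H>.scale_mem)
    moreover have "hnorm \<H> (act (G n) (hminus \<H> y u)) \<le> \<bar>C\<bar> * hnorm \<H> (hminus \<H> y u)"
      by (rule act_bound[OF G]) (use y u b in \<open>auto intro!: \<H>.minus_mem AE_I2 simp del: completion_simps\<close>)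
    moreover have "\<bar>C\<bar> * hnorm \<H> (hminus \<H> y u) \<le> \<epsilon> / 2"
    proof -
      have "\<bar>C\<bar> * hnorm \<H> (hminus \<H> y u) \<le> (\<bar>C\<bar> + 1) * (\<epsilon> / (2 * (\<bar>C\<bar> + 1)))"
        using f(2) \<H>.nrm_nonneg[OF \<H>.minus_mem[OF y u]] unfolding u_def by (intro mult_mono) auto
      also have "\<dots> = \<epsilon> / 2" by (simp add: field_simps add_eq_0_iff_both_eq_0)
      finally show ?thesis .
    qed
    ultimately have "hnorm \<H> (hminus \<H> (act (G n) y) (act (G n) u)) \<le> \<epsilon> / 2" by simp
    then show ?thesis
      using \<H>.nrm_le_add_minus[OF Gy Gu] n0[OF n] \<H>.nrm_nonneg[OF Gy] by simp
  qed
  then show "\<exists>no. \<forall>n\<ge>no. norm (hnorm \<H> (act (G n) y) - 0) < \<epsilon>" by blast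
qed

sublocale \<H>: normal_Linf_rep completion "\<lambda>f. lift_op (mulop f)"
proof
  fix F :: "nat \<Rightarrow> complex \<Rightarrow> complex" and f C x y
  assume F: "\<And>n. F n \<in> Linf" and f: "f \<in> Linf"
    and b: "\<And>n z. z \<in> sphere 0 1 \<Longrightarrow> cmod (F n z) \<le> C"
    and lim: "\<And>z. z \<in> sphere 0 1 \<Longrightarrow> (\<lambda>n. F n z) \<longlonglongrightarrow> f z"
    and x: "x \<in> hcarrier \<H>" and y: "y \<in> hcarrier \<H>"
  have fC: "cmod (f z) \<le> C" if "z \<in> sphere 0 1" for z
    using LIMSEQ_le_const2[OF tendsto_norm[OF lim[OF that]]] b[OF that] by blast
  have L: "(\<lambda>z. F n z - f z) \<in> Linf" for n by (intro Linf_diff F f)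
  have null: "(\<lambda>n. hnorm \<H> (act (\<lambda>z. F n z - f z) y)) \<longlonglongrightarrow> 0"
  proof (rule act_strong_null[OF L _ _ y])
    show "cmod (F n z - f z) \<le> C + C" if "z \<in> sphere 0 1" for n z
      using norm_triangle_ineq4[of "F n z" "f z"] fC[OF that] b[OF that, of n] by linarith
    show "(\<lambda>n. F n z - f z) \<longlonglongrightarrow> 0" if "z \<in> sphere 0 1" for z
      using tendsto_diff[OF lim[OF that] tendsto_const, of "f z"] by simp
  qed
  show "(\<lambda>n. hinner \<H> x (act (F n) y)) \<longlonglongrightarrow> hinner \<H> x (act f y)"
  proof (rule \<H>.tendsto_ip[OF _ _ x _ \<H>.hlim_const[OF x]])
    have "hminus \<H> (act (F n) y) (act f y) = act (\<lambda>z. F n z - f z) y" for n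
      using \<H>.rep_add[OF F Linf_mult[OF Linf_const f] y, of n "- 1"] \<H>.rep_scale[OF f y, of "- 1"]
      by (simp add: hminus_def)
    then show "hlim \<H> (\<lambda>n. act (F n) y) (act f y)"
      using null by (simp only: hlim_def)
  qed (use x y f F in \<open>auto simp del: completion_simps\<close>)
qed

end

lemma hdense_mono: "hdense H D \<Longrightarrow> D \<subseteq> D' \<Longrightarrow> D' \<subseteq> hcarrier H \<Longrightarrow> hdense H D'"
  unfolding hdense_def by (meson subset_iff)

context scaling_data
begin

definition the_rep :: "(nat \<Rightarrow> complex) rep" where
  "the_rep = \<lparr>rspace = completion, rfun = (\<lambda>f. lift_op (mulop f)), runi = lift_op shift,
     rvec = emb (germ 0 (\<lambda>_. 1))\<rparr>"

lemma the_rep_simps [simp]: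
  "rspace the_rep = \<H>" "rfun the_rep f = act f" "runi the_rep = lift_op shift"
  "rvec the_rep = emb (germ 0 (\<lambda>_. 1))"
  by (simp_all add: the_rep_def)

lemma shift_unshift_lift: "F \<in> hcarrier \<H> \<Longrightarrow> lift_op shift (lift_op unshift F) = F"
  using lift_op_comp[OF lipschitz_shift lipschitz_unshift] by (auto simp: shift_unshift)

lemma unshift_shift_lift:
  assumes "F \<in> hcarrier \<H>" shows "lift_op unshift (lift_op shift F) = F"
proof -
  obtain v where v: "hCauchy V v" "F = cls v" using assms by auto
  have "cls (\<lambda>k. unshift (shift (v k))) = cls v"
    by (rule cls_eqI[OF lipschitz_op_hCauchy[OF lipschitz_unshift lipschitz_op_hCauchy[OF lipschitz_shift v(1)]] v(1)])
      (rule unshift_shift_ip[OF V.hCauchy_mem[OF v(1)]])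
  then show ?thesis using lift_op_comp[OF lipschitz_unshift lipschitz_shift v(1)] v(2) by simp
qed

lemma shift_linear: "linear_op \<H> \<H> (lift_op shift)" and unshift_linear: "linear_op \<H> \<H> (lift_op unshift)"
proof -
  show "linear_op \<H> \<H> (lift_op shift)"
    by (rule lift_op_linear[OF lipschitz_shift]) (auto simp: shift_def)
  show "linear_op \<H> \<H> (lift_op unshift)"
    by (rule lift_op_linear[OF lipschitz_unshift]) (auto simp: unshift_def fun_eq_iff split: nat.split)
qed

lemma unitary_shift: "unitary_op \<H> \<H> (lift_op shift)"
  unfolding unitary_op_def
proof (intro conjI ballI shift_linear)
  show "bij_betw (lift_op shift) (hcarrier \<H>) (hcarrier \<H>)"
    by (rule bij_betwI[where g = "lift_op unshift"])
      (use lift_op_mem[OF lipschitz_shift] lift_op_mem[OF lipschitz_unshift] shift_unshift_lift unshift_shift_lift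
        in \<open>auto simp del: completion_simps\<close>)
  show "hinner \<H> (lift_op shift F) (lift_op shift G) = hinner \<H> F G"
    if "F \<in> hcarrier \<H>" "G \<in> hcarrier \<H>" for F G
    by (rule lift_op_isometric[OF lipschitz_shift that shift_ip])
qed

lemma inv_shift:
  assumes F: "F \<in> hcarrier \<H>" shows "inv_into (hcarrier \<H>) (lift_op shift) F = lift_op unshift F"
proof -
  have "inj_on (lift_op shift) (hcarrier \<H>)"
    using unitary_shift by (simp add: unitary_op_def bij_betw_def)
  then show ?thesis
    using inv_into_f_f[of "lift_op shift" "hcarrier \<H>" "lift_op unshift F"]
      lift_op_mem[OF lipschitz_unshift F] shift_unshift_lift[OF F] by simp
qed

lemma covariant:
  assumes f: "f \<in> Linf" and F: "F \<in> hcarrier \<H>"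
  shows "lift_op shift (act f (lift_op unshift F)) = act (\<lambda>z. f (z ^ N)) F"
proof -
  obtain v where v: "hCauchy V v" "F = cls v" using F by auto
  note c1 = lipschitz_op_hCauchy[OF lipschitz_unshift v(1)]
  have "lift_op shift (act f (lift_op unshift F)) = cls (\<lambda>k. shift (mulop f (unshift (v k))))"
    unfolding v(2) lift_op_cls[OF lipschitz_unshift v(1)]
    by (rule lift_op_comp[OF lipschitz_shift lipschitz_mulop[OF f] c1])
  also have "\<dots> = cls (\<lambda>k. mulop (\<lambda>z. f (z ^ N)) (v k))"
    by (simp add: shift_def mulop_def unshift_def power_mult[symmetric] mult.commute)
  also have "\<dots> = act (\<lambda>z. f (z ^ N)) F"
    unfolding v(2) lift_op_cls[OF lipschitz_mulop[OF Linf_power_comp[OF N f]] v(1)] ..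
  finally show ?thesis .
qed

lemma mulop_germ: "mulop f (germ 0 g) = germ 0 (\<lambda>z. f z * g z)"
proof
  fix k
  have "(dil ^^ k) (\<lambda>z. f z * g z) = (\<lambda>z. f (z ^ (N ^ k)) * (dil ^^ k) g z)"
    by (induction k) (auto simp: dilate_def power_mult mult_ac)
  then show "mulop f (germ 0 g) k = germ 0 (\<lambda>z. f z * g z) k"
    by (simp add: mulop_def germ_def)
qed

lemma act_vec: "f \<in> Linf \<Longrightarrow> act f (emb (germ 0 (\<lambda>_. 1))) = emb (germ 0 f)"
  by (simp add: lift_op_emb lipschitz_mulop germ_mem mulop_germ)

lemma shift_germ: "shift (germ 0 f) = germ 0 (dil f)"
  by (simp add: shift_def germ_def funpow_Suc_right del: funpow.simps)

lemma unshift_germ: "unshift (germ j f) = germ (Suc j) f"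
  by (auto simp: unshift_def germ_def fun_eq_iff split: nat.split)

definition germ_word :: "nat \<Rightarrow> (complex \<Rightarrow> complex) \<Rightarrow> alg_term" where
  "germ_word j f = (Times UniInv ^^ j) (Fn f)"

lemma germ_word_simps [simp]:
  "germ_word 0 f = Fn f" "germ_word (Suc j) f = Times UniInv (germ_word j f)"
  by (simp_all add: germ_word_def)

lemma germ_word_wf: "f \<in> Linf \<Longrightarrow> alg_wf (germ_word j f)"
  by (induction j) auto

lemma germ_word_linear:
  assumes f: "f \<in> Linf" shows "linear_op \<H> \<H> (alg_eval the_rep (germ_word j f))"
proof (induction j)
  case 0
  then show ?case using act_linear[OF f] by simp
next
  case (Suc j)
  let ?T = "alg_eval the_rep (germ_word j f)"
  have mem: "?T F \<in> hcarrier \<H>" if "F \<in> hcarrier \<H>" for F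
    using Suc that unfolding linear_op_def by blast
  have "linear_op \<H> \<H> (\<lambda>F. lift_op unshift (?T F))"
    using Suc unshift_linear unfolding linear_op_def by metis
  moreover have "alg_eval the_rep (germ_word (Suc j) f) F = lift_op unshift (?T F)" if "F \<in> hcarrier \<H>" for F
    using inv_shift[OF mem[OF that]] by simp
  ultimately show ?case
    unfolding linear_op_def by (metis \<H>.add_mem \<H>.scale_mem)
qed

lemma germ_word_vec:
  assumes f: "f \<in> Linf"
  shows "alg_eval the_rep (germ_word j f) (rvec the_rep) = emb (germ j f)"
proof (induction j)
  case 0
  then show ?case using act_vec[OF f] by simp
next
  case (Suc j)
  have "inv_into (hcarrier \<H>) (lift_op shift) (emb (germ j f)) = emb (germ (Suc j) f)"
    using inv_shift[OF emb_mem[OF germ_mem[OF f]]] lift_op_emb[OF lipschitz_unshift germ_mem[OF f]]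
    by (simp only: unshift_germ)
  then show ?case using Suc by simp
qed

lemma cyclic_the_rep: "cyclic_vector the_rep"
  unfolding cyclic_vector_def
proof
  show "rvec the_rep \<in> hcarrier (rspace the_rep)"
    using emb_mem[OF germ_mem[OF Linf_const]] by simp
  let ?C = "{A (rvec the_rep) |A. A \<in> alg_image the_rep}"
  have "rvec the_rep \<in> hcarrier \<H>" using emb_mem[OF germ_mem[OF Linf_const]] by simp
  then have sub: "?C \<subseteq> hcarrier \<H>"
    unfolding alg_image_def linear_op_def by (auto simp del: completion_simps the_rep_simps(2-))
  have "emb (germ j f) \<in> ?C" if f: "f \<in> Linf" for j f
  proof -
    let ?A = "alg_eval the_rep (germ_word j f)"
    have mem: "?A F \<in> hcarrier \<H>" if "F \<in> hcarrier \<H>" for F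
      using germ_word_linear[OF f, of j] that unfolding linear_op_def by blast
    have "op_tendsto \<H> (\<lambda>_. ?A) ?A"
      by (rule op_tendsto_const[OF \<H>.semi_inner_space_axioms mem])
    then have "?A \<in> alg_image the_rep"
      unfolding alg_image_def the_rep_simps(1)
      using germ_word_linear[OF f, of j] germ_word_wf[OF f, of j]
      by (intro CollectI exI[of _ "\<lambda>_. germ_word j f"]) blast
    then show ?thesis using germ_word_vec[OF f, of j] by (metis (mono_tags, lifting) mem_Collect_eq)
  qed
  then have "emb ` {germ j f |j f. f \<in> Linf} \<subseteq> ?C"
    by (intro image_subsetI) (elim CollectE exE conjE, simp only:)
  then have "hdense \<H> ?C"
    by (rule hdense_mono[OF hdense_emb[OF hdense_germs] _ sub])
  then show "Metric_space.mtopology (hcarrier (rspace the_rep)) (hdist (rspace the_rep)) closure_of ?C =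
      hcarrier (rspace the_rep)"
    using \<H>.closure_of_eq_carrier_iff[OF sub] by (simp only: the_rep_simps(1))
qed

lemma the_rep_scaling: "the_rep \<in> scaling_reps N m0"
  unfolding scaling_reps_def normal_cyclic_rep_def mem_Collect_eq
proof (intro conjI ballI)
  show "hilbert_space (rspace the_rep)" by (simp add: hilbert_space_completion)
  show "star_rep (rspace the_rep) (rfun the_rep)" using star_rep_act by (simp add: the_rep_def)
  show "unitary_op (rspace the_rep) (rspace the_rep) (runi the_rep)" using unitary_shift by simp
  show "cyclic_vector the_rep" by (rule cyclic_the_rep)
  show "runi the_rep (rfun the_rep f (inv_into (hcarrier (rspace the_rep)) (runi the_rep) x)) =
      rfun the_rep (\<lambda>z. f (z ^ N)) x" if "f \<in> Linf" "x \<in> hcarrier (rspace the_rep)" for f x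
    using that inv_shift[of x] covariant[of f x] by (simp del: completion_simps)
  have vec: "rvec the_rep \<in> hcarrier \<H>" using emb_mem[OF germ_mem[OF Linf_const]] by simp
  show "\<exists>E. spectral_resolution (rspace the_rep) (rfun the_rep (monom_fun 1)) E \<and>
        (\<forall>f\<in>Linf. is_spectral_integral (rspace the_rep) E f (rfun the_rep f)) \<and>
        absolutely_continuous circle_measure (scalar_spectral_measure (rspace the_rep) E (rvec the_rep))"
    using \<H>.spectral_resolution_rep \<H>.is_spectral_integral_rep
      \<H>.absolutely_continuous_scalar_spectral_measure[OF vec]
    by (intro exI[of _ "\<lambda>S. act (indicator S)"]) simp
  show "runi the_rep (rvec the_rep) = rfun the_rep m0 (rvec the_rep)"
  proof -
    have "dil (\<lambda>_. 1) = m0" by (simp add: dilate_def)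
    then show ?thesis
      using act_vec[OF m0] lift_op_emb[OF lipschitz_shift germ_mem[OF Linf_const[of 1], of 0]]
      by (simp add: shift_germ)
  qed
qed

lemma the_rep_density:
  assumes f: "f \<in> Linf"
  shows "hinner (rspace the_rep) (rvec the_rep) (rfun the_rep f (rvec the_rep)) = (LINT z|\<rho>. f z)"
  using act_vec[OF f] hinner_emb[OF germ_mem[OF Linf_const] germ_mem[OF f]] ip_germ[OF Linf_const[of 1] f, of 0]
  by (simp add: form_def)

end

section \<open>The correspondence\<close>

text \<open>Testing \<open>R h = h\<close> against \<open>f\<close> gives the invariance of \<open>h d\<mu>\<close> that the construction needs.\<close>

lemma scaling_rep_exists:
  assumes N: "N > 0" and m0: "m0 \<in> Linf" and h: "h \<in> ruelle_harmonic N m0"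
  shows "\<exists>r\<in>(scaling_reps N m0 :: (nat \<Rightarrow> complex) rep set). has_density r h"
proof -
  have i: "integrable circle_measure h" and pos: "AE z in circle_measure. h z \<in> \<real>\<^sub>\<ge>\<^sub>0"
    and R: "AE z in circle_measure. ruelle N m0 h z = h z"
    using h by (auto simp: ruelle_harmonic_def)
  define g where "g z = Re (h z)" for z
  have gi: "integrable circle_measure g" unfolding g_def using i by simp
  have g0: "AE z in circle_measure. 0 \<le> g z"
    using pos by eventually_elim (simp add: g_def complex_nonneg_Reals_iff)
  have gh: "AE z in circle_measure. complex_of_real (g z) = h z"
    using pos by eventually_elim (simp add: g_def complex_nonneg_Reals_iff complex_eq_iff)
  define \<rho> where "\<rho> = density circle_measure (\<lambda>z. ennreal (g z))"
  have int: "(LINT z|\<rho>. f z) = (LINT z|circle_measure. f z * h z)" if f: "f \<in> Linf" for f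
  proof -
    have "(LINT z|\<rho>. f z) = (LINT z|circle_measure. g z *\<^sub>R f z)"
      unfolding \<rho>_def using gi by (intro integral_density Linf_measurable[OF f] g0) auto
    also have "\<dots> = (LINT z|circle_measure. f z * h z)"
    proof (rule integral_cong_AE)
      show "AE z in circle_measure. g z *\<^sub>R f z = f z * h z"
        using gh by eventually_elim (simp add: scaleR_conv_of_real mult.commute)
    qed (use borel_measurable_integrable[OF gi] borel_measurable_integrable[OF i] Linf_measurable[OF f] in auto)
    finally show ?thesis .
  qed
  interpret scaling_data N m0 \<rho>
  proof (rule scaling_data.intro)
    have "emeasure \<rho> (space \<rho>) = (\<integral>\<^sup>+ z. ennreal (g z) \<partial>circle_measure)"
      unfolding \<rho>_def using gi sets.top[of circle_measure]
      by (subst emeasure_density) (auto intro!: nn_integral_cong)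
    also have "\<dots> < \<infinity>"
      using gi g0 by (simp add: nn_integral_eq_integral)
    finally show "finite_measure \<rho>" by (intro finite_measureI) simp
    show "absolutely_continuous circle_measure \<rho>"
      unfolding \<rho>_def using gi by (intro absolutely_continuousI_density) auto
    fix f assume f: "f \<in> Linf"
    have F: "(\<lambda>z. of_real ((cmod (m0 z))\<^sup>2) * f (z ^ N)) \<in> Linf"
      by (intro Linf_mult Linf_cmod_square Linf_power_comp N m0 f)
    have "(LINT z|circle_measure. f z * ruelle N m0 h z) = (LINT z|circle_measure. f z * h z)"
    proof (rule integral_cong_AE)
      show "AE z in circle_measure. f z * ruelle N m0 h z = f z * h z" using R by eventually_elim simp
    qed (use borel_measurable_integrable[OF integrable_ruelle[OF N m0 i]] borel_measurable_integrable[OF i]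
        Linf_measurable[OF f] in auto)
    then show "(LINT z|\<rho>. of_real ((cmod (m0 z))\<^sup>2) * f (z ^ N)) = (LINT z|\<rho>. f z)"
      unfolding int[OF F] int[OF f] integral_ruelle[OF N m0 i f] .
  qed (use N m0 in \<open>auto simp: \<rho>_def\<close>)
  have "has_density the_rep h"
    unfolding has_density_def using the_rep_density int by metis
  then show ?thesis using the_rep_scaling by blast
qed

lemma scaling_repI: "N \<ge> 2 \<Longrightarrow> m0 \<in> Linf \<Longrightarrow> r \<in> scaling_reps N m0 \<Longrightarrow> scaling_rep N m0 r"
  by (simp add: scaling_rep_def)

text \<open>The classes of representations are therefore the fibres of the density, which makes the
  correspondence well defined and injective.\<close>

lemma unitarily_equivalent_iff_same_density:
  fixes r :: "'a rep" and s :: "'b rep"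
  assumes "N \<ge> 2" "m0 \<in> Linf" "r \<in> scaling_reps N m0" "s \<in> scaling_reps N m0" and h: "has_density r h"
  shows "unitarily_equivalent r s \<longleftrightarrow> has_density s h"
proof -
  interpret scaling_rep_pair N m0 r s
    using assms by (simp add: scaling_rep_pair_def scaling_repI)
  show ?thesis
    using unitarily_equivalent_if_same_density[OF h] unitarily_equivalent_has_density[OF _ h] by blast
qed

theorem theorem2p4:
  fixes N :: nat and m0 :: "complex \<Rightarrow> complex"
  assumes "N \<ge> 2"
    and "m0 \<in> Linf"
    and "\<And>S. S \<in> sets circle_measure \<Longrightarrow> emeasure circle_measure S > 0 \<Longrightarrow> \<not> (\<forall>z\<in>S. m0 z = 0)"
  shows
    "(\<exists>\<Phi>. bij_betw \<Phi> (ruelle_harmonic N m0 // L1_eq)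
          ((scaling_reps N m0 :: (nat \<Rightarrow> complex) rep set) // rep_eq N m0) \<and>
        (\<forall>h\<in>ruelle_harmonic N m0.
          \<Phi> (L1_eq `` {h}) = {r \<in> scaling_reps N m0. has_density r h}) \<and>
        (\<forall>r\<in>scaling_reps N m0.
          inv_into (ruelle_harmonic N m0 // L1_eq) \<Phi> (rep_eq N m0 `` {r}) = h_phi r)) \<and>
     (\<forall>r\<in>(scaling_reps N m0 :: 'a rep set).
        (\<exists>r0\<in>(scaling_reps N m0 :: (nat \<Rightarrow> complex) rep set). unitarily_equivalent r r0) \<and>
        (\<exists>h\<in>ruelle_harmonic N m0. h_phi r = L1_eq `` {h} \<and> has_density r h)) \<and>
     (\<forall>h\<in>ruelle_harmonic N m0.
        \<forall>r\<in>(scaling_reps N m0 :: 'a rep set). \<forall>s\<in>(scaling_reps N m0 :: 'b rep set).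
          has_density r h \<longrightarrow> has_density s h \<longrightarrow> unitarily_equivalent r s)"
proof -
  let ?X = "ruelle_harmonic N m0" and ?R = "scaling_reps N m0 :: (nat \<Rightarrow> complex) rep set"
  have N: "N > 0" using assms(1) by simp
  note m0 = assms(2)
  have int: "integrable circle_measure h" if "h \<in> ?X" for h
    using that by (simp add: ruelle_harmonic_def)
  have ex: "\<exists>r\<in>?R. has_density r h" if "h \<in> ?X" for h
    using scaling_rep_exists[OF N m0 that] .
  define \<Phi> where "\<Phi> X = {r \<in> ?R. \<exists>h\<in>X. has_density r h}" for X
  have \<Phi>: "\<Phi> (L1_eq `` {h}) = {r \<in> ?R. has_density r h}" if h: "h \<in> ?X" for h
  proof -
    have "has_density r g \<longleftrightarrow> has_density r h" if "(h, g) \<in> L1_eq" for r :: "(nat \<Rightarrow> complex) rep" and g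
      using that has_density_cong_AE[of r h g] has_density_cong_AE[of r g h]
      by (auto simp: L1_eq_def eq_commute)
    moreover have "(h, h) \<in> L1_eq" using int[OF h] by (simp add: L1_eq_def)
    ultimately show ?thesis unfolding \<Phi>_def by blast
  qed
  have cls: "rep_eq N m0 `` {r} = {s \<in> ?R. has_density s h}" if "r \<in> ?R" "has_density r h" for r h
    using that unitarily_equivalent_iff_same_density[OF assms(1) m0, of r _ h] by (auto simp: rep_eq_def)
  have dens: "\<exists>h\<in>?X. has_density r h" if "r \<in> ?R" for r
    using scaling_rep.harmonic_density_exists[OF scaling_repI[OF assms(1) m0 that]] .
  have bij: "bij_betw \<Phi> (?X // L1_eq) (?R // rep_eq N m0)"
  proof (rule bij_betw_imageI)
    show "inj_on \<Phi> (?X // L1_eq)"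
    proof (rule inj_onI)
      fix X Y assume X: "X \<in> ?X // L1_eq" and Y: "Y \<in> ?X // L1_eq" and eq: "\<Phi> X = \<Phi> Y"
      obtain h where h: "h \<in> ?X" "X = L1_eq `` {h}" using X by (rule quotientE)
      obtain g where g: "g \<in> ?X" "Y = L1_eq `` {g}" using Y by (rule quotientE)
      obtain r where r: "r \<in> ?R" "has_density r h" using ex[OF h(1)] by blast
      have "r \<in> \<Phi> X" using r \<Phi>[OF h(1)] h(2) by simp
      then have "r \<in> \<Phi> Y" by (simp only: eq)
      then have "has_density r g" using \<Phi>[OF g(1)] g(2) by simp
      note l = scaling_repI[OF assms(1) m0 r(1)]
      show "X = Y"
        using scaling_rep.h_phi_eq[OF l int[OF h(1)] r(2)]
          scaling_rep.h_phi_eq[OF l int[OF g(1)] \<open>has_density r g\<close>] h(2) g(2) by simp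
    qed
    show "\<Phi> ` (?X // L1_eq) = ?R // rep_eq N m0"
    proof (intro equalityI subsetI)
      fix Y assume "Y \<in> \<Phi> ` (?X // L1_eq)"
      then obtain X where X: "X \<in> ?X // L1_eq" "Y = \<Phi> X" by blast
      obtain h where h: "h \<in> ?X" "X = L1_eq `` {h}" using X(1) by (rule quotientE)
      obtain r where r: "r \<in> ?R" "has_density r h" using ex[OF h(1)] by blast
      have "Y = rep_eq N m0 `` {r}" using X(2) h(2) \<Phi>[OF h(1)] cls[OF r] by simp
      then show "Y \<in> ?R // rep_eq N m0" using quotientI[OF r(1)] by simp
    next
      fix Y assume "Y \<in> ?R // rep_eq N m0"
      then obtain r where r: "r \<in> ?R" "Y = rep_eq N m0 `` {r}" by (rule quotientE)
      obtain h where h: "h \<in> ?X" "has_density r h" using dens[OF r(1)] by blast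
      have "Y = \<Phi> (L1_eq `` {h})" using r(2) \<Phi>[OF h(1)] cls[OF r(1) h(2)] by simp
      then show "Y \<in> \<Phi> ` (?X // L1_eq)" using quotientI[OF h(1)] by blast
    qed
  qed
  have inv: "inv_into (?X // L1_eq) \<Phi> (rep_eq N m0 `` {r}) = h_phi r" if r: "r \<in> ?R" for r
  proof -
    obtain h where h: "h \<in> ?X" "has_density r h" using dens[OF r] by blast
    have "h_phi r = L1_eq `` {h}"
      by (rule scaling_rep.h_phi_eq[OF scaling_repI[OF assms(1) m0 r] int[OF h(1)] h(2)])
    moreover have "rep_eq N m0 `` {r} = \<Phi> (L1_eq `` {h})" using \<Phi>[OF h(1)] cls[OF r h(2)] by simp
    ultimately show ?thesis
      using inv_into_f_f[OF bij_betw_imp_inj_on[OF bij] quotientI[OF h(1)]] by simp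
  qed
  have "(\<exists>r0\<in>?R. unitarily_equivalent r r0) \<and>
      (\<exists>h\<in>?X. h_phi r = L1_eq `` {h} \<and> has_density r h)" if r: "r \<in> scaling_reps N m0" for r :: "'a rep"
  proof -
    interpret scaling_rep N m0 r by (rule scaling_repI[OF assms(1) m0 r])
    obtain h where h: "h \<in> ?X" "has_density r h" using harmonic_density_exists by blast
    obtain r0 where r0: "r0 \<in> ?R" "has_density r0 h" using ex[OF h(1)] by blast
    then have "unitarily_equivalent r r0"
      using unitarily_equivalent_iff_same_density[OF assms(1) m0 r r0(1) h(2)] by blast
    then show ?thesis using r0(1) h h_phi_eq[OF int[OF h(1)] h(2)] by blast
  qed
  moreover have "unitarily_equivalent r s"
    if "r \<in> scaling_reps N m0" "s \<in> scaling_reps N m0" "has_density r h" "has_density s h"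
    for r :: "'a rep" and s :: "'b rep" and h
    using unitarily_equivalent_iff_same_density[OF assms(1) m0 that(1,2,3)] that(4) by blast
  ultimately show ?thesis
    using bij \<Phi> inv by (intro conjI exI[of _ \<Phi>] ballI impI) blast+
qed

end
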